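(* Let $H$ be a Hopf manifold, that is, $H=\frac{\mathbb{C}^n\setminus\{0\}}{\langle\gamma\rangle}$, where $\gamma:\mathbb{C}^n\to\mathbb{C}^n$ is an invertible (not necessarily linear) holomorphic contraction centered in $0$. Then $H$ admits an LCK metric with potential.
   Context: A holomorphic contraction of $\mathbb{C}^n$ centered in $0$ is a holomorphic map $\gamma:\mathbb{C}^n\to\mathbb{C}^n$ with $\gamma(0)=0$ such that for each compact subset $K\subset\mathbb{C}^n$ and each open neighbourhood $U\ni 0$ there exists $N>0$ such that $\gamma^m(K)\subset U$ for every integer $m>N$. It is invertible if it is a biholomorphic automorphism of $\mathbb{C}^n$; $\langle\gamma\rangle$ denotes the cyclic group generated by $\gamma$. A complex manifold $M$ is locally conformally Kähler (LCK) if it admits a covering $\tilde M$ (with the pulled-back complex structure) equipped with a Kähler metric $\tilde\omega$ such that the deck group of the covering acts on $(\tilde M,\tilde\omega)$ by holomorphic homotheties (each deck transformation multiplies $\tilde\omega$ by a positive constant). An LCK metric on $M$ is a Hermitian metric on $M$ whose pullback to $\tilde M$ is conformal to $\tilde\omega$. The LCK manifold has LCK potential (one says it is an LCK manifold with potential, or admits an LCK metric with potential) if it admits such a Kähler covering $(\tilde M,\tilde\omega)$ on which the Kähler metric has a global positive Kähler potential $\psi:\tilde M\to\mathbb{R}_{>0}$ (i.e. $\tilde\omega=dd^c\psi$, a positive constant multiple of $\sqrt{-1}\,\partial\bar\partial\psi$) such that each element of the deck group multiplies $\psi$ by a constant. *)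

theory Defs
  imports "HOL-Analysis.Analysis" "HOL-Algebra.Generated_Groups" "HOL-Algebra.Bij"
begin

section \<open>Smooth and holomorphic maps on open subsets of coordinate space\<close>

primrec Ck_on :: "nat \<Rightarrow> 'a::real_normed_vector set \<Rightarrow> ('a \<Rightarrow> 'b::real_normed_vector) \<Rightarrow> bool" where
  "Ck_on 0 S f \<longleftrightarrow> continuous_on S f"
| "Ck_on (Suc k) S f \<longleftrightarrow>
     (\<forall>x\<in>S. f differentiable (at x)) \<and> (\<forall>v. Ck_on k S (\<lambda>x. frechet_derivative f (at x) v))"

text \<open>Meaningful for open \<open>S\<close> only, since derivatives are taken in the ambient space; the same
  remark applies to \<open>holo_on\<close>.\<close>

definition smooth_on :: "'a::real_normed_vector set \<Rightarrow> ('a \<Rightarrow> 'b::real_normed_vector) \<Rightarrow> bool" where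
  "smooth_on S f \<longleftrightarrow> (\<forall>k. Ck_on k S f)"

definition holo_on :: "(complex^'n) set \<Rightarrow> (complex^'n \<Rightarrow> complex^'m) \<Rightarrow> bool" where
  "holo_on S f \<longleftrightarrow>
     (\<forall>x\<in>S. \<exists>D. (f has_derivative D) (at x) \<and> Vector_Spaces.linear (*s) (*s) D)"

section \<open>Complex manifolds\<close>

text \<open>A chart is a pair of its domain and its coordinate map; values of the coordinate map outside
  the domain are irrelevant. A manifold is given by a topology and an atlas.\<close>

type_synonym ('a, 'n) chart = "'a set \<times> ('a \<Rightarrow> complex^'n)"

definition coord_rep ::
  "('a, 'n::finite) chart \<Rightarrow> ('b, 'm::finite) chart \<Rightarrow> ('a \<Rightarrow> 'b) \<Rightarrow> complex^'n \<Rightarrow> complex^'m" where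
  "coord_rep c d F = snd d \<circ> F \<circ> inv_into (fst c) (snd c)"

definition holomorphic_map ::
  "('a, 'n::finite) chart set \<Rightarrow> ('b, 'm::finite) chart set \<Rightarrow> 'a topology \<Rightarrow> 'b topology \<Rightarrow> ('a \<Rightarrow> 'b) \<Rightarrow> bool" where
  "holomorphic_map A B X Y F \<longleftrightarrow> continuous_map X Y F \<and>
     (\<forall>c\<in>A. \<forall>d\<in>B. holo_on (snd c ` {p\<in>fst c. F p \<in> fst d}) (coord_rep c d F))"

definition complex_manifold :: "'a topology \<Rightarrow> ('a, 'n::finite) chart set \<Rightarrow> bool" where
  "complex_manifold X A \<longleftrightarrow>
     Hausdorff_space X \<and> second_countable X \<and>
     (\<forall>(U, \<phi>)\<in>A. openin X U \<and> open (\<phi> ` U) \<and>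
        homeomorphic_map (subtopology X U) (top_of_set (\<phi> ` U)) \<phi>) \<and>
     \<Union> (fst ` A) = topspace X \<and>
     (\<forall>c\<in>A. \<forall>d\<in>A. holo_on (snd c ` (fst c \<inter> fst d)) (coord_rep c d id))"

definition smooth_function :: "('a, 'n::finite) chart set \<Rightarrow> ('a \<Rightarrow> real) \<Rightarrow> bool" where
  "smooth_function A f \<longleftrightarrow> (\<forall>(U, \<phi>)\<in>A. smooth_on (\<phi> ` U) (f \<circ> inv_into U \<phi>))"

section \<open>Real 2-forms, Hermitian and Kaehler metrics\<close>

text \<open>A tensor field \<open>\<omega>\<close> of type (0,2) is given by its components: \<open>\<omega> c p v w\<close> is the value at the
  point \<open>p\<close> of the domain of the chart \<open>c\<close> on the two tangent vectors whose coordinates in \<open>c\<close> are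
  \<open>v\<close> and \<open>w\<close>. Tangent vectors are identified with their real coordinates, the complex structure
  being multiplication by the imaginary unit.\<close>

type_synonym ('a, 'n) tensor2 =
  "('a, 'n) chart \<Rightarrow> 'a \<Rightarrow> complex^'n \<Rightarrow> complex^'n \<Rightarrow> real"

definition is_pullback ::
  "('a, 'n::finite) chart set \<Rightarrow> ('b, 'm::finite) chart set \<Rightarrow> ('a \<Rightarrow> 'b) \<Rightarrow> ('b, 'm::finite) tensor2 \<Rightarrow> ('a, 'n::finite) tensor2 \<Rightarrow> bool"
  where
  "is_pullback A B F \<eta> \<omega> \<longleftrightarrow>
     (\<forall>c\<in>A. \<forall>d\<in>B. \<forall>p\<in>fst c. F p \<in> fst d \<longrightarrow>
        (let T = frechet_derivative (coord_rep c d F) (at (snd c p))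
         in \<forall>v w. \<omega> c p v w = \<eta> d (F p) (T v) (T w)))"

definition scale_tensor :: "('a \<Rightarrow> real) \<Rightarrow> ('a, 'n::finite) tensor2 \<Rightarrow> ('a, 'n::finite) tensor2" where
  "scale_tensor f \<omega> = (\<lambda>c p v w. f p * \<omega> c p v w)"

definition local_tensor ::
  "('a, 'n::finite) chart \<Rightarrow> ('a, 'n::finite) tensor2 \<Rightarrow> complex^'n \<Rightarrow> complex^'n \<Rightarrow> complex^'n \<Rightarrow> real" where
  "local_tensor c \<omega> x = \<omega> c (inv_into (fst c) (snd c) x)"

text \<open>The last clause says that the components transform correctly under changes of charts.\<close>

definition two_form :: "('a, 'n::finite) chart set \<Rightarrow> ('a, 'n::finite) tensor2 \<Rightarrow> bool" where
  "two_form A \<omega> \<longleftrightarrow>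
     (\<forall>c\<in>A. (\<forall>p\<in>fst c. bilinear (\<omega> c p) \<and> (\<forall>v. \<omega> c p v v = 0)) \<and>
        (\<forall>v w. smooth_on (snd c ` fst c) (\<lambda>x. local_tensor c \<omega> x v w))) \<and>
     is_pullback A A id \<omega> \<omega>"

text \<open>A Hermitian metric is represented by its fundamental form \<open>\<omega>\<close>; the associated Riemannian
  metric is \<open>\<omega>(v, \<i> w)\<close>.\<close>

definition hermitian_metric :: "('a, 'n::finite) chart set \<Rightarrow> ('a, 'n::finite) tensor2 \<Rightarrow> bool" where
  "hermitian_metric A \<omega> \<longleftrightarrow> two_form A \<omega> \<and>
     (\<forall>c\<in>A. \<forall>p\<in>fst c. (\<forall>v w. \<omega> c p (\<i> *s v) (\<i> *s w) = \<omega> c p v w) \<and>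
        (\<forall>v. v \<noteq> 0 \<longrightarrow> \<omega> c p v (\<i> *s v) > 0))"

definition ext_deriv1 ::
  "(complex^'n \<Rightarrow> complex^'n \<Rightarrow> real) \<Rightarrow> complex^'n \<Rightarrow> complex^'n \<Rightarrow> complex^'n \<Rightarrow> real" where
  "ext_deriv1 \<alpha> x v w =
     frechet_derivative (\<lambda>y. \<alpha> y w) (at x) v - frechet_derivative (\<lambda>y. \<alpha> y v) (at x) w"

definition ext_deriv2 ::
  "(complex^'n \<Rightarrow> complex^'n \<Rightarrow> complex^'n \<Rightarrow> real) \<Rightarrow>
    complex^'n \<Rightarrow> complex^'n \<Rightarrow> complex^'n \<Rightarrow> complex^'n \<Rightarrow> real" where
  "ext_deriv2 \<eta> x u v w =
     frechet_derivative (\<lambda>y. \<eta> y v w) (at x) u - frechet_derivative (\<lambda>y. \<eta> y u w) (at x) v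
     + frechet_derivative (\<lambda>y. \<eta> y u v) (at x) w"

definition kaehler_metric :: "('a, 'n::finite) chart set \<Rightarrow> ('a, 'n::finite) tensor2 \<Rightarrow> bool" where
  "kaehler_metric A \<omega> \<longleftrightarrow> hermitian_metric A \<omega> \<and>
     (\<forall>c\<in>A. \<forall>x\<in>snd c ` fst c. \<forall>u v w. ext_deriv2 (local_tensor c \<omega>) x u v w = 0)"

text \<open>Sign convention \<open>(d\<^sup>c f)(v) = - df(\<i> v)\<close>, for which \<open>d d\<^sup>c\<close> is \<open>2 \<i>\<close> times
  the Dolbeault operator \<open>\<partial>\<close> composed with its conjugate, and \<open>(d d\<^sup>c f)(v, \<i> v) > 0\<close> for strictly
  plurisubharmonic \<open>f\<close>.\<close>

definition dc :: "(complex^'n \<Rightarrow> real) \<Rightarrow> complex^'n \<Rightarrow> complex^'n \<Rightarrow> real" where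
  "dc f x v = - frechet_derivative f (at x) (\<i> *s v)"

definition is_ddc :: "('a, 'n::finite) chart set \<Rightarrow> ('a \<Rightarrow> real) \<Rightarrow> ('a, 'n::finite) tensor2 \<Rightarrow> bool" where
  "is_ddc A \<psi> \<omega> \<longleftrightarrow>
     (\<forall>c\<in>A. \<forall>x\<in>snd c ` fst c. \<forall>v w.
        local_tensor c \<omega> x v w = ext_deriv1 (dc (\<psi> \<circ> inv_into (fst c) (snd c))) x v w)"

section \<open>Coverings\<close>

definition covering_map :: "'b topology \<Rightarrow> 'a topology \<Rightarrow> ('b \<Rightarrow> 'a) \<Rightarrow> bool" where
  "covering_map Y X p \<longleftrightarrow>
     continuous_map Y X p \<and> p ` topspace Y = topspace X \<and>
     (\<forall>x\<in>topspace X. \<exists>T. x \<in> T \<and> openin X T \<and>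
        (\<exists>\<V>. \<Union>\<V> = {y\<in>topspace Y. p y \<in> T} \<and> (\<forall>V\<in>\<V>. openin Y V) \<and> pairwise disjnt \<V> \<and>
           (\<forall>V\<in>\<V>. homeomorphic_map (subtopology Y V) (subtopology X T) p)))"

definition deck_transformation :: "'b topology \<Rightarrow> ('b \<Rightarrow> 'a) \<Rightarrow> ('b \<Rightarrow> 'b) \<Rightarrow> bool" where
  "deck_transformation Y p f \<longleftrightarrow> homeomorphic_map Y Y f \<and> (\<forall>y\<in>topspace Y. p (f y) = p y)"

text \<open>The pulled-back complex structure on the total space of a covering \<open>p\<close>.\<close>

definition pullback_atlas ::
  "'b topology \<Rightarrow> ('b \<Rightarrow> 'a) \<Rightarrow> ('a, 'n::finite) chart set \<Rightarrow> ('b, 'n::finite) chart set" where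
  "pullback_atlas Y p A =
     {(V, \<phi> \<circ> p) | V U \<phi>. openin Y V \<and> inj_on p V \<and> (U, \<phi>) \<in> A \<and> p ` V \<subseteq> U}"

section \<open>Locally conformally Kaehler metrics\<close>

definition lck_covering ::
  "'a topology \<Rightarrow> ('a, 'n::finite) chart set \<Rightarrow> 'b topology \<Rightarrow> ('b \<Rightarrow> 'a) \<Rightarrow> ('b, 'n::finite) tensor2 \<Rightarrow> bool" where
  "lck_covering X A Y p \<omega> \<longleftrightarrow>
     connected_space Y \<and> covering_map Y X p \<and>
     (let B = pullback_atlas Y p A in
        kaehler_metric B \<omega> \<and>
        (\<forall>f. deck_transformation Y p f \<longrightarrow>
           holomorphic_map B B Y Y f \<and>
           (\<exists>a>0. is_pullback B B f \<omega> (scale_tensor (\<lambda>_. a) \<omega>))))"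

definition lck_metric ::
  "('a, 'n::finite) chart set \<Rightarrow> 'b topology \<Rightarrow> ('b \<Rightarrow> 'a) \<Rightarrow> ('b, 'n::finite) tensor2 \<Rightarrow> ('a, 'n::finite) tensor2 \<Rightarrow> bool" where
  "lck_metric A Y p \<omega> g \<longleftrightarrow>
     hermitian_metric A g \<and>
     (let B = pullback_atlas Y p A in
        \<exists>f. smooth_function B f \<and> (\<forall>y\<in>topspace Y. f y > 0) \<and> is_pullback B A p g (scale_tensor f \<omega>))"

definition automorphic_potential ::
  "('a, 'n::finite) chart set \<Rightarrow> 'b topology \<Rightarrow> ('b \<Rightarrow> 'a) \<Rightarrow> ('b, 'n::finite) tensor2 \<Rightarrow> ('b \<Rightarrow> real) \<Rightarrow> bool" where
  "automorphic_potential A Y p \<omega> \<psi> \<longleftrightarrow>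
     (let B = pullback_atlas Y p A in
        smooth_function B \<psi> \<and> (\<forall>y\<in>topspace Y. \<psi> y > 0) \<and> is_ddc B \<psi> \<omega> \<and>
        (\<forall>f. deck_transformation Y p f \<longrightarrow> (\<exists>a. \<forall>y\<in>topspace Y. \<psi> (f y) = a * \<psi> y)))"

text \<open>The total space of the covering is taken with points in \<open>complex^'n\<close>. This is no restriction:
  a connected covering of a connected complex manifold of positive dimension has the cardinality of
  the continuum, so its points can be relabelled.\<close>

definition admits_lck_metric_with_potential :: "'a topology \<Rightarrow> ('a, 'n::finite) chart set \<Rightarrow> bool" where
  "admits_lck_metric_with_potential X A \<longleftrightarrow>
     complex_manifold X A \<and>
     (\<exists>(Y :: (complex^'n) topology) p \<omega> g \<psi>.
        lck_covering X A Y p \<omega> \<and> lck_metric A Y p \<omega> g \<and> automorphic_potential A Y p \<omega> \<psi>)"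

section \<open>Hopf manifolds\<close>

definition holomorphic_contraction :: "(complex^'n \<Rightarrow> complex^'n) \<Rightarrow> bool" where
  "holomorphic_contraction \<gamma> \<longleftrightarrow>
     holo_on UNIV \<gamma> \<and> \<gamma> 0 = 0 \<and>
     (\<forall>K U. compact K \<and> open U \<and> 0 \<in> U \<longrightarrow> (\<exists>N>0. \<forall>m>N. (\<gamma> ^^ m) ` K \<subseteq> U))"

definition biholomorphic_automorphism :: "(complex^'n \<Rightarrow> complex^'n) \<Rightarrow> bool" where
  "biholomorphic_automorphism \<gamma> \<longleftrightarrow>
     bij \<gamma> \<and> holo_on UNIV \<gamma> \<and> holo_on UNIV (inv_into UNIV \<gamma>)"

definition hopf_proj :: "(complex^'n \<Rightarrow> complex^'n) \<Rightarrow> complex^'n \<Rightarrow> (complex^'n) set" where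
  "hopf_proj \<gamma> z = (\<lambda>g. g z) ` generate (BijGroup UNIV) {\<gamma>}"

definition quotient_topology :: "'a topology \<Rightarrow> ('a \<Rightarrow> 'b) \<Rightarrow> 'b topology" where
  "quotient_topology X q =
     topology (\<lambda>U. U \<subseteq> q ` topspace X \<and> openin X {x\<in>topspace X. q x \<in> U})"

lemma openin_quotient_topology:
  "openin (quotient_topology X q) U \<longleftrightarrow>
     U \<subseteq> q ` topspace X \<and> openin X {x\<in>topspace X. q x \<in> U}"
proof -
  have "istopology (\<lambda>U. U \<subseteq> q ` topspace X \<and> openin X {x\<in>topspace X. q x \<in> U})"
    unfolding istopology_def
  proof (intro conjI allI impI)
    fix S T
    assume S: "S \<subseteq> q ` topspace X \<and> openin X {x\<in>topspace X. q x \<in> S}"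
      and T: "T \<subseteq> q ` topspace X \<and> openin X {x\<in>topspace X. q x \<in> T}"
    have "{x\<in>topspace X. q x \<in> S \<inter> T} =
        {x\<in>topspace X. q x \<in> S} \<inter> {x\<in>topspace X. q x \<in> T}" by auto
    then show "openin X {x\<in>topspace X. q x \<in> S \<inter> T}" using S T by auto
    show "S \<inter> T \<subseteq> q ` topspace X" using S by auto
  next
    fix \<K>
    assume K: "\<forall>S\<in>\<K>. S \<subseteq> q ` topspace X \<and> openin X {x\<in>topspace X. q x \<in> S}"
    have "{x\<in>topspace X. q x \<in> \<Union>\<K>} = (\<Union>S\<in>\<K>. {x\<in>topspace X. q x \<in> S})" by auto
    then show "openin X {x\<in>topspace X. q x \<in> \<Union>\<K>}" using K by auto
    show "\<Union>\<K> \<subseteq> q ` topspace X" using K by auto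
  qed
  then show ?thesis
    by (simp add: quotient_topology_def topology_inverse')
qed

lemma quotient_map_quotient_topology: "quotient_map X (quotient_topology X q) q"
proof -
  have "{x\<in>topspace X. q x \<in> q ` topspace X} = topspace X" by auto
  then have "openin (quotient_topology X q) (q ` topspace X)"
    by (simp add: openin_quotient_topology)
  moreover have "topspace (quotient_topology X q) \<subseteq> q ` topspace X"
    using openin_quotient_topology[of X q "topspace (quotient_topology X q)"] by simp
  ultimately have "topspace (quotient_topology X q) = q ` topspace X"
    by (meson openin_subset subset_antisym)
  then show ?thesis
    by (simp add: quotient_map_def openin_quotient_topology)
qed

definition hopf_topology :: "(complex^'n \<Rightarrow> complex^'n) \<Rightarrow> (complex^'n) set topology" where
  "hopf_topology \<gamma> = quotient_topology (top_of_set (UNIV - {0})) (hopf_proj \<gamma>)"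

text \<open>The charts of the quotient are the local inverses of the projection.\<close>

definition hopf_atlas :: "(complex^'n \<Rightarrow> complex^'n) \<Rightarrow> ((complex^'n) set, 'n::finite) chart set" where
  "hopf_atlas \<gamma> =
     {(hopf_proj \<gamma> ` V, inv_into V (hopf_proj \<gamma>)) | V. open V \<and> 0 \<notin> V \<and> inj_on (hopf_proj \<gamma>) V}"

end

theory Submission
  imports Defs "HOL-Complex_Analysis.Conformal_Mappings"
begin

text \<open>The covering of the Hopf manifold is \<open>p : \<complex>\<^sup>n - 0 \<rightarrow> H\<close>. Its deck transformations are
  the powers \<open>\<gamma>\<^sup>k\<close>, so everything follows from one function: a smooth positive strictly plurisubharmonic \<open>\<psi>\<close> on
  \<open>\<complex>\<^sup>n - 0\<close> with \<open>\<psi> \<circ> \<gamma> = a \<psi>\<close> for a constant \<open>0 < a < 1\<close>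
  (\<open>automorphic_potential_exists\<close>). Then \<open>dd\<^sup>c \<psi>\<close> is the Kaehler form on the covering, on
  which \<open>\<gamma>\<close> acts as multiplication by \<open>a\<close>, and \<open>dd\<^sup>c \<psi> / \<psi>\<close> is \<open>\<gamma>\<close>-invariant and
  descends to the Hermitian metric on \<open>H\<close>.

  By the Schwarz lemma some power of \<open>\<gamma>\<close> halves the norm on the
  unit ball, and therefore a weighted sum \<open>\<rho>\<close> of finitely many \<open>|\<gamma>\<^sup>k z|\<^sup>2\<close> satisfies
  \<open>\<rho> \<circ> \<gamma> \<le> s \<rho>\<close> on \<open>{\<rho> \<le> 1}\<close> with \<open>s < 1\<close> (\<open>adapted_psh_function\<close>). On the shell between
  \<open>\<gamma> {\<rho> \<le> 1}\<close> and \<open>{\<rho> \<le> 1}\<close> consider an outer function \<open>g\<close>, which is affine in \<open>\<rho>\<close>, steep, and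
  changes sign inside the shell, and the inner function \<open>h = a (g \<circ> \<gamma>\<^sup>-\<^sup>1)\<close>, up to a constant that
  compensates for the smoothing. Both are strictly plurisubharmonic on the whole space, \<open>h\<close> dominates \<open>g\<close> near
  the inner boundary because \<open>h\<close> is positive and \<open>g\<close> negative there, and \<open>g\<close> dominates \<open>h\<close> near the outer one as soon as \<open>a\<close> is small. A smooth convex version of
  \<open>max g h\<close> is strictly plurisubharmonic (\<open>strictly_psh_glue\<close>), coincides with the outer function near the
  outer boundary and with the inner one near the inner boundary, and hence extends by the rule \<open>\<psi> \<circ> \<gamma> = a \<psi>\<close> to a smooth function
  on \<open>\<complex>\<^sup>n - 0\<close>. Gluing one shell at a time is what makes the construction insensitive to the growth of
  \<open>\<gamma>\<^sup>-\<^sup>k\<close> at infinity.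

  The same \<open>\<psi>\<close> controls the topology of the quotient: a set on which \<open>\<psi>\<close> varies by a factor less than
  \<open>1 / a\<close> is disjoint from its nontrivial translates, which gives the evenly covered neighbourhoods, the charts and
  the Hausdorff property. In all charts, the projection, the deck transformations and the changes of coordinates
  are locally powers of \<open>\<gamma>\<close>, so each assertion about tensors reduces to the behaviour of \<open>dd\<^sup>c \<psi>\<close> under
  \<open>\<gamma>\<^sup>k\<close>. That the powers of \<open>\<gamma>\<close> are smooth in the real sense is Cauchy's integral formula
  (\<open>holo_on_imp_smooth_on\<close>).\<close>

section \<open>Calculus of smooth functions\<close>

lemma differentiable_has_frechet_derivative:
  "f differentiable (at x) \<Longrightarrow> (f has_derivative frechet_derivative f (at x)) (at x)"
  by (simp add: frechet_derivative_works)

lemma frechet_derivative_cong_open: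
  assumes "open T" "x \<in> T" "\<And>y. y \<in> T \<Longrightarrow> f y = g y"
  shows "frechet_derivative f (at x) = frechet_derivative g (at x)"
proof -
  have "(f has_derivative D) (at x) \<longleftrightarrow> (g has_derivative D) (at x)" for D
    using has_derivative_transform_within_open[OF _ assms(1,2), where f = f and g = g]
      has_derivative_transform_within_open[OF _ assms(1,2), where f = g and g = f] assms(3) by auto
  then show ?thesis by (simp add: frechet_derivative_def)
qed

lemma differentiable_cong_open:
  assumes "open T" "x \<in> T" "\<And>y. y \<in> T \<Longrightarrow> f y = g y" "f differentiable (at x)"
  shows "g differentiable (at x)"
proof -
  obtain D where "(f has_derivative D) (at x)" using assms(4) by (auto simp: differentiable_def)
  then have "(g has_derivative D) (at x)"
    by (rule has_derivative_transform_within_open[OF _ assms(1,2)]) (rule assms(3))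
  then show ?thesis by (auto simp: differentiable_def)
qed

lemma Ck_on_cong:
  assumes "open S" "\<And>x. x \<in> S \<Longrightarrow> f x = g x" "Ck_on k S f"
  shows "Ck_on k S g"
  using assms(2,3)
proof (induction k arbitrary: f g)
  case 0
  then show ?case by (auto cong: continuous_on_cong)
next
  case (Suc k)
  have "g differentiable at x" if "x \<in> S" for x
    by (rule differentiable_cong_open[OF assms(1) that, of f]) (use Suc that in auto)
  moreover have "Ck_on k S (\<lambda>x. frechet_derivative g (at x) v)" for v
  proof (rule Suc.IH)
    show "frechet_derivative f (at x) v = frechet_derivative g (at x) v" if "x \<in> S" for x
      using frechet_derivative_cong_open[OF assms(1) that, of f g] Suc.prems by auto
    show "Ck_on k S (\<lambda>x. frechet_derivative f (at x) v)" using Suc.prems by auto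
  qed
  ultimately show ?case by simp
qed

lemma Ck_on_subset: "Ck_on k S f \<Longrightarrow> T \<subseteq> S \<Longrightarrow> Ck_on k T f"
proof (induction k arbitrary: f)
  case 0
  then show ?case using continuous_on_subset[of S f T] by simp
next
  case (Suc k)
  then show ?case by auto
qed

lemma Ck_on_local:
  assumes "\<And>x. x \<in> S \<Longrightarrow> \<exists>T. open T \<and> x \<in> T \<and> Ck_on k T f"
  shows "Ck_on k S f"
  using assms
proof (induction k arbitrary: f)
  case 0
  have "continuous (at x within S) f" if "x \<in> S" for x
  proof -
    obtain T where "open T" "x \<in> T" "continuous_on T f" using 0[OF \<open>x \<in> S\<close>] unfolding Ck_on.simps(1) by blast
    then have "isCont f x" by (simp add: continuous_on_eq_continuous_at)
    then show ?thesis by (rule continuous_at_imp_continuous_at_within)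
  qed
  then show ?case by (simp add: continuous_on_eq_continuous_within)
next
  case (Suc k)
  have "f differentiable at x" if x: "x \<in> S" for x
  proof -
    obtain T where "x \<in> T" "Ck_on (Suc k) T f" using Suc.prems[OF x] by blast
    then show ?thesis by simp
  qed
  moreover have "Ck_on k S (\<lambda>x. frechet_derivative f (at x) v)" for v
  proof (rule Suc.IH)
    fix x assume x: "x \<in> S"
    obtain T where T: "open T" "x \<in> T" "Ck_on (Suc k) T f" using Suc.prems[OF x] by blast
    then have "Ck_on k T (\<lambda>x. frechet_derivative f (at x) v)" by simp
    then show "\<exists>T. open T \<and> x \<in> T \<and> Ck_on k T (\<lambda>x. frechet_derivative f (at x) v)" using T by blast
  qed
  ultimately show ?case by simp
qed

lemma Ck_on_Suc_imp: "Ck_on (Suc k) S f \<Longrightarrow> Ck_on k S f"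
proof (induction k arbitrary: f)
  case 0
  then show ?case
    using differentiable_imp_continuous_within[of f _ UNIV]
    by (auto intro!: continuous_at_imp_continuous_on)
next
  case (Suc k)
  have 1: "\<forall>x\<in>S. f differentiable at x" and 2: "\<And>v. Ck_on (Suc k) S (\<lambda>x. frechet_derivative f (at x) v)"
    using Suc.prems unfolding Ck_on.simps(2)[of "Suc k" S f] by auto
  show ?case unfolding Ck_on.simps(2)[of k S f] using 1 Suc.IH[OF 2] by auto
qed

text \<open>The derivative selected in the definition of \<open>Ck_on\<close> may be replaced by any explicit one. Openness
  matters: agreement on the set has to imply agreement of the higher derivatives, too.\<close>

lemma Ck_on_SucI:
  assumes "open S" "\<And>x. x \<in> S \<Longrightarrow> (f has_derivative D x) (at x)" "\<And>v. Ck_on k S (\<lambda>x. D x v)"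
  shows "Ck_on (Suc k) S f"
proof -
  have "frechet_derivative f (at x) = D x" if "x \<in> S" for x
    by (rule frechet_derivative_at[OF assms(2)[OF that], symmetric])
  then have "Ck_on k S (\<lambda>x. frechet_derivative f (at x) v)" for v
    by (intro Ck_on_cong[OF assms(1) _ assms(3)[of v]]) simp
  then show ?thesis using assms(2) by (auto simp: differentiable_def)
qed

lemma Ck_on_SucD:
  assumes "Ck_on (Suc k) S f" "x \<in> S"
  shows "(f has_derivative frechet_derivative f (at x)) (at x)"
  using assms by (intro differentiable_has_frechet_derivative) auto

lemma Ck_on_const: "Ck_on k S (\<lambda>x. c)"
proof (induction k arbitrary: c)
  case (Suc k)
  then show ?case by simp
qed simp

lemma Ck_on_bounded_linear_compose:
  assumes "open S" "bounded_linear L" "Ck_on k S f"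
  shows "Ck_on k S (\<lambda>x. L (f x))"
  using assms(3)
proof (induction k arbitrary: f)
  case 0
  then show ?case using bounded_linear.continuous_on[OF assms(2)] by simp
next
  case (Suc k)
  show ?case
  proof (rule Ck_on_SucI[OF assms(1)])
    show "((\<lambda>x. L (f x)) has_derivative (\<lambda>v. L (frechet_derivative f (at x) v))) (at x)" if "x \<in> S" for x
      by (rule bounded_linear.has_derivative[OF assms(2) Ck_on_SucD[OF Suc.prems that]])
    show "Ck_on k S (\<lambda>x. L (frechet_derivative f (at x) v))" for v
      using Suc by auto
  qed
qed

lemma Ck_on_add:
  assumes "open S" "Ck_on k S f" "Ck_on k S g"
  shows "Ck_on k S (\<lambda>x. f x + g x)"
  using assms(2,3)
proof (induction k arbitrary: f g)
  case (Suc k)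
  show ?case
  proof (rule Ck_on_SucI[OF assms(1)])
    show "((\<lambda>x. f x + g x) has_derivative (\<lambda>v. frechet_derivative f (at x) v + frechet_derivative g (at x) v)) (at x)"
      if "x \<in> S" for x
      by (intro has_derivative_add Ck_on_SucD[OF Suc.prems(1) that] Ck_on_SucD[OF Suc.prems(2) that])
    show "Ck_on k S (\<lambda>x. frechet_derivative f (at x) v + frechet_derivative g (at x) v)" for v
      using Suc by auto
  qed
qed (simp add: continuous_on_add)

lemma Ck_on_sum:
  assumes "open S" "\<And>i. i \<in> I \<Longrightarrow> Ck_on k S (f i)"
  shows "Ck_on k S (\<lambda>x. \<Sum>i\<in>I. f i x)"
  using assms(2)
  by (induction I rule: infinite_finite_induct) (simp_all add: Ck_on_const Ck_on_add[OF assms(1)])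

lemma Ck_on_bilinear:
  assumes "open S" "bounded_bilinear b" "Ck_on k S f" "Ck_on k S g"
  shows "Ck_on k S (\<lambda>x. b (f x) (g x))"
  using assms(3,4)
proof (induction k arbitrary: f g)
  case 0
  then show ?case using bounded_bilinear.continuous_on[OF assms(2)] by simp
next
  case (Suc k)
  show ?case
  proof (rule Ck_on_SucI[OF assms(1)])
    show "((\<lambda>x. b (f x) (g x)) has_derivative
        (\<lambda>v. b (f x) (frechet_derivative g (at x) v) + b (frechet_derivative f (at x) v) (g x))) (at x)"
      if "x \<in> S" for x
      by (intro bounded_bilinear.FDERIV[OF assms(2)] Ck_on_SucD[OF Suc.prems(1) that]
          Ck_on_SucD[OF Suc.prems(2) that])
    show "Ck_on k S (\<lambda>x. b (f x) (frechet_derivative g (at x) v) + b (frechet_derivative f (at x) v) (g x))" for v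
      using Suc.prems Ck_on_Suc_imp[OF Suc.prems(1)] Ck_on_Suc_imp[OF Suc.prems(2)]
      by (intro Ck_on_add[OF assms(1)] Suc.IH) auto
  qed
qed

text \<open>The derivative of a composition is expanded in the standard basis of the intermediate space,
  so that it becomes a sum of products of functions of lower order.\<close>

lemma Ck_on_compose:
  fixes G :: "'a::real_normed_vector \<Rightarrow> 'b::euclidean_space" and f :: "'b \<Rightarrow> 'c::real_normed_vector"
  assumes "open S" "open T" "G ` S \<subseteq> T" "Ck_on k S G" "Ck_on k T f"
  shows "Ck_on k S (\<lambda>x. f (G x))"
  using assms(4,5)
proof (induction k arbitrary: f)
  case 0
  then show ?case using continuous_on_compose2[of T f S G] assms(3) by simp
next
  case (Suc k)
  let ?D = "\<lambda>x v. \<Sum>b\<in>Basis. (frechet_derivative G (at x) v \<bullet> b) *\<^sub>R frechet_derivative f (at (G x)) b"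
  show ?case
  proof (rule Ck_on_SucI[OF assms(1)])
    fix x assume x: "x \<in> S"
    have f: "(f has_derivative frechet_derivative f (at (G x))) (at (G x))"
      using Ck_on_SucD[OF Suc.prems(2)] x assms(3) by auto
    interpret f: bounded_linear "frechet_derivative f (at (G x))"
      using f by (rule has_derivative_bounded_linear)
    have "frechet_derivative f (at (G x)) (frechet_derivative G (at x) v) = ?D x v" for v
      by (subst euclidean_representation[of "frechet_derivative G (at x) v", symmetric])
         (simp only: f.sum f.scaleR)
    moreover have "((\<lambda>x. f (G x)) has_derivative
        (\<lambda>v. frechet_derivative f (at (G x)) (frechet_derivative G (at x) v))) (at x)"
      by (rule has_derivative_compose[OF Ck_on_SucD[OF Suc.prems(1) x] f])
    ultimately show "((\<lambda>x. f (G x)) has_derivative ?D x) (at x)" by presburger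
  next
    fix v
    show "Ck_on k S (\<lambda>x. ?D x v)"
    proof (intro Ck_on_sum[OF assms(1)] Ck_on_bilinear[OF assms(1) bounded_bilinear_scaleR]
        Ck_on_bounded_linear_compose[OF assms(1) bounded_linear_inner_left])
      show "Ck_on k S (\<lambda>x. frechet_derivative G (at x) v)" using Suc.prems by auto
      show "Ck_on k S (\<lambda>x. frechet_derivative f (at (G x)) b)" for b
        using Suc.prems Ck_on_Suc_imp[OF Suc.prems(1)] by (intro Suc.IH) auto
    qed
  qed
qed

lemma smooth_on_cong:
  "open S \<Longrightarrow> (\<And>x. x \<in> S \<Longrightarrow> f x = g x) \<Longrightarrow> smooth_on S f \<Longrightarrow> smooth_on S g"
  unfolding smooth_on_def by (auto intro: Ck_on_cong[of S f g])

lemma smooth_on_subset: "smooth_on S f \<Longrightarrow> T \<subseteq> S \<Longrightarrow> smooth_on T f"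
  unfolding smooth_on_def using Ck_on_subset by blast

lemma smooth_on_local:
  assumes "\<And>x. x \<in> S \<Longrightarrow> \<exists>T. open T \<and> x \<in> T \<and> smooth_on T f"
  shows "smooth_on S f"
  unfolding smooth_on_def
proof
  show "Ck_on k S f" for k
    by (rule Ck_on_local) (use assms in \<open>auto simp: smooth_on_def\<close>)
qed

lemma smooth_onI:
  assumes "open S" "\<And>x. x \<in> S \<Longrightarrow> (f has_derivative D x) (at x)" "\<And>v. smooth_on S (\<lambda>x. D x v)"
  shows "smooth_on S f"
  unfolding smooth_on_def
proof
  fix k show "Ck_on k S f"
    by (rule Ck_on_Suc_imp, rule Ck_on_SucI[OF assms(1,2)]) (use assms(3) in \<open>auto simp: smooth_on_def\<close>)
qed

lemma smooth_on_has_derivative: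
  "smooth_on S f \<Longrightarrow> x \<in> S \<Longrightarrow> (f has_derivative frechet_derivative f (at x)) (at x)"
  unfolding smooth_on_def by (auto intro: Ck_on_SucD simp del: Ck_on.simps)

lemma smooth_on_frechet_derivative:
  "smooth_on S f \<Longrightarrow> smooth_on S (\<lambda>x. frechet_derivative f (at x) v)"
  unfolding smooth_on_def using Ck_on.simps(2)[of _ S f] by blast

lemma smooth_on_imp_continuous_on: "smooth_on S f \<Longrightarrow> continuous_on S f"
  unfolding smooth_on_def using Ck_on.simps(1)[of S f] by blast

lemma smooth_on_const: "smooth_on S (\<lambda>x. c)"
  by (simp add: smooth_on_def Ck_on_const)

lemma smooth_on_bounded_linear_compose:
  "open S \<Longrightarrow> bounded_linear L \<Longrightarrow> smooth_on S f \<Longrightarrow> smooth_on S (\<lambda>x. L (f x))"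
  by (simp add: smooth_on_def Ck_on_bounded_linear_compose)

lemma smooth_on_ident: "open S \<Longrightarrow> smooth_on S (\<lambda>x. x)"
  by (rule smooth_onI[where D = "\<lambda>x v. v"]) (auto intro: smooth_on_const)

lemma smooth_on_add:
  "open S \<Longrightarrow> smooth_on S f \<Longrightarrow> smooth_on S g \<Longrightarrow> smooth_on S (\<lambda>x. f x + g x)"
  by (simp add: smooth_on_def Ck_on_add)

lemma smooth_on_bilinear:
  "open S \<Longrightarrow> bounded_bilinear b \<Longrightarrow> smooth_on S f \<Longrightarrow> smooth_on S g \<Longrightarrow>
    smooth_on S (\<lambda>x. b (f x) (g x))"
  by (simp add: smooth_on_def Ck_on_bilinear)

lemma smooth_on_mult:
  fixes f :: "_ \<Rightarrow> real"
  shows "open S \<Longrightarrow> smooth_on S f \<Longrightarrow> smooth_on S g \<Longrightarrow> smooth_on S (\<lambda>x. f x * g x)"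
  by (rule smooth_on_bilinear[OF _ bounded_bilinear_mult])

lemma smooth_on_cmult:
  fixes f :: "_ \<Rightarrow> real"
  shows "open S \<Longrightarrow> smooth_on S f \<Longrightarrow> smooth_on S (\<lambda>x. c * f x)"
  by (intro smooth_on_mult smooth_on_const)

lemma smooth_on_diff:
  assumes "open S" "smooth_on S f" "smooth_on S g"
  shows "smooth_on S (\<lambda>x. f x - g x)"
  using smooth_on_add[OF assms(1,2)
      smooth_on_bounded_linear_compose[OF assms(1) bounded_linear_minus[OF bounded_linear_ident] assms(3)]]
  by simp

lemma smooth_on_sum:
  "open S \<Longrightarrow> (\<And>i. i \<in> I \<Longrightarrow> smooth_on S (f i)) \<Longrightarrow> smooth_on S (\<lambda>x. \<Sum>i\<in>I. f i x)"
  by (simp add: smooth_on_def Ck_on_sum)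

lemma smooth_on_compose:
  fixes G :: "'a::real_normed_vector \<Rightarrow> 'b::euclidean_space"
  shows "open S \<Longrightarrow> open T \<Longrightarrow> G ` S \<subseteq> T \<Longrightarrow> smooth_on S G \<Longrightarrow> smooth_on T f \<Longrightarrow>
    smooth_on S (\<lambda>x. f (G x))"
  unfolding smooth_on_def by (auto intro: Ck_on_compose[of S T G])

lemma smooth_on_inverse: "smooth_on {0<..} (inverse :: real \<Rightarrow> real)"
  unfolding smooth_on_def
proof
  fix k show "Ck_on k {0<..} (inverse :: real \<Rightarrow> real)"
  proof (induction k)
    case 0
    have "continuous_on {0<..} (\<lambda>x::real. inverse x)" by (rule continuous_on_inverse) auto
    then show ?case by simp
  next
    case (Suc k)
    show ?case
    proof (rule Ck_on_SucI)
      show "(inverse has_derivative (\<lambda>v. (- v) * (inverse x * inverse x))) (at x)" if "x \<in> {0<..}" for x :: real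
        using that by (auto intro!: derivative_eq_intros)
      show "Ck_on k {0<..} (\<lambda>x::real. (- v) * (inverse x * inverse x))" for v
        by (intro Ck_on_bilinear[OF _ bounded_bilinear_mult] Ck_on_const Suc) auto
    qed auto
  qed
qed

text \<open>This is the core of the symmetry of second derivatives. By the mean value theorem, applied once in each direction,
  the second difference of \<open>f\<close> over the parallelogram spanned by \<open>h u\<close> and \<open>h v\<close> is \<open>h\<^sup>2\<close> times
  either mixed derivative at some point of the parallelogram.\<close>

lemma second_difference_mean_value:
  fixes f :: "'a::real_normed_vector \<Rightarrow> real"
  assumes "smooth_on S f" "h > 0"
    and S: "\<And>r s. r \<in> {0..h} \<Longrightarrow> s \<in> {0..h} \<Longrightarrow> x + r *\<^sub>R u + s *\<^sub>R v \<in> S"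
  obtains r s where "r \<in> {0..h}" "s \<in> {0..h}"
    "f (x + h *\<^sub>R u + h *\<^sub>R v) - f (x + h *\<^sub>R u) - f (x + h *\<^sub>R v) + f x
      = h\<^sup>2 * frechet_derivative (\<lambda>y. frechet_derivative f (at y) u) (at (x + r *\<^sub>R u + s *\<^sub>R v)) v"
proof -
  let ?Df = "\<lambda>y. frechet_derivative f (at y)"
  let ?D2 = "\<lambda>y. frechet_derivative (\<lambda>y. ?Df y u) (at y)"
  have der: "((\<lambda>r. k (z + r *\<^sub>R w)) has_real_derivative frechet_derivative k (at (z + r *\<^sub>R w)) w) (at r)"
    if "smooth_on S k" "z + r *\<^sub>R w \<in> S" for k :: "'a \<Rightarrow> real" and z w r
  proof -
    have k: "(k has_derivative frechet_derivative k (at (z + r *\<^sub>R w))) (at (z + r *\<^sub>R w))"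
      using smooth_on_has_derivative that by blast
    have "((\<lambda>r. k (z + r *\<^sub>R w)) has_derivative (\<lambda>t. frechet_derivative k (at (z + r *\<^sub>R w)) (t *\<^sub>R w))) (at r)"
      by (rule has_derivative_compose[where f = "\<lambda>r. z + r *\<^sub>R w" and g = k, OF _ k])
         (auto intro!: derivative_eq_intros)
    moreover have "(\<lambda>t. frechet_derivative k (at (z + r *\<^sub>R w)) (t *\<^sub>R w)) = (*) (frechet_derivative k (at (z + r *\<^sub>R w)) w)"
      using linear_cmul[OF has_derivative_linear[OF k]] by (simp add: fun_eq_iff)
    ultimately show ?thesis by (simp add: has_field_derivative_def)
  qed
  let ?p = "\<lambda>r. f (x + h *\<^sub>R v + r *\<^sub>R u) - f (x + r *\<^sub>R u)"
  have p: "(?p has_real_derivative ?Df (x + h *\<^sub>R v + r *\<^sub>R u) u - ?Df (x + r *\<^sub>R u) u) (at r)"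
    if "0 \<le> r" "r \<le> h" for r
    using S[of r h] S[of r 0] that assms(2)
    by (intro DERIV_diff der[OF assms(1)]) (auto simp: algebra_simps)
  obtain r where r: "0 < r" "r < h" "?p h - ?p 0 = (h - 0) * (?Df (x + h *\<^sub>R v + r *\<^sub>R u) u - ?Df (x + r *\<^sub>R u) u)"
    using MVT2[OF assms(2), of ?p, OF p] by blast
  let ?q = "\<lambda>s. ?Df (x + r *\<^sub>R u + s *\<^sub>R v) u"
  have q: "(?q has_real_derivative ?D2 (x + r *\<^sub>R u + s *\<^sub>R v) v) (at s)" if "0 \<le> s" "s \<le> h" for s
    using S[of r s] that r by (intro der[OF smooth_on_frechet_derivative[OF assms(1)]]) auto
  obtain s where s: "0 < s" "s < h" "?q h - ?q 0 = (h - 0) * ?D2 (x + r *\<^sub>R u + s *\<^sub>R v) v"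
    using MVT2[OF assms(2), of ?q, OF q] by blast
  show thesis
  proof
    show "f (x + h *\<^sub>R u + h *\<^sub>R v) - f (x + h *\<^sub>R u) - f (x + h *\<^sub>R v) + f x
      = h\<^sup>2 * ?D2 (x + r *\<^sub>R u + s *\<^sub>R v) v"
      using r(3) s(3) by (simp add: power2_eq_square add.commute add.left_commute)
  qed (use r s in auto)
qed

text \<open>Both mixed derivatives at \<open>x\<close> are limits of the second difference divided by
  \<open>h\<^sup>2\<close>.\<close>

lemma second_derivative_symmetric_real:
  fixes f :: "'a::real_normed_vector \<Rightarrow> real"
  assumes "open S" "smooth_on S f" "x \<in> S"
  shows "frechet_derivative (\<lambda>y. frechet_derivative f (at y) u) (at x) v
       = frechet_derivative (\<lambda>y. frechet_derivative f (at y) v) (at x) u"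
proof -
  let ?D2 = "\<lambda>u v y. frechet_derivative (\<lambda>y. frechet_derivative f (at y) u) (at y) v"
  have cont: "isCont (?D2 u v) x" for u v
    using smooth_on_imp_continuous_on[OF smooth_on_frechet_derivative[OF smooth_on_frechet_derivative[OF assms(2)]]]
      assms(1,3) continuous_on_eq_continuous_at by blast
  have "\<bar>?D2 u v x - ?D2 v u x\<bar> \<le> e" if "e > 0" for e
  proof -
    obtain d1 where d1: "d1 > 0" "\<And>y. dist y x < d1 \<Longrightarrow> dist (?D2 u v y) (?D2 u v x) < e/2"
      using cont[of u v] half_gt_zero[OF \<open>e > 0\<close>] unfolding continuous_at_eps_delta by blast
    obtain d2 where d2: "d2 > 0" "\<And>y. dist y x < d2 \<Longrightarrow> dist (?D2 v u y) (?D2 v u x) < e/2"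
      using cont[of v u] half_gt_zero[OF \<open>e > 0\<close>] unfolding continuous_at_eps_delta by blast
    obtain d3 where d3: "d3 > 0" "ball x d3 \<subseteq> S"
      using assms(1,3) openE by blast
    define d where "d = min d1 (min d2 d3)"
    have d: "d > 0" using d1 d2 d3 by (simp add: d_def)
    define N where "N = norm u + norm v + 1"
    have N: "N > 0" by (simp add: N_def add_nonneg_pos)
    \<comment> \<open>keeps the parallelogram spanned by \<open>h u\<close> and \<open>h v\<close> within distance \<open>d / 2\<close> of \<open>x\<close>\<close>
    define h where "h = d / (2 * N)"
    have h: "h > 0" using d N by (simp add: h_def)
    have small: "dist (x + r *\<^sub>R u + s *\<^sub>R v) x < d" if "r \<in> {0..h}" "s \<in> {0..h}" for r s
    proof -
      have "norm (r *\<^sub>R u + s *\<^sub>R v) \<le> h * norm u + h * norm v"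
        using that by (intro norm_triangle_le add_mono) (auto intro!: mult_right_mono)
      also have "\<dots> \<le> h * N" using h by (simp add: N_def algebra_simps)
      also have "\<dots> = d / 2" using N by (simp add: h_def)
      finally show ?thesis using d by (simp add: dist_norm add.assoc)
    qed
    have inS: "x + r *\<^sub>R u + s *\<^sub>R v \<in> S" if "r \<in> {0..h}" "s \<in> {0..h}" for r s
      using small[OF that] d3 by (auto simp: d_def dist_commute subset_iff)
    have inS': "x + r *\<^sub>R v + s *\<^sub>R u \<in> S" if "r \<in> {0..h}" "s \<in> {0..h}" for r s
      using inS[OF that(2,1)] by (simp add: algebra_simps)
    obtain r s where rs: "r \<in> {0..h}" "s \<in> {0..h}"
      "f (x + h *\<^sub>R u + h *\<^sub>R v) - f (x + h *\<^sub>R u) - f (x + h *\<^sub>R v) + f x = h\<^sup>2 * ?D2 u v (x + r *\<^sub>R u + s *\<^sub>R v)"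
      using second_difference_mean_value[OF assms(2) h inS] by blast
    obtain r' s' where rs': "r' \<in> {0..h}" "s' \<in> {0..h}"
      "f (x + h *\<^sub>R v + h *\<^sub>R u) - f (x + h *\<^sub>R v) - f (x + h *\<^sub>R u) + f x = h\<^sup>2 * ?D2 v u (x + r' *\<^sub>R v + s' *\<^sub>R u)"
      using second_difference_mean_value[OF assms(2) h inS'] by blast
    have "h\<^sup>2 * ?D2 u v (x + r *\<^sub>R u + s *\<^sub>R v) = h\<^sup>2 * ?D2 v u (x + r' *\<^sub>R v + s' *\<^sub>R u)"
      unfolding rs(3)[symmetric] rs'(3)[symmetric] by (simp add: add.commute add.left_commute)
    then have "?D2 u v (x + r *\<^sub>R u + s *\<^sub>R v) = ?D2 v u (x + r' *\<^sub>R v + s' *\<^sub>R u)"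
      using h by simp
    moreover have "dist (?D2 u v (x + r *\<^sub>R u + s *\<^sub>R v)) (?D2 u v x) < e/2"
      using small[OF rs(1,2)] by (intro d1) (simp add: d_def)
    moreover have "dist (?D2 v u (x + r' *\<^sub>R v + s' *\<^sub>R u)) (?D2 v u x) < e/2"
      using small[OF rs'(2,1)] by (intro d2) (simp add: d_def algebra_simps)
    ultimately show ?thesis unfolding dist_real_def by linarith
  qed
  then have "\<bar>?D2 u v x - ?D2 v u x\<bar> \<le> 0" by (rule field_le_epsilon) simp
  then show ?thesis by simp
qed

lemma second_derivative_symmetric:
  fixes f :: "'a::real_normed_vector \<Rightarrow> 'b::euclidean_space"
  assumes "open S" "smooth_on S f" "x \<in> S"
  shows "frechet_derivative (\<lambda>y. frechet_derivative f (at y) u) (at x) v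
       = frechet_derivative (\<lambda>y. frechet_derivative f (at y) v) (at x) u"
proof (rule euclidean_eqI)
  fix b :: 'b
  have inner: "frechet_derivative (\<lambda>y. k y \<bullet> b) (at y) w = frechet_derivative k (at y) w \<bullet> b"
    if "smooth_on S k" "y \<in> S" for k :: "'a \<Rightarrow> 'b" and y w
  proof -
    have "((\<lambda>y. k y \<bullet> b) has_derivative (\<lambda>w. frechet_derivative k (at y) w \<bullet> b)) (at y)"
      by (rule bounded_linear.has_derivative[OF bounded_linear_inner_left smooth_on_has_derivative[OF that]])
    from frechet_derivative_at[OF this] show ?thesis by (simp add: fun_eq_iff)
  qed
  have *: "frechet_derivative (\<lambda>y. frechet_derivative (\<lambda>y. f y \<bullet> b) (at y) u) (at x) v
      = frechet_derivative (\<lambda>y. frechet_derivative f (at y) u) (at x) v \<bullet> b" for u v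
  proof -
    have "frechet_derivative (\<lambda>y. frechet_derivative (\<lambda>y. f y \<bullet> b) (at y) u) (at x)
        = frechet_derivative (\<lambda>y. frechet_derivative f (at y) u \<bullet> b) (at x)"
      by (rule frechet_derivative_cong_open[OF assms(1,3)]) (rule inner[OF assms(2)])
    then show ?thesis
      using inner[OF smooth_on_frechet_derivative[OF assms(2)] assms(3)] by metis
  qed
  show "frechet_derivative (\<lambda>y. frechet_derivative f (at y) u) (at x) v \<bullet> b
       = frechet_derivative (\<lambda>y. frechet_derivative f (at y) v) (at x) u \<bullet> b"
    unfolding *[symmetric]
    by (rule second_derivative_symmetric_real[OF assms(1)
        smooth_on_bounded_linear_compose[OF assms(1) bounded_linear_inner_left assms(2)] assms(3)])
qed

section \<open>Holomorphic maps of several variables\<close>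

lemma norm_vector_smult: "norm (c *s (v::complex^'n)) = norm c * norm v"
proof -
  have "norm (c *s v) = L2_set (\<lambda>i. norm c * norm (v $ i)) UNIV"
    by (simp add: norm_vec_def norm_mult)
  also have "\<dots> = norm c * L2_set (\<lambda>i. norm (v $ i)) UNIV"
    by (simp add: L2_set_right_distrib)
  finally show ?thesis by (simp add: norm_vec_def)
qed

lemma bounded_bilinear_vector_smult:
  "bounded_bilinear (\<lambda>(c::complex) (v::complex^'n). c *s v)"
proof
  show "\<exists>K. \<forall>a b. norm (a *s (b::complex^'n)) \<le> norm a * norm b * K"
    by (rule exI[of _ 1]) (simp add: norm_vector_smult)
qed (auto simp: vec_eq_iff algebra_simps scaleR_conv_of_real[where 'a = complex])

lemmas bounded_linear_vector_smult = bounded_bilinear.bounded_linear_right[OF bounded_bilinear_vector_smult]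

lemma i_smult_i_smult: "\<i> *s (\<i> *s v) = - (v::complex^'n)"
  by (simp add: vec_eq_iff)

text \<open>The derivative is unique, so the complex linear one in the definition of \<open>holo_on\<close> is the
  selected one.\<close>

lemma holo_onD:
  assumes "holo_on S f" "x \<in> S"
  shows "(f has_derivative frechet_derivative f (at x)) (at x)"
    and "frechet_derivative f (at x) (c *s v) = c *s frechet_derivative f (at x) v"
proof -
  obtain D where D: "(f has_derivative D) (at x)" "Vector_Spaces.linear (*s) (*s) D"
    using assms unfolding holo_on_def by blast
  then have eq: "frechet_derivative f (at x) = D" using frechet_derivative_at by metis
  show "(f has_derivative frechet_derivative f (at x)) (at x)" using D eq by simp
  interpret Vector_Spaces.linear "(*s)" "(*s)" D by (rule D(2))
  show "frechet_derivative f (at x) (c *s v) = c *s frechet_derivative f (at x) v"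
    using scale eq by simp
qed

lemma holo_onI:
  fixes f :: "complex^'n \<Rightarrow> complex^'m"
  assumes "\<And>x. x \<in> S \<Longrightarrow> (f has_derivative D x) (at x)"
    and "\<And>x c v. x \<in> S \<Longrightarrow> D x (c *s v) = c *s D x v"
  shows "holo_on S f"
  unfolding holo_on_def
proof
  fix x assume x: "x \<in> S"
  interpret bounded_linear "D x" using has_derivative_bounded_linear[OF assms(1)[OF x]] .
  have "Vector_Spaces.linear (*s) (*s) (D x)"
    by (simp add: Vector_Spaces.linear_iff vec.vector_space_axioms add assms(2)[OF x])
  then show "\<exists>D. (f has_derivative D) (at x) \<and> Vector_Spaces.linear (*s) (*s) D"
    using assms(1)[OF x] by blast
qed

lemma holo_on_local:
  assumes "\<And>x. x \<in> S \<Longrightarrow> \<exists>T g. open T \<and> x \<in> T \<and> holo_on T g \<and> (\<forall>y\<in>T. f y = g y)"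
  shows "holo_on S f"
  unfolding holo_on_def
proof
  fix x assume "x \<in> S"
  then obtain T g where T: "open T" "x \<in> T" "holo_on T g" "\<forall>y\<in>T. f y = g y" using assms by blast
  then obtain D where D: "(g has_derivative D) (at x)" "Vector_Spaces.linear (*s) (*s) D"
    unfolding holo_on_def by blast
  have "(f has_derivative D) (at x)"
    by (rule has_derivative_transform_within_open[OF D(1) T(1,2)]) (use T(4) in simp)
  then show "\<exists>D. (f has_derivative D) (at x) \<and> Vector_Spaces.linear (*s) (*s) D" using D(2) by blast
qed

lemma holo_on_subset: "holo_on S f \<Longrightarrow> T \<subseteq> S \<Longrightarrow> holo_on T f"
  unfolding holo_on_def by blast

lemma holo_on_id: "holo_on S (\<lambda>x. x)"
  by (rule holo_onI[where D = "\<lambda>x v. v"]) auto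

lemma holo_on_compose:
  assumes "holo_on UNIV f" "holo_on UNIV g"
  shows "holo_on UNIV (\<lambda>x. f (g x))"
proof (rule holo_onI)
  show "((\<lambda>x. f (g x)) has_derivative
      (\<lambda>v. frechet_derivative f (at (g x)) (frechet_derivative g (at x) v))) (at x)" for x
    by (rule has_derivative_compose[OF holo_onD(1)[OF assms(2)] holo_onD(1)[OF assms(1)]]) auto
qed (simp add: holo_onD(2)[OF assms(1)] holo_onD(2)[OF assms(2)])

lemma holo_on_imp_continuous_on: "holo_on S f \<Longrightarrow> continuous_on S f"
  unfolding holo_on_def
  by (metis continuous_at_imp_continuous_on has_derivative_continuous)

text \<open>Through this restriction to complex lines, Cauchy's formula and the Schwarz lemma in one variable apply to
  maps of several variables.\<close>

lemma holo_on_line_has_field_derivative: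
  assumes "holo_on UNIV f"
  shows "((\<lambda>\<zeta>. f (x + \<zeta> *s v) $ i) has_field_derivative (frechet_derivative f (at (x + \<zeta> *s v)) v $ i)) (at \<zeta>)"
proof -
  have 1: "((\<lambda>\<zeta>. x + \<zeta> *s v) has_derivative (\<lambda>t. t *s v)) (at \<zeta>)"
    using bounded_linear.has_derivative[OF bounded_bilinear.bounded_linear_left[OF bounded_bilinear_vector_smult] has_derivative_ident]
    by (auto intro!: derivative_eq_intros)
  have 2: "((\<lambda>\<zeta>. f (x + \<zeta> *s v)) has_derivative (\<lambda>t. frechet_derivative f (at (x + \<zeta> *s v)) (t *s v))) (at \<zeta>)"
    by (rule has_derivative_compose[where f = "\<lambda>\<zeta>. x + \<zeta> *s v", OF 1 holo_onD(1)[OF assms UNIV_I]])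
  have "((\<lambda>\<zeta>. f (x + \<zeta> *s v) $ i) has_derivative (\<lambda>t. frechet_derivative f (at (x + \<zeta> *s v)) (t *s v) $ i)) (at \<zeta>)"
    by (rule bounded_linear.has_derivative[OF bounded_linear_vec_nth 2])
  moreover have "(\<lambda>t. frechet_derivative f (at (x + \<zeta> *s v)) (t *s v) $ i) = (*) (frechet_derivative f (at (x + \<zeta> *s v)) v $ i)"
    by (simp add: fun_eq_iff holo_onD(2)[OF assms] mult.commute)
  ultimately show ?thesis by (simp add: has_field_derivative_def)
qed

abbreviation unit_circle :: "real \<Rightarrow> complex" where
  "unit_circle t \<equiv> exp (2 * of_real pi * \<i> * of_real t)"

text \<open>Cauchy's formula for the derivative, on the complex line through \<open>x\<close> in the direction \<open>v\<close>.\<close>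

lemma frechet_derivative_integral:
  fixes f :: "complex^'n \<Rightarrow> complex^'m"
  assumes "holo_on UNIV f"
  shows "frechet_derivative f (at x) v =
    integral (cbox 0 1) (\<lambda>t. inverse (unit_circle t) *s f (x + unit_circle t *s v))" (is "_ = integral _ ?F")
proof -
  have contf: "continuous_on UNIV f" by (rule holo_on_imp_continuous_on[OF assms])
  have cont: "continuous_on (cbox 0 1) ?F"
    by (intro bounded_bilinear.continuous_on[OF bounded_bilinear_vector_smult] continuous_intros
        continuous_on_compose2[OF contf]) auto
  have "frechet_derivative f (at x) v $ i = integral (cbox 0 1) ?F $ i" for i
  proof -
    let ?\<phi> = "\<lambda>\<zeta>. f (x + \<zeta> *s v) $ i"
    note der = holo_on_line_has_field_derivative[OF assms, of x v i]
    have hol: "?\<phi> holomorphic_on UNIV" using der by (auto simp: holomorphic_on_def field_differentiable_def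
        intro: has_field_derivative_at_within)
    have "((\<lambda>u. ?\<phi> u / (u - 0) ^ Suc 1) has_contour_integral ((2 * pi * \<i>) / fact 1 * (deriv ^^ 1) ?\<phi> 0)) (circlepath 0 1)"
      by (rule Cauchy_has_contour_integral_higher_derivative_circlepath)
         (auto intro: holomorphic_on_subset[OF hol] continuous_on_subset[OF holomorphic_on_imp_continuous_on[OF hol]])
    then have "((\<lambda>t. ?\<phi> (unit_circle t) / (unit_circle t)\<^sup>2 * (2 * pi * \<i> * unit_circle t)) has_integral
        (2 * pi * \<i> * deriv ?\<phi> 0)) {0..1}"
      unfolding has_contour_integral vector_derivative_circlepath
      by (simp add: circlepath power2_eq_square mult.assoc)
    from has_integral_mult_right[OF this, of "inverse (2 * pi * \<i>)"]
    have "((\<lambda>t. inverse (unit_circle t) * ?\<phi> (unit_circle t)) has_integral deriv ?\<phi> 0) {0..1}"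
      by (simp add: field_simps power2_eq_square)
    moreover have "deriv ?\<phi> 0 = frechet_derivative f (at x) v $ i"
      using DERIV_imp_deriv[OF der[of 0]] by simp
    ultimately have "((\<lambda>t. ?F t $ i) has_integral (frechet_derivative f (at x) v $ i)) (cbox 0 1)"
      by simp
    then have "integral (cbox 0 1) (\<lambda>t. ?F t $ i) = frechet_derivative f (at x) v $ i"
      by (rule integral_unique)
    then show ?thesis
      using integral_linear[OF integrable_continuous[OF cont] bounded_linear_vec_nth[of i]] by (simp add: o_def)
  qed
  then show ?thesis by (simp add: vec_eq_iff)
qed

lemma continuous_frechet_derivative:
  assumes "holo_on UNIV f"
  shows "continuous_on UNIV (\<lambda>x. frechet_derivative f (at x) v)"
proof -
  have contf: "continuous_on UNIV f" by (rule holo_on_imp_continuous_on[OF assms])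
  have "continuous_on UNIV (\<lambda>x. integral (cbox 0 1) (\<lambda>t. inverse (unit_circle t) *s f (x + unit_circle t *s v)))"
    unfolding split_def
    by (intro integral_continuous_on_param, unfold split_def)
       (intro bounded_bilinear.continuous_on[OF bounded_bilinear_vector_smult] continuous_intros
        continuous_on_compose2[OF contf], auto)
  then show ?thesis by (simp add: frechet_derivative_integral[OF assms])
qed

text \<open>Differentiating Cauchy's formula under the integral sign shows that directional derivatives of
  entire maps are entire; the derivative stays complex linear because the integrand is.\<close>

lemma holo_on_frechet_derivative:
  fixes f :: "complex^'n \<Rightarrow> complex^'m"
  assumes "holo_on UNIV f"
  shows "holo_on UNIV (\<lambda>x. frechet_derivative f (at x) v)"
proof -
  let ?e = unit_circle
  let ?D = "\<lambda>x. frechet_derivative f (at x)"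
  define B where "B = (\<lambda>x t. Blinfun (\<lambda>h. inverse (?e t) *s ?D (x + ?e t *s v) h))"
  have bl: "bounded_linear (\<lambda>h. inverse (?e t) *s ?D y h)" for t y
    by (rule bounded_linear_compose[OF bounded_linear_vector_smult has_derivative_bounded_linear[OF holo_onD(1)[OF assms]]]) simp
  have B: "blinfun_apply (B x t) = (\<lambda>h. inverse (?e t) *s ?D (x + ?e t *s v) h)" for x t
    unfolding B_def by (rule bounded_linear_Blinfun_apply[OF bl])
  have contf: "continuous_on UNIV f" by (rule holo_on_imp_continuous_on[OF assms])
  have contB: "continuous_on (UNIV \<times> cbox 0 1) (\<lambda>(x, t). B x t)"
    unfolding split_def
    by (rule continuous_on_blinfun_componentwise, unfold B,
        intro bounded_bilinear.continuous_on[OF bounded_bilinear_vector_smult] continuous_intros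
        continuous_on_compose2[OF continuous_frechet_derivative[OF assms]]) auto
  have contBx: "continuous_on (cbox 0 1) (B x)" for x
    using continuous_on_compose2[OF contB, of "cbox 0 1" "\<lambda>t. (x, t)"] by (force intro!: continuous_intros)
  have der: "((\<lambda>x. integral (cbox 0 1) ((\<lambda>x t. inverse (?e t) *s f (x + ?e t *s v)) x))
      has_derivative blinfun_apply (integral (cbox 0 1) (B x0))) (at x0 within UNIV)" for x0
  proof (rule leibniz_rule[OF _ _ contB UNIV_I convex_UNIV])
    fix x t
    have "((\<lambda>x. inverse (?e t) *s f (x + ?e t *s v)) has_derivative blinfun_apply (B x t)) (at x)"
      unfolding B
    proof (rule bounded_linear.has_derivative[OF bounded_linear_vector_smult])
      have "((\<lambda>x. x + ?e t *s v) has_derivative (\<lambda>h. h)) (at x)" by (auto intro!: derivative_eq_intros)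
      then show "((\<lambda>x. f (x + ?e t *s v)) has_derivative ?D (x + ?e t *s v)) (at x)"
        by (rule has_derivative_compose[where f = "\<lambda>x. x + ?e t *s v"]) (rule holo_onD(1)[OF assms UNIV_I])
    qed
    then show "((\<lambda>x. inverse (?e t) *s f (x + ?e t *s v)) has_derivative blinfun_apply (B x t)) (at x within UNIV)"
      by simp
  next
    fix x
    show "(\<lambda>t. inverse (?e t) *s f (x + ?e t *s v)) integrable_on cbox 0 1"
      by (intro integrable_continuous bounded_bilinear.continuous_on[OF bounded_bilinear_vector_smult]
          continuous_intros continuous_on_compose2[OF contf]) auto
  qed
  show ?thesis
  proof (rule holo_onI)
    show "((\<lambda>x. ?D x v) has_derivative blinfun_apply (integral (cbox 0 1) (B x))) (at x)" for x
      using der by (simp add: frechet_derivative_integral[OF assms])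
    show "blinfun_apply (integral (cbox 0 1) (B x)) (c *s h) = c *s blinfun_apply (integral (cbox 0 1) (B x)) h" for x c h
    proof -
      have i: "B x integrable_on cbox 0 1" by (rule integrable_continuous[OF contBx])
      have "(\<lambda>t. blinfun_apply (B x t) h) integrable_on cbox 0 1"
        using integrable_linear[OF i blinfun.bounded_linear_left[of h]] by (simp add: o_def)
      from integral_linear[OF this bounded_linear_vector_smult[of c]]
      have "integral (cbox 0 1) (\<lambda>t. c *s blinfun_apply (B x t) h)
          = c *s integral (cbox 0 1) (\<lambda>t. blinfun_apply (B x t) h)" by (simp add: o_def)
      moreover have "blinfun_apply (B x t) (c *s h) = c *s blinfun_apply (B x t) h" for t
        by (simp add: B holo_onD(2)[OF assms] vec_eq_iff)
      ultimately show ?thesis unfolding blinfun_apply_integral[OF i] by simp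
    qed
  qed
qed

text \<open>Holomorphy is preserved by taking directional derivatives, so it can be used as induction
  invariant.\<close>

lemma holo_on_imp_smooth_on:
  assumes "holo_on UNIV f"
  shows "smooth_on UNIV f"
  unfolding smooth_on_def
proof
  show "Ck_on k UNIV f" for k
    using assms
  proof (induction k arbitrary: f)
    case 0
    then show ?case by (simp add: holo_on_imp_continuous_on)
  next
    case (Suc k)
    show ?case
      by (rule Ck_on_SucI[OF open_UNIV holo_onD(1)[OF Suc.prems]])
         (auto intro: Suc.IH holo_on_frechet_derivative[OF Suc.prems])
  qed
qed

section \<open>The operator \<open>dd\<^sup>c\<close>\<close>

abbreviation der :: "('a::real_normed_vector \<Rightarrow> 'b::real_normed_vector) \<Rightarrow> 'a \<Rightarrow> 'a \<Rightarrow> 'b" where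
  "der f x v \<equiv> frechet_derivative f (at x) v"

text \<open>The direction \<open>v\<close> is differentiated along first; \<open>u\<close> is the direction of the outer derivative.\<close>

abbreviation der2 :: "('a::real_normed_vector \<Rightarrow> 'b::real_normed_vector) \<Rightarrow> 'a \<Rightarrow> 'a \<Rightarrow> 'a \<Rightarrow> 'b" where
  "der2 f x u v \<equiv> der (\<lambda>y. der f y v) x u"

abbreviation ddc :: "(complex^'n \<Rightarrow> real) \<Rightarrow> complex^'n \<Rightarrow> complex^'n \<Rightarrow> complex^'n \<Rightarrow> real" where
  "ddc f \<equiv> ext_deriv1 (dc f)"

lemma der_eqI: "(f has_derivative D) (at x) \<Longrightarrow> der f x v = D v"
  using frechet_derivative_at by metis

lemma der_add_right: "smooth_on S f \<Longrightarrow> x \<in> S \<Longrightarrow> der f x (u + v) = der f x u + der f x v"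
  using linear_add[OF has_derivative_linear[OF smooth_on_has_derivative]] by blast

lemma der_scaleR_right: "smooth_on S f \<Longrightarrow> x \<in> S \<Longrightarrow> der f x (c *\<^sub>R v) = c *\<^sub>R der f x v"
  using linear_cmul[OF has_derivative_linear[OF smooth_on_has_derivative]] by blast

lemma der_add:
  "smooth_on S f \<Longrightarrow> smooth_on S g \<Longrightarrow> x \<in> S \<Longrightarrow> der (\<lambda>y. f y + g y) x v = der f x v + der g x v"
  by (rule der_eqI) (intro has_derivative_add smooth_on_has_derivative)

lemma der_cmult:
  fixes f :: "'a::real_normed_vector \<Rightarrow> real"
  shows "smooth_on S f \<Longrightarrow> x \<in> S \<Longrightarrow> der (\<lambda>y. c * f y) x v = c * der f x v"
  by (rule der_eqI) (intro has_derivative_mult_right smooth_on_has_derivative)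

lemma der_minus:
  "smooth_on S f \<Longrightarrow> x \<in> S \<Longrightarrow> der (\<lambda>y. - f y) x v = - der f x v"
  by (rule der_eqI) (intro has_derivative_minus smooth_on_has_derivative)

lemma der_cong_open:
  "open S \<Longrightarrow> x \<in> S \<Longrightarrow> (\<And>y. y \<in> S \<Longrightarrow> f y = g y) \<Longrightarrow> der f x v = der g x v"
  using frechet_derivative_cong_open[of S x f g] by simp

context
  fixes S :: "'a::real_normed_vector set" and f :: "'a \<Rightarrow> 'b::real_normed_vector"
  assumes S: "open S" and f: "smooth_on S f"
begin

lemma der2_add_right: "x \<in> S \<Longrightarrow> der2 f x u (v + w) = der2 f x u v + der2 f x u w"
proof -
  assume x: "x \<in> S"
  have "der2 f x u (v + w) = der (\<lambda>y. der f y v + der f y w) x u"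
    by (rule der_cong_open[OF S x]) (rule der_add_right[OF f])
  also have "\<dots> = der2 f x u v + der2 f x u w"
    by (rule der_add[OF _ _ x]) (rule smooth_on_frechet_derivative[OF f])+
  finally show ?thesis .
qed

lemma der2_scaleR_right: "x \<in> S \<Longrightarrow> der2 f x u (c *\<^sub>R v) = c *\<^sub>R der2 f x u v"
proof -
  assume x: "x \<in> S"
  have "der2 f x u (c *\<^sub>R v) = der (\<lambda>y. c *\<^sub>R der f y v) x u"
    by (rule der_cong_open[OF S x]) (rule der_scaleR_right[OF f])
  also have "\<dots> = c *\<^sub>R der2 f x u v"
    by (rule der_eqI, rule has_derivative_scaleR_right)
       (rule smooth_on_has_derivative[OF smooth_on_frechet_derivative[OF f] x])
  finally show ?thesis .
qed

lemma der2_minus_right: "x \<in> S \<Longrightarrow> der2 f x u (- v) = - der2 f x u v"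
  using der2_scaleR_right[where c = "-1"] by simp

end

text \<open>The derivative of \<open>f\<close> is evaluated at a moving point and on a moving vector \<open>der G y v\<close>. Expanding this
  vector in the standard basis turns it into a sum of products of scalar functions with functions of \<open>G y\<close>, to
  which the product rule applies.\<close>

lemma der2_compose:
  fixes G :: "'a::real_normed_vector \<Rightarrow> 'b::euclidean_space" and f :: "'b \<Rightarrow> 'c::real_normed_vector"
  assumes S: "open S" and T: "open T" and GS: "G ` S \<subseteq> T" and G: "smooth_on S G" and f: "smooth_on T f"
    and x: "x \<in> S"
  shows "der2 (\<lambda>y. f (G y)) x u v = der2 f (G x) (der G x u) (der G x v) + der f (G x) (der2 G x u v)"
proof -
  have GT: "G y \<in> T" if "y \<in> S" for y using GS that by auto
  have exp1: "der f z w = (\<Sum>b\<in>Basis. (w \<bullet> b) *\<^sub>R der f z b)" if "z \<in> T" for z w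
  proof -
    interpret bounded_linear "frechet_derivative f (at z)"
      by (rule has_derivative_bounded_linear[OF smooth_on_has_derivative[OF f that]])
    show ?thesis by (subst euclidean_representation[of w, symmetric]) (simp only: sum scaleR)
  qed
  have exp2: "der2 f z a w = (\<Sum>b\<in>Basis. (w \<bullet> b) *\<^sub>R der2 f z a b)" if "z \<in> T" for z a w
  proof -
    interpret Real_Vector_Spaces.linear "\<lambda>w. der2 f z a w"
      by (rule linearI) (simp_all add: der2_add_right[OF T f that] der2_scaleR_right[OF T f that])
    show ?thesis by (subst euclidean_representation[of w, symmetric]) (simp only: sum scaleR)
  qed
  have chain: "der (\<lambda>y. f (G y)) y v = der f (G y) (der G y v)" if "y \<in> S" for y
    by (rule der_eqI, rule has_derivative_compose[OF smooth_on_has_derivative[OF G that]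
          smooth_on_has_derivative[OF f GT[OF that]]])
  have "der (\<lambda>y. f (G y)) y v = (\<Sum>b\<in>Basis. (der G y v \<bullet> b) *\<^sub>R der f (G y) b)" if "y \<in> S" for y
    by (rule trans[OF chain[OF that] exp1[OF GT[OF that]]])
  then have "der2 (\<lambda>y. f (G y)) x u v = der (\<lambda>y. \<Sum>b\<in>Basis. (der G y v \<bullet> b) *\<^sub>R der f (G y) b) x u"
    by (rule der_cong_open[OF S x])
  also have "\<dots> = (\<Sum>b\<in>Basis. (der G x v \<bullet> b) *\<^sub>R der2 f (G x) (der G x u) b + (der2 G x u v \<bullet> b) *\<^sub>R der f (G x) b)"
  proof (rule der_eqI, intro has_derivative_sum bounded_bilinear.FDERIV[OF bounded_bilinear_scaleR])
    fix b :: 'b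
    show "((\<lambda>y. der G y v \<bullet> b) has_derivative (\<lambda>u. der2 G x u v \<bullet> b)) (at x)"
      by (rule bounded_linear.has_derivative[OF bounded_linear_inner_left
            smooth_on_has_derivative[OF smooth_on_frechet_derivative[OF G] x]])
    show "((\<lambda>y. der f (G y) b) has_derivative (\<lambda>u. der2 f (G x) (der G x u) b)) (at x)"
      by (rule has_derivative_compose[OF smooth_on_has_derivative[OF G x]
            smooth_on_has_derivative[OF smooth_on_frechet_derivative[OF f] GT[OF x]]])
  qed
  also have "\<dots> = der2 f (G x) (der G x u) (der G x v) + der f (G x) (der2 G x u v)"
    unfolding sum.distrib exp1[OF GT[OF x], of "der2 G x u v"]
      exp2[OF GT[OF x], where a = "der G x u" and w = "der G x v"] ..
  finally show ?thesis .
qed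

lemma smooth_on_dc: "open S \<Longrightarrow> smooth_on S f \<Longrightarrow> smooth_on S (\<lambda>x. dc f x v)"
  unfolding dc_def
  by (intro smooth_on_bounded_linear_compose[OF _ bounded_linear_minus[OF bounded_linear_ident]] smooth_on_frechet_derivative)

lemma ddc_cong_open:
  assumes "open S" "x \<in> S" "\<And>y. y \<in> S \<Longrightarrow> f y = g y"
  shows "ddc f x v w = ddc g x v w"
proof -
  have "dc f y w = dc g y w" if "y \<in> S" for y w
    unfolding dc_def using der_cong_open[OF assms(1) that assms(3)] by simp
  then have "der (\<lambda>y. dc f y w) x v = der (\<lambda>y. dc g y w) x v" for v w
    by (rule der_cong_open[OF assms(1,2)])
  then show ?thesis unfolding ext_deriv1_def by simp
qed

lemma ddc_alternating: "ddc f x v v = 0"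
  by (simp add: ext_deriv1_def)

context
  fixes S :: "(complex^'n) set" and f :: "complex^'n \<Rightarrow> real"
  assumes S: "open S" and f: "smooth_on S f"
begin

lemma ddc_eq_der2: "x \<in> S \<Longrightarrow> ddc f x v w = der2 f x w (\<i> *s v) - der2 f x v (\<i> *s w)"
  by (simp add: ext_deriv1_def dc_def der_minus[OF smooth_on_frechet_derivative[OF f]])

lemma ddc_bilinear:
  assumes x: "x \<in> S"
  shows "bilinear (ddc f x)"
proof -
  have i: "\<i> *s (v + w) = \<i> *s v + \<i> *s w" "\<i> *s (c *\<^sub>R v) = c *\<^sub>R (\<i> *s v)" for v w :: "complex^'n" and c
    by (simp_all add: vec_eq_iff algebra_simps)
  note f' = smooth_on_frechet_derivative[OF f]
  have "linear (\<lambda>w. ddc f x v w)" "linear (\<lambda>v. ddc f x v w)" for v w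
    by (rule linearI; simp add: ddc_eq_der2[OF x] i der_add_right[OF f' x] der_scaleR_right[OF f' x]
        der2_add_right[OF S f x] der2_scaleR_right[OF S f x] right_diff_distrib)+
  then show ?thesis unfolding bilinear_def by simp
qed

lemma smooth_on_ddc: "smooth_on S (\<lambda>x. ddc f x v w)"
  by (rule smooth_on_cong[OF S, of "\<lambda>x. der2 f x w (\<i> *s v) - der2 f x v (\<i> *s w)"])
     (auto simp: ddc_eq_der2 intro!: smooth_on_diff[OF S] smooth_on_frechet_derivative f)

text \<open>Multiplying both arguments by the imaginary unit interchanges the two terms of
  \<open>ddc_eq_der2\<close>, each with the two directions of its second derivative swapped.\<close>

lemma ddc_i_invariant: "x \<in> S \<Longrightarrow> ddc f x (\<i> *s v) (\<i> *s w) = ddc f x v w"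
  using second_derivative_symmetric[OF S f]
  by (simp add: ddc_eq_der2 i_smult_i_smult der2_minus_right[OF S f])

text \<open>On a complex line, \<open>dd\<^sup>c f\<close> is the Laplacian of the restriction of \<open>f\<close>.\<close>

lemma ddc_diagonal: "x \<in> S \<Longrightarrow> ddc f x v (\<i> *s v) = der2 f x v v + der2 f x (\<i> *s v) (\<i> *s v)"
  by (simp add: ddc_eq_der2 i_smult_i_smult der2_minus_right[OF S f])

text \<open>The six third derivatives cancel in pairs, since the second derivatives of each function
  \<open>der f y (\<i> *s a)\<close> are symmetric.\<close>

lemma ddc_closed:
  assumes x: "x \<in> S"
  shows "ext_deriv2 (ddc f) x u v w = 0"
proof -
  have f'': "smooth_on S (\<lambda>y. der2 f y a b)" for a b
    by (intro smooth_on_frechet_derivative f)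
  have *: "der (\<lambda>y. ddc f y a b) x c = der2 (\<lambda>y. der f y (\<i> *s a)) x c b - der2 (\<lambda>y. der f y (\<i> *s b)) x c a" for a b c
  proof -
    have "der (\<lambda>y. ddc f y a b) x c = der (\<lambda>y. der2 f y b (\<i> *s a) - der2 f y a (\<i> *s b)) x c"
      by (rule der_cong_open[OF S x]) (rule ddc_eq_der2)
    also have "\<dots> = der2 (\<lambda>y. der f y (\<i> *s a)) x c b - der2 (\<lambda>y. der f y (\<i> *s b)) x c a"
      by (rule der_eqI) (intro has_derivative_diff smooth_on_has_derivative[OF f'' x])
    finally show ?thesis .
  qed
  have sym: "der2 (\<lambda>y. der f y c) x a b = der2 (\<lambda>y. der f y c) x b a" for a b c
    by (rule second_derivative_symmetric[OF S smooth_on_frechet_derivative[OF f] x])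
  show ?thesis
    unfolding ext_deriv2_def *
    using sym[of "\<i> *s u" v w] sym[of "\<i> *s v" u w] sym[of "\<i> *s w" u v] by simp
qed

lemma ddc_cmult:
  assumes x: "x \<in> S"
  shows "ddc (\<lambda>y. c * f y) x v w = c * ddc f x v w"
proof -
  have dc: "dc (\<lambda>y. c * f y) y w = c * dc f y w" if "y \<in> S" for y w
    by (simp add: dc_def der_cmult[OF f that])
  have "der (\<lambda>y. dc (\<lambda>y. c * f y) y w) x v = der (\<lambda>y. c * dc f y w) x v" for v w
    by (rule der_cong_open[OF S x]) (rule dc)
  then have "der (\<lambda>y. dc (\<lambda>y. c * f y) y w) x v = c * der (\<lambda>y. dc f y w) x v" for v w
    by (simp only: der_cmult[OF smooth_on_dc[OF S f] x])
  then show ?thesis by (simp add: ext_deriv1_def right_diff_distrib)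
qed

end

text \<open>The form \<open>dd\<^sup>c\<close> commutes with holomorphic pullback. Of the two terms of the second-order chain rule, those
  with second derivatives of \<open>G\<close> cancel, since these are complex bilinear and symmetric.\<close>

lemma ddc_holomorphic_pullback:
  assumes G: "holo_on UNIV G" and T: "open T" and f: "smooth_on T f" and x: "G x \<in> T"
  shows "ddc (\<lambda>y. f (G y)) x v w = ddc f (G x) (der G x v) (der G x w)"
proof -
  have Gs: "smooth_on UNIV G" by (rule holo_on_imp_smooth_on[OF G])
  have S: "open (G -` T)"
    using T continuous_on_open_vimage[OF open_UNIV, of G] holo_on_imp_continuous_on[OF G] by auto
  have GS: "smooth_on (G -` T) G" using smooth_on_subset[OF Gs] by simp
  have fG: "smooth_on (G -` T) (\<lambda>y. f (G y))" by (rule smooth_on_compose[OF S T _ GS f]) auto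
  note c = der2_compose[OF S T _ GS f, of x]
  have i: "der (\<lambda>y. \<i> *s der G y b) x a = \<i> *s der2 G x a b" for a b
    by (rule der_eqI, rule bounded_linear.has_derivative[OF bounded_linear_vector_smult])
       (rule holo_onD(1)[OF holo_on_frechet_derivative[OF G] UNIV_I])
  have sym: "der2 G x w v = der2 G x v w"
    by (rule second_derivative_symmetric[OF open_UNIV Gs UNIV_I])
  show ?thesis
    using x by (simp add: ddc_eq_der2[OF S fG] ddc_eq_der2[OF T f] c i sym holo_onD(2)[OF G] image_subset_iff)
qed

text \<open>Only meaningful for functions that are smooth near the point.\<close>

definition strictly_psh_at :: "(complex^'n \<Rightarrow> real) \<Rightarrow> complex^'n \<Rightarrow> bool" where
  "strictly_psh_at f x \<longleftrightarrow> (\<forall>v. v \<noteq> 0 \<longrightarrow> ddc f x v (\<i> *s v) > 0)"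

lemma smooth_on_inner_self: "open S \<Longrightarrow> smooth_on S G \<Longrightarrow> smooth_on S (\<lambda>y. G y \<bullet> G y)"
  by (rule smooth_on_bilinear[OF _ bounded_bilinear_inner])

text \<open>The function is the pullback of the squared norm, whose \<open>dd\<^sup>c\<close> is four times the standard
  Hermitian form.\<close>

lemma ddc_norm_holomorphic:
  fixes G :: "complex^'n \<Rightarrow> complex^'m"
  assumes G: "holo_on UNIV G"
  shows "ddc (\<lambda>y. G y \<bullet> G y) x v (\<i> *s v) = 4 * (der G x v \<bullet> der G x v)"
proof -
  let ?q = "\<lambda>z::complex^'m. z \<bullet> z"
  have q: "smooth_on UNIV ?q" by (intro smooth_on_inner_self smooth_on_ident open_UNIV)
  have Gx: "holo_on UNIV (\<lambda>y. y :: complex^'m)" by (rule holo_on_id)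
  have d1: "der ?q y a = 2 * (y \<bullet> a)" for y a
    by (rule der_eqI) (auto intro!: derivative_eq_intros simp: inner_commute)
  have d2: "der2 ?q y a b = 2 * (a \<bullet> b)" for y a b
    unfolding d1 by (rule der_eqI) (auto intro!: derivative_eq_intros)
  have "ddc (\<lambda>y. ?q (G y)) x v (\<i> *s v) = ddc ?q (G x) (der G x v) (\<i> *s der G x v)"
    using ddc_holomorphic_pullback[OF G open_UNIV q] holo_onD(2)[OF G] by simp
  also have "\<dots> = 2 * (der G x v \<bullet> der G x v) + 2 * ((\<i> *s der G x v) \<bullet> (\<i> *s der G x v))"
    by (simp add: ddc_diagonal[OF open_UNIV q] d2)
  also have "(\<i> *s der G x v) \<bullet> (\<i> *s der G x v) = der G x v \<bullet> der G x v"
    by (simp add: inner_vec_def inner_complex_def add.commute)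
  finally show ?thesis by simp
qed

lemma ddc_add:
  assumes S: "open S" and f: "smooth_on S f" and g: "smooth_on S g" and x: "x \<in> S"
  shows "ddc (\<lambda>y. f y + g y) x v w = ddc f x v w + ddc g x v w"
proof -
  have dc: "dc (\<lambda>y. f y + g y) y w = dc f y w + dc g y w" if "y \<in> S" for y w
    by (simp add: dc_def der_add[OF f g that])
  have "der (\<lambda>y. dc (\<lambda>y. f y + g y) y w) x v = der (\<lambda>y. dc f y w + dc g y w) x v" for v w
    by (rule der_cong_open[OF S x]) (rule dc)
  then have "der (\<lambda>y. dc (\<lambda>y. f y + g y) y w) x v = der (\<lambda>y. dc f y w) x v + der (\<lambda>y. dc g y w) x v" for v w
    by (simp only: der_add[OF smooth_on_dc[OF S f] smooth_on_dc[OF S g] x])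
  then show ?thesis by (simp add: ext_deriv1_def)
qed

lemma ddc_const: "ddc (\<lambda>y. c) x v w = 0"
  by (simp add: ext_deriv1_def dc_def)

lemma ddc_sum:
  assumes "open S" "\<And>i. i \<in> I \<Longrightarrow> smooth_on S (f i)" "x \<in> S"
  shows "ddc (\<lambda>y. \<Sum>i\<in>I. f i y) x v w = (\<Sum>i\<in>I. ddc (f i) x v w)"
  using assms(2)
proof (induction I rule: infinite_finite_induct)
  case (insert i I)
  then show ?case
    using ddc_add[OF assms(1) _ smooth_on_sum[OF assms(1), of I f] assms(3), of "f i" v w] by simp
qed (simp_all add: ddc_const)

text \<open>The first summand is nonnegative for convex \<open>F\<close>; this is why convex nondecreasing profiles preserve
  plurisubharmonicity.\<close>

lemma ddc_compose_real:
  fixes q :: "complex^'n \<Rightarrow> real"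
  assumes S: "open S" and q: "smooth_on S q" and F: "smooth_on UNIV F" and x: "x \<in> S"
    and F1: "\<And>t. (F has_real_derivative F' t) (at t)" and F2: "\<And>t. (F' has_real_derivative F'' t) (at t)"
  shows "ddc (\<lambda>y. F (q y)) x v (\<i> *s v)
    = F'' (q x) * ((der q x v)\<^sup>2 + (der q x (\<i> *s v))\<^sup>2) + F' (q x) * ddc q x v (\<i> *s v)"
proof -
  have Fq: "smooth_on S (\<lambda>y. F (q y))" by (rule smooth_on_compose[OF S open_UNIV _ q F]) auto
  have d1: "der F t a = F' t * a" for t a
    using der_eqI[OF F1[unfolded has_field_derivative_def]] by simp
  have d2: "der2 F t a b = F'' t * a * b" for t a b
    unfolding d1 by (rule der_eqI) (auto intro!: derivative_eq_intros F2[unfolded has_field_derivative_def] simp: fun_eq_iff)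
  have "der2 (\<lambda>y. F (q y)) x u u = F'' (q x) * (der q x u)\<^sup>2 + F' (q x) * der2 q x u u" for u
    unfolding der2_compose[OF S open_UNIV subset_UNIV q F x] using d2[unfolded d1] by (simp add: d1 power2_eq_square)
  then show ?thesis
    by (simp add: ddc_diagonal[OF S Fq x] ddc_diagonal[OF S q x] algebra_simps)
qed

section \<open>A smooth convex approximation of the positive part\<close>

text \<open>The functions \<open>x\<^sup>-\<^sup>n exp (-1/x)\<close>, continued by zero. The family is closed, up to linear combinations,
  under differentiation, and therefore all members are smooth by a simultaneous induction.\<close>

definition flat_exp :: "nat \<Rightarrow> real \<Rightarrow> real" where
  "flat_exp n x = (if x > 0 then inverse x ^ n / exp (inverse x) else 0)"

lemma flat_exp_has_derivative:
  "(flat_exp n has_real_derivative flat_exp (n + 2) x - real n * flat_exp (n + 1) x) (at x)"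
proof -
  consider "x > 0" | "x < 0" | "x = 0" by linarith
  then show ?thesis
  proof cases
    case 1
    have *: "((\<lambda>x. inverse x ^ n / exp (inverse x)) has_real_derivative
        inverse x ^ (n + 2) / exp (inverse x) - real n * (inverse x ^ (n + 1) / exp (inverse x))) (at x)"
    proof (cases n)
      case 0
      then show ?thesis using 1
        by (auto intro!: derivative_eq_intros simp: power2_eq_square divide_simps)
    next
      case (Suc k)
      have "((\<lambda>x. inverse x ^ Suc k / exp (inverse x)) has_real_derivative
          ((1 + real k) * (- (inverse x ^ Suc (Suc 0)) * inverse x ^ k) * exp (inverse x)
            - inverse x ^ Suc k * (exp (inverse x) * - (inverse x ^ Suc (Suc 0)))) / (exp (inverse x) * exp (inverse x))) (at x)"
        using 1 by (intro DERIV_divide DERIV_power_Suc DERIV_inverse DERIV_fun_exp) auto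
      then show ?thesis unfolding Suc
        by (rule DERIV_cong) (use 1 in \<open>simp add: field_simps\<close>)
    qed
    have "(flat_exp n has_real_derivative
        inverse x ^ (n + 2) / exp (inverse x) - real n * (inverse x ^ (n + 1) / exp (inverse x))) (at x)"
      by (rule has_field_derivative_transform_within_open[OF *, of "{0<..}"])
         (use 1 in \<open>simp_all add: flat_exp_def\<close>)
    then show ?thesis using 1 by (simp add: flat_exp_def)
  next
    case 2
    have "(flat_exp n has_real_derivative 0) (at x)"
      by (rule has_field_derivative_transform_within_open[of "\<lambda>_. 0" _ _ "{..<0}"])
         (use 2 in \<open>simp_all add: flat_exp_def\<close>)
    then show ?thesis using 2 by (simp add: flat_exp_def)
  next
    case 3
    \<comment> \<open>the difference quotient at zero is again a member of the family\<close>
    have "((\<lambda>h. flat_exp n h / h) \<longlongrightarrow> 0) (at_right 0)"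
    proof -
      have "((\<lambda>h. inverse h ^ Suc n / exp (inverse h)) \<longlongrightarrow> (0::real)) (at_right 0)"
        by (rule filterlim_compose[OF tendsto_power_div_exp_0 filterlim_inverse_at_top_right])
      then show ?thesis
        by (rule Lim_transform_eventually[OF _ eventually_mono[OF eventually_at_right_less]])
           (simp add: flat_exp_def field_simps)
    qed
    moreover have "((\<lambda>h. flat_exp n h / h) \<longlongrightarrow> 0) (at_left 0)"
      by (rule Lim_transform_eventually[OF tendsto_const eventually_mono[OF eventually_at_left_real[of "-1"]]])
         (simp_all add: flat_exp_def)
    ultimately have "((\<lambda>h. flat_exp n h / h) \<longlongrightarrow> 0) (at 0)"
      by (simp add: filterlim_split_at)
    then show ?thesis using 3 by (simp add: flat_exp_def DERIV_def)
  qed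
qed

lemma smooth_on_real_antiderivative:
  fixes f :: "real \<Rightarrow> real"
  assumes "\<And>x. (f has_real_derivative f' x) (at x)" "smooth_on UNIV f'"
  shows "smooth_on UNIV f"
  by (rule smooth_onI[OF open_UNIV assms(1)[unfolded has_field_derivative_def]])
     (intro smooth_on_mult smooth_on_const assms(2) open_UNIV)

lemma smooth_on_flat_exp: "smooth_on UNIV (flat_exp n)"
  unfolding smooth_on_def
proof
  show "Ck_on k UNIV (flat_exp n)" for k
  proof (induction k arbitrary: n)
    case 0
    have "isCont (flat_exp n) x" for x by (rule DERIV_isCont[OF flat_exp_has_derivative])
    then show ?case by (simp add: continuous_at_imp_continuous_on)
  next
    case (Suc k)
    show ?case
    proof (rule Ck_on_SucI[OF open_UNIV flat_exp_has_derivative[unfolded has_field_derivative_def]])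
      fix v :: real
      have "Ck_on k UNIV (\<lambda>x. (flat_exp (n + 2) x + (- real n) * flat_exp (n + 1) x) * v)"
        by (intro Ck_on_bilinear[OF _ bounded_bilinear_mult] Ck_on_add Ck_on_const Suc.IH open_UNIV)
      then show "Ck_on k UNIV (\<lambda>x. (flat_exp (n + 2) x - real n * flat_exp (n + 1) x) * v)"
        by simp
    qed
  qed
qed

lemma ex_antiderivative:
  fixes f :: "real \<Rightarrow> real"
  assumes "continuous_on UNIV f"
  shows "\<exists>F. \<forall>x. (F has_real_derivative f x) (at x)"
proof -
  have "isCont f x" for x using assms by (simp add: continuous_on_eq_continuous_at)
  then have "\<exists>F. \<forall>x. - \<infinity> < ereal x \<longrightarrow> ereal x < \<infinity> \<longrightarrow> (F has_vector_derivative f x) (at x)"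
    by (intro einterval_antiderivative) auto
  then show ?thesis by (auto simp: has_real_derivative_iff_has_vector_derivative)
qed

lemma mean_value_ge:
  fixes F :: "real \<Rightarrow> real"
  assumes "\<And>x. (F has_real_derivative f x) (at x)" "a < b"
  obtains z where "a < z" "z < b" "F b - F a = (b - a) * f z"
  using MVT2[OF assms(2), of F f] assms(1) by blast

text \<open>The second derivative is a bump supported in \<open>[-1, 1]\<close> whose integral is normalized to one; the
  profile itself is obtained by integrating twice. The offset \<open>c\<close> is left as it comes out; it only has to be
  bounded.\<close>

lemma smooth_convex_profile:
  obtains F F' F'' :: "real \<Rightarrow> real" and c :: real
  where "smooth_on UNIV F"
    "\<And>t. (F has_real_derivative F' t) (at t)" "\<And>t. (F' has_real_derivative F'' t) (at t)"
    "\<And>t. 0 \<le> F' t" "\<And>t. F' t \<le> 1" "\<And>t. 0 \<le> F'' t" "\<And>t. 0 \<le> F t"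
    "\<And>t. t \<le> -1 \<Longrightarrow> F t = 0" "\<And>t. t \<ge> 1 \<Longrightarrow> F t = t + c" "-1 \<le> c" "c \<le> 1"
proof -
  define \<kappa> where "\<kappa> = (\<lambda>x. flat_exp 0 (1 + x) * flat_exp 0 (1 - x))"
  have \<kappa>_nonneg: "\<kappa> x \<ge> 0" for x by (simp add: \<kappa>_def flat_exp_def)
  have \<kappa>_pos: "\<kappa> x > 0" if "-1 < x" "x < 1" for x using that by (simp add: \<kappa>_def flat_exp_def)
  have \<kappa>_0: "\<kappa> x = 0" if "x \<le> -1 \<or> x \<ge> 1" for x using that by (auto simp: \<kappa>_def flat_exp_def)
  have \<kappa>_smooth: "smooth_on UNIV \<kappa>"
    unfolding \<kappa>_def
    by (intro smooth_on_mult smooth_on_compose[OF open_UNIV open_UNIV _ _ smooth_on_flat_exp]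
        smooth_on_add smooth_on_diff smooth_on_const smooth_on_ident open_UNIV subset_UNIV)
  obtain G where G: "\<And>x. (G has_real_derivative \<kappa> x) (at x)"
    using ex_antiderivative[OF smooth_on_imp_continuous_on[OF \<kappa>_smooth]] by blast
  obtain z where "-1 < z" "z < 1" "G 1 - G (-1) = (1 - (-1)) * \<kappa> z"
    using mean_value_ge[OF G, of "-1" 1] by auto
  then have I: "G 1 - G (-1) > 0" using \<kappa>_pos[of z] by simp
  define I where "I = G 1 - G (-1)"
  have I: "I > 0" using I by (simp add: I_def)
  define \<sigma> where "\<sigma> = (\<lambda>x. (G x - G (-1)) / I)"
  have \<sigma>: "(\<sigma> has_real_derivative \<kappa> x / I) (at x)" for x
    unfolding \<sigma>_def using I by (auto intro!: derivative_eq_intros G)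
  have \<sigma>_mono: "\<sigma> x \<le> \<sigma> y" if "x \<le> y" for x y
    by (rule deriv_nonneg_imp_mono[OF \<sigma> _ that]) (use \<kappa>_nonneg I in auto)
  have \<sigma>_left: "\<sigma> x = 0" if "x \<le> -1" for x
  proof (cases "x = -1")
    case False
    then have "x < -1" using that by simp
    then obtain z where "x < z" "z < -1" "\<sigma> (-1) - \<sigma> x = (-1 - x) * (\<kappa> z / I)"
      using mean_value_ge[OF \<sigma>, of x "-1"] by blast
    then show ?thesis using \<kappa>_0[of z] by (simp add: \<sigma>_def)
  qed (simp add: \<sigma>_def)
  have \<sigma>_right: "\<sigma> x = 1" if "x \<ge> 1" for x
  proof (cases "x = 1")
    case False
    then have "1 < x" using that by simp
    then obtain z where "1 < z" "z < x" "\<sigma> x - \<sigma> 1 = (x - 1) * (\<kappa> z / I)"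
      using mean_value_ge[OF \<sigma>, of 1 x] by blast
    then have "\<sigma> x = \<sigma> 1" using \<kappa>_0[of z] by simp
    then show ?thesis using I by (simp add: \<sigma>_def I_def)
  qed (use I in \<open>simp add: \<sigma>_def I_def\<close>)
  have \<sigma>_nonneg: "0 \<le> \<sigma> x" for x
    using \<sigma>_left[of "min x (-1)"] \<sigma>_mono[of "min x (-1)" x] by simp
  have \<sigma>_le_1: "\<sigma> x \<le> 1" for x
    using \<sigma>_right[of "max x 1"] \<sigma>_mono[of x "max x 1"] by simp
  have \<sigma>_smooth: "smooth_on UNIV \<sigma>"
    by (rule smooth_on_real_antiderivative[OF \<sigma>])
       (use smooth_on_cmult[OF open_UNIV \<kappa>_smooth, of "inverse I"] in \<open>simp add: field_simps\<close>)
  obtain F0 where F0: "\<And>x. (F0 has_real_derivative \<sigma> x) (at x)"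
    using ex_antiderivative[OF smooth_on_imp_continuous_on[OF \<sigma>_smooth]] by blast
  define F where "F = (\<lambda>x. F0 x - F0 (-1))"
  have F: "(F has_real_derivative \<sigma> x) (at x)" for x
    unfolding F_def by (auto intro!: derivative_eq_intros F0)
  have F_left: "F x = 0" if "x \<le> -1" for x
  proof (cases "x = -1")
    case False
    then have "x < -1" using that by simp
    then obtain z where "x < z" "z < -1" "F (-1) - F x = (-1 - x) * \<sigma> z"
      using mean_value_ge[OF F, of x "-1"] by blast
    then show ?thesis using \<sigma>_left[of z] by (simp add: F_def)
  qed (simp add: F_def)
  have F_right: "F x = x + (F 1 - 1)" if "x \<ge> 1" for x
  proof (cases "x = 1")
    case False
    then have "1 < x" using that by simp
    then obtain z where "1 < z" "z < x" "F x - F 1 = (x - 1) * \<sigma> z"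
      using mean_value_ge[OF F, of 1 x] by blast
    then show ?thesis using \<sigma>_right[of z] by simp
  qed simp
  have F_mono: "F x \<le> F y" if "x \<le> y" for x y
    by (rule deriv_nonneg_imp_mono[OF F _ that]) (rule \<sigma>_nonneg)
  have F_nonneg: "0 \<le> F x" for x
    using F_left[of "min x (-1)"] F_mono[of "min x (-1)" x] by simp
  obtain y where "F 1 - F (-1) = (1 - (-1)) * \<sigma> y"
    using mean_value_ge[OF F, of "-1" 1] by auto
  then have "F 1 \<le> 2" using \<sigma>_le_1[of y] F_left[of "-1"] by simp
  moreover have "0 \<le> F 1" by (rule F_nonneg)
  ultimately have c: "-1 \<le> F 1 - 1" "F 1 - 1 \<le> 1" by simp_all
  show thesis
    by (rule that[OF smooth_on_real_antiderivative[OF F \<sigma>_smooth] F \<sigma> \<sigma>_nonneg \<sigma>_le_1 _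
          F_nonneg F_left F_right c])
       (use \<kappa>_nonneg I in simp_all)
qed

section \<open>Contractions of coordinate space\<close>

lemma norm_le_sum_components: "norm (v::complex^'n) \<le> (\<Sum>i\<in>UNIV. norm (v $ i))"
  by (simp add: norm_vec_def L2_set_le_sum)

text \<open>The Schwarz lemma in one variable applies to every component of the restriction of \<open>f\<close> to the complex line
  through \<open>z\<close>. Passing from components to the norm of the vector costs the dimension of the target as a factor,
  which is harmless since \<open>c\<close> can be chosen small in the application to high powers of a contraction.\<close>

lemma Schwarz_lemma_vector:
  fixes f :: "complex^'n \<Rightarrow> complex^'m"
  assumes f: "holo_on UNIV f" "f 0 = 0" and bound: "\<And>z. norm z < R \<Longrightarrow> norm (f z) < c"
    and "c > 0" "norm z < R"
  shows "norm (f z) \<le> CARD('m) * (c / R) * norm z"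
proof (cases "z = 0")
  case True
  then show ?thesis using f by simp
next
  case False
  have R: "R > 0" using assms(5) norm_ge_zero[of z] by linarith
  have "norm (f z $ i) \<le> c / R * norm z" for i
  proof -
    define e where "e = (complex_of_real (R / norm z)) *s z"
    have e: "norm e = R" using False R by (simp add: e_def norm_vector_smult norm_divide)
    let ?\<phi> = "\<lambda>\<zeta>. f (0 + \<zeta> *s e) $ i / of_real c"
    have hol: "?\<phi> holomorphic_on ball 0 1"
      unfolding holomorphic_on_def field_differentiable_def
      using DERIV_cdivide[OF holo_on_line_has_field_derivative[OF f(1)]] has_field_derivative_at_within by blast
    have "norm (?\<phi> \<zeta>) < 1" if "norm \<zeta> < 1" for \<zeta>
    proof -
      have "norm (\<zeta> *s e) < R" using that R by (simp add: norm_vector_smult e)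
      then have "norm (f (\<zeta> *s e)) < c" by (rule bound)
      then have "norm ((f (\<zeta> *s e)) $ i) < c" by (rule le_less_trans[OF Finite_Cartesian_Product.norm_nth_le])
      then show ?thesis using \<open>c > 0\<close> by (simp add: norm_divide)
    qed
    moreover have "norm (complex_of_real (norm z / R)) < 1" using assms(5) R by (simp add: norm_divide)
    moreover have "?\<phi> 0 = 0" using f(2) by simp
    ultimately have "norm (?\<phi> (of_real (norm z / R))) \<le> norm (complex_of_real (norm z / R))"
      by (intro Schwarz_Lemma(1)[OF hol]) auto
    moreover have "complex_of_real (norm z / R) *s e = z"
      using False R by (simp add: e_def vec_eq_iff)
    ultimately show ?thesis using R \<open>c > 0\<close> by (simp add: norm_divide field_simps)
  qed
  then have "(\<Sum>i\<in>UNIV. norm (f z $ i)) \<le> (\<Sum>i\<in>(UNIV::'m set). c / R * norm z)"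
    by (rule sum_mono)
  then show ?thesis using norm_le_sum_components[of "f z"] by simp
qed

text \<open>Integer powers of a bijection, taken in the group of all bijections because the orbits of
  \<open>hopf_proj\<close> are those of the subgroup that \<open>\<gamma>\<close> generates there.\<close>

definition iterate :: "('a \<Rightarrow> 'a) \<Rightarrow> int \<Rightarrow> 'a \<Rightarrow> 'a" where
  "iterate \<gamma> k = \<gamma> [^]\<^bsub>BijGroup UNIV\<^esub> k"

context
  fixes \<gamma> :: "'a \<Rightarrow> 'a"
  assumes bij: "bij \<gamma>"
begin

lemma in_BijGroup: "\<gamma> \<in> carrier (BijGroup UNIV)"
  using bij by (simp add: BijGroup_def Bij_def)

lemma BijGroup_mult: "f \<in> carrier (BijGroup UNIV) \<Longrightarrow> g \<in> carrier (BijGroup UNIV) \<Longrightarrow>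
    f \<otimes>\<^bsub>BijGroup UNIV\<^esub> g = (\<lambda>x. f (g x))"
  by (simp add: BijGroup_def compose_def restrict_UNIV)

lemma iterate_0: "iterate \<gamma> 0 = (\<lambda>x. x)"
  by (simp add: iterate_def int_pow_def BijGroup_def restrict_UNIV)

lemma iterate_1: "iterate \<gamma> 1 = \<gamma>"
  unfolding iterate_def by (rule group.int_pow_1[OF group_BijGroup in_BijGroup])

lemma iterate_add: "iterate \<gamma> (j + k) x = iterate \<gamma> j (iterate \<gamma> k x)"
  unfolding iterate_def
  by (simp add: group.int_pow_mult[OF group_BijGroup in_BijGroup] BijGroup_mult
      group.int_pow_closed[OF group_BijGroup in_BijGroup])

lemma iterate_uminus_1: "iterate \<gamma> (-1) = inv_into UNIV \<gamma>"
proof -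
  have "\<gamma> \<in> Bij UNIV" using bij by (simp add: Bij_def)
  then show ?thesis
    unfolding iterate_def
    using group.int_pow_neg[OF group_BijGroup in_BijGroup, of 1] group.int_pow_1[OF group_BijGroup in_BijGroup]
    by (simp add: inv_BijGroup restrict_UNIV)
qed

lemma iterate_cancel: "iterate \<gamma> (- k) (iterate \<gamma> k x) = x" "iterate \<gamma> k (iterate \<gamma> (- k) x) = x"
  using iterate_add[of "- k" k x] iterate_add[of k "- k" x] by (simp_all add: iterate_0)

lemma iterate_eq_funpow: "iterate \<gamma> (int n) = \<gamma> ^^ n"
proof (induction n)
  case 0
  then show ?case by (simp add: iterate_0 fun_eq_iff)
next
  case (Suc n)
  then show ?case using iterate_add[of 1 "int n"] by (simp add: fun_eq_iff iterate_1)
qed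

lemma hopf_orbit_range: "(\<lambda>g. g z) ` generate (BijGroup UNIV) {\<gamma>} = range (\<lambda>k. iterate \<gamma> k z)"
  unfolding group.generate_pow[OF group_BijGroup in_BijGroup] iterate_def by auto

end

locale hopf =
  fixes \<gamma> :: "complex^'n \<Rightarrow> complex^'n"
  assumes contraction: "holomorphic_contraction \<gamma>"
    and automorphism: "biholomorphic_automorphism \<gamma>"
begin

abbreviation \<Phi> :: "int \<Rightarrow> complex^'n \<Rightarrow> complex^'n" where "\<Phi> \<equiv> iterate \<gamma>"

lemma bij_\<gamma>: "bij \<gamma>" using automorphism by (simp add: biholomorphic_automorphism_def)

lemma \<gamma>_holo: "holo_on UNIV \<gamma>" and inv_\<gamma>_holo: "holo_on UNIV (inv_into UNIV \<gamma>)"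
  using automorphism by (simp_all add: biholomorphic_automorphism_def)

lemmas \<Phi>_0 = iterate_0[OF bij_\<gamma>] and \<Phi>_1 = iterate_1[OF bij_\<gamma>] and \<Phi>_add = iterate_add[OF bij_\<gamma>]
  and \<Phi>_cancel = iterate_cancel[OF bij_\<gamma>] and \<Phi>_nat = iterate_eq_funpow[OF bij_\<gamma>]

lemma \<Phi>_holo: "holo_on UNIV (\<Phi> k)"
proof (cases k)
  case (nonneg n)
  have "holo_on UNIV (\<Phi> (int n))"
  proof (induction n)
    case 0
    then show ?case using holo_on_id by (simp add: \<Phi>_0)
  next
    case (Suc n)
    have "\<Phi> (int (Suc n)) = (\<lambda>x. \<gamma> (\<Phi> (int n) x))"
      using \<Phi>_add[of 1 "int n"] by (simp add: fun_eq_iff \<Phi>_1)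
    then show ?case
      using holo_on_compose[OF \<gamma>_holo Suc] by simp
  qed
  then show ?thesis using nonneg by simp
next
  case (neg n)
  have "holo_on UNIV (\<Phi> (- int n))" for n
  proof (induction n)
    case 0
    then show ?case using holo_on_id by (simp add: \<Phi>_0)
  next
    case (Suc n)
    have "\<Phi> (- int (Suc n)) = (\<lambda>x. inv_into UNIV \<gamma> (\<Phi> (- int n) x))"
      using \<Phi>_add[of "-1" "- int n"] by (simp add: fun_eq_iff iterate_uminus_1[OF bij_\<gamma>])
    then show ?case
      using holo_on_compose[OF inv_\<gamma>_holo Suc] by simp
  qed
  then show ?thesis using neg by blast
qed

lemma \<Phi>_smooth: "smooth_on UNIV (\<Phi> k)"
  by (rule holo_on_imp_smooth_on[OF \<Phi>_holo])

lemma \<Phi>_continuous: "continuous_on S (\<Phi> k)"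
  using continuous_on_subset[OF holo_on_imp_continuous_on[OF \<Phi>_holo]] by blast

lemma \<Phi>_open_vimage: "open S \<Longrightarrow> open (\<Phi> k -` S)"
  using continuous_on_open_vimage[OF open_UNIV, of "\<Phi> k"] \<Phi>_continuous by auto

lemma \<Phi>_fix_0: "\<Phi> k 0 = 0"
proof (cases "k \<ge> 0")
  case True
  then obtain n where n: "k = int n" using nonneg_int_cases by blast
  have "(\<gamma> ^^ n) 0 = 0"
    using contraction by (induction n) (auto simp: holomorphic_contraction_def)
  then show ?thesis by (simp add: n \<Phi>_nat)
next
  case False
  then obtain n where n: "- k = int n" by (intro that[of "nat (- k)"]) simp
  have "\<Phi> (- k) 0 = 0"
    unfolding n \<Phi>_nat using contraction by (induction n) (auto simp: holomorphic_contraction_def)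
  then show ?thesis using \<Phi>_cancel(2)[of k 0] by simp
qed

lemma \<Phi>_eq_0_iff: "\<Phi> k z = 0 \<longleftrightarrow> z = 0"
  by (metis \<Phi>_cancel(1) \<Phi>_fix_0)

lemma der_\<Phi>_cancel: "der (\<Phi> (- k)) (\<Phi> k x) (der (\<Phi> k) x v) = v"
proof -
  have "((\<lambda>y. \<Phi> (- k) (\<Phi> k y)) has_derivative (\<lambda>v. der (\<Phi> (- k)) (\<Phi> k x) (der (\<Phi> k) x v))) (at x)"
    by (rule has_derivative_compose[OF holo_onD(1)[OF \<Phi>_holo] holo_onD(1)[OF \<Phi>_holo]]) auto
  then have "((\<lambda>y. y) has_derivative (\<lambda>v. der (\<Phi> (- k)) (\<Phi> k x) (der (\<Phi> k) x v))) (at x)"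
    by (simp add: \<Phi>_cancel)
  from has_derivative_unique[OF this has_derivative_ident] show ?thesis by (simp add: fun_eq_iff)
qed

lemma der_\<Phi>_nonzero: "v \<noteq> 0 \<Longrightarrow> der (\<Phi> k) x v \<noteq> 0"
  using der_\<Phi>_cancel[of k x v] linear_0[OF has_derivative_linear[OF holo_onD(1)[OF \<Phi>_holo UNIV_I]]] by metis

text \<open>Powers of \<open>\<gamma>\<close> have injective derivatives, so no positivity is lost.\<close>

lemma strictly_psh_pullback:
  assumes "open T" "smooth_on T f" "\<Phi> k x \<in> T" "strictly_psh_at f (\<Phi> k x)"
  shows "strictly_psh_at (\<lambda>y. f (\<Phi> k y)) x"
  using assms(4) der_\<Phi>_nonzero
  by (simp add: strictly_psh_at_def ddc_holomorphic_pullback[OF \<Phi>_holo assms(1-3)] holo_onD(2)[OF \<Phi>_holo])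

lemma contraction_eventually:
  assumes "compact K" "open U" "0 \<in> U"
  obtains N where "\<And>m. m > N \<Longrightarrow> \<Phi> (int m) ` K \<subseteq> U"
  using contraction assms unfolding holomorphic_contraction_def \<Phi>_nat by metis

text \<open>Some power of \<open>\<gamma>\<close> shrinks the norm near the origin by the Schwarz lemma. A weighted sum of
  \<open>|\<gamma>\<^sup>k z|\<^sup>2\<close> over the \<open>k\<close> below that power telescopes under \<open>\<gamma>\<close>, and the one new term is
  absorbed.\<close>

lemma adapted_psh_function:
  obtains \<rho> s where "smooth_on UNIV \<rho>" "\<And>x. strictly_psh_at \<rho> x" "\<rho> 0 = 0" "\<And>x. (norm x)\<^sup>2 \<le> \<rho> x"
    "0 < s" "s < 1" "\<And>x. norm x \<le> 1 \<Longrightarrow> \<rho> (\<gamma> x) \<le> s * \<rho> x"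
proof -
  \<comment> \<open>chosen so that the Schwarz lemma on the ball of radius two gives the contraction factor one half\<close>
  define c where "c = 1 / real CARD('n)"
  have c: "c > 0" by (simp add: c_def)
  obtain N where N: "\<And>m. m > N \<Longrightarrow> \<Phi> (int m) ` cball 0 2 \<subseteq> ball 0 c"
    using contraction_eventually[of "cball 0 2" "ball 0 c"] c by auto
  define m where "m = Suc N"
  have half: "norm (\<Phi> (int m) x) \<le> norm x / 2" if "norm x \<le> 1" for x
  proof -
    have "norm (\<Phi> (int m) z) < c" if "norm z < 2" for z
      using N[of m] that by (force simp: m_def dist_norm)
    then have "norm (\<Phi> (int m) x) \<le> CARD('n) * (c / 2) * norm x"
      using Schwarz_lemma_vector[OF \<Phi>_holo \<Phi>_fix_0, of 2 m c x] c that by simp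
    then show ?thesis by (simp add: c_def)
  qed
  \<comment> \<open>so that the weight \<open>s\<^sup>-\<^sup>m\<close> of the term left over by telescoping is just compensated by \<open>(1/2)\<^sup>2\<close>\<close>
  define s where "s = root m (1/4)"
  have m: "m > 0" by (simp add: m_def)
  have s: "0 < s" "s < 1" "s ^ m = 1/4"
    using real_root_less_mono[OF m, of "1/4" 1] real_root_pow_pos2[OF m, of "1/4"] m
    by (simp_all add: s_def)
  define q where "q = (\<lambda>k x. \<Phi> (int k) x \<bullet> \<Phi> (int k) x)"
  define \<rho> where "\<rho> = (\<lambda>x. \<Sum>k<m. inverse s ^ k * q k x)"
  have q_smooth: "smooth_on UNIV (q k)" for k
    unfolding q_def by (intro smooth_on_inner_self \<Phi>_smooth open_UNIV)
  have \<rho>_Suc: "\<rho> x = q 0 x + (\<Sum>k<N. inverse s ^ Suc k * q (Suc k) x)" for x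
    unfolding \<rho>_def m_def by (subst sum.lessThan_Suc_shift) simp
  have q0: "q 0 x = (norm x)\<^sup>2" for x by (simp add: q_def \<Phi>_0 power2_norm_eq_inner)
  have q_nonneg: "0 \<le> q k x" for k x by (simp add: q_def)
  show thesis
  proof
    show "smooth_on UNIV \<rho>"
      unfolding \<rho>_def by (intro smooth_on_sum smooth_on_cmult q_smooth open_UNIV)
    show "strictly_psh_at \<rho> x" for x
      unfolding strictly_psh_at_def
    proof (intro allI impI)
      fix v :: "complex^'n" assume v: "v \<noteq> 0"
      have qd: "ddc (q k) x v (\<i> *s v) = 4 * (der (\<Phi> (int k)) x v \<bullet> der (\<Phi> (int k)) x v)" for k
        unfolding q_def by (rule ddc_norm_holomorphic[OF \<Phi>_holo])
      have "ddc \<rho> x v (\<i> *s v) = (\<Sum>k<m. inverse s ^ k * (4 * (der (\<Phi> (int k)) x v \<bullet> der (\<Phi> (int k)) x v)))"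
        unfolding \<rho>_def
        unfolding ddc_sum[OF open_UNIV smooth_on_cmult[OF open_UNIV q_smooth] UNIV_I]
          ddc_cmult[OF open_UNIV q_smooth UNIV_I] qd ..
      also have "\<dots> > 0"
        using der_\<Phi>_nonzero[OF v] s(1) by (intro sum_pos) (auto simp: m_def)
      finally show "ddc \<rho> x v (\<i> *s v) > 0" .
    qed
    show "\<rho> 0 = 0" by (simp add: \<rho>_def q_def \<Phi>_fix_0)
    show "(norm x)\<^sup>2 \<le> \<rho> x" for x
      unfolding \<rho>_Suc q0 using s(1) q_nonneg by (simp add: sum_nonneg)
    show "\<rho> (\<gamma> x) \<le> s * \<rho> x" if "norm x \<le> 1" for x
    proof -
      have "q k (\<gamma> x) = q (Suc k) x" for k
        using \<Phi>_add[of "int k" 1 x] by (simp add: q_def \<Phi>_1 add.commute)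
      then have "\<rho> (\<gamma> x) = s * (\<Sum>k<m. inverse s ^ Suc k * q (Suc k) x)"
        using s(1) by (simp add: \<rho>_def sum_distrib_left mult.assoc[symmetric])
      also have "(\<Sum>k<m. inverse s ^ Suc k * q (Suc k) x) = \<rho> x - q 0 x + inverse s ^ m * q m x"
        unfolding \<rho>_Suc by (simp add: m_def)
      also have "inverse s ^ m * q m x \<le> q 0 x"
      proof -
        have "(norm (\<Phi> (int m) x))\<^sup>2 \<le> (norm x / 2)\<^sup>2"
          using half[OF that] by (intro power_mono) auto
        then have "4 * q m x \<le> q 0 x"
          by (simp add: q_def \<Phi>_0 power2_norm_eq_inner power_divide)
        moreover have "inverse s ^ m = 4" unfolding power_inverse s(3) by simp
        ultimately show ?thesis by simp
      qed
      finally show ?thesis using s(1) by simp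
    qed
  qed (use s in auto)
qed

end

section \<open>The automorphic potential\<close>

lemma strictly_psh_cmult:
  assumes "open S" "smooth_on S f" "x \<in> S" "c > 0" "strictly_psh_at f x"
  shows "strictly_psh_at (\<lambda>y. c * f y) x"
  using assms by (simp add: strictly_psh_at_def ddc_cmult)

lemma strictly_psh_add_const:
  assumes "open S" "smooth_on S f" "x \<in> S" "strictly_psh_at f x"
  shows "strictly_psh_at (\<lambda>y. f y + c) x"
  unfolding strictly_psh_at_def ddc_add[OF assms(1,2) smooth_on_const assms(3)] ddc_const
  using assms(4) by (simp add: strictly_psh_at_def)

lemma strictly_psh_cong_open:
  assumes "open S" "x \<in> S" "\<And>y. y \<in> S \<Longrightarrow> f y = g y" "strictly_psh_at f x"
  shows "strictly_psh_at g x"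
  using assms(4) ddc_cong_open[OF assms(1,2,3)] by (simp add: strictly_psh_at_def)

text \<open>At each point, \<open>dd\<^sup>c\<close> of the glued function is the convex combination of those of \<open>g\<close> and \<open>h\<close>
  with weights \<open>F'\<close> and \<open>1 - F'\<close>, plus a term that is nonnegative because \<open>F\<close> is convex.\<close>

lemma strictly_psh_glue:
  fixes g h :: "complex^'n \<Rightarrow> real"
  assumes F: "smooth_on UNIV F" "\<And>t. (F has_real_derivative F' t) (at t)" "\<And>t. (F' has_real_derivative F'' t) (at t)"
    "\<And>t. 0 \<le> F' t" "\<And>t. F' t \<le> 1" "\<And>t. 0 \<le> F'' t"
    and g: "smooth_on UNIV g" "strictly_psh_at g x" and h: "smooth_on UNIV h" "strictly_psh_at h x"
  shows "strictly_psh_at (\<lambda>y. h y + F (g y - h y)) x"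
  unfolding strictly_psh_at_def
proof (intro allI impI)
  fix v :: "complex^'n" assume v: "v \<noteq> 0"
  let ?q = "\<lambda>y. g y + (-1) * h y"
  let ?A = "ddc g x v (\<i> *s v)" and ?B = "ddc h x v (\<i> *s v)"
  have AB: "?A > 0" "?B > 0" using g(2) h(2) v by (auto simp: strictly_psh_at_def)
  have mh: "smooth_on UNIV (\<lambda>y. (-1) * h y)" by (rule smooth_on_cmult[OF open_UNIV h(1)])
  have q: "smooth_on UNIV ?q" by (rule smooth_on_add[OF open_UNIV g(1) mh])
  have Fq: "smooth_on UNIV (\<lambda>y. F (?q y))" by (rule smooth_on_compose[OF open_UNIV open_UNIV _ q F(1)]) simp
  have "ddc ?q x v (\<i> *s v) = ?A - ?B"
    using ddc_add[OF open_UNIV g(1) mh UNIV_I] ddc_cmult[OF open_UNIV h(1) UNIV_I, of "-1"] by simp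
  then have 1: "ddc (\<lambda>y. h y + F (?q y)) x v (\<i> *s v)
      = ?B + (F'' (?q x) * ((der ?q x v)\<^sup>2 + (der ?q x (\<i> *s v))\<^sup>2) + F' (?q x) * (?A - ?B))"
    using ddc_add[OF open_UNIV h(1) Fq UNIV_I] ddc_compose_real[OF open_UNIV q F(1) UNIV_I F(2,3)] by simp
  have 2: "?B + (F'' (?q x) * ((der ?q x v)\<^sup>2 + (der ?q x (\<i> *s v))\<^sup>2) + F' (?q x) * (?A - ?B))
      \<ge> (1 - F' (?q x)) * ?B + F' (?q x) * ?A"
    using F(6)[of "?q x"] by (simp add: algebra_simps mult_nonneg_nonneg)
  have "(1 - F' (?q x)) * ?B + F' (?q x) * ?A > 0"
  proof (cases "F' (?q x) = 0")
    case False
    then have "F' (?q x) * ?A > 0" using AB F(4)[of "?q x"] by simp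
    moreover have "(1 - F' (?q x)) * ?B \<ge> 0" using AB F(5)[of "?q x"] by simp
    ultimately show ?thesis by linarith
  qed (use AB in simp)
  then have "ddc (\<lambda>y. h y + F (?q y)) x v (\<i> *s v) > 0" using 1 2 by linarith
  then show "ddc (\<lambda>y. h y + F (g y - h y)) x v (\<i> *s v) > 0" by simp
qed

locale adapted = hopf \<gamma> for \<gamma> :: "complex^'n \<Rightarrow> complex^'n" +
  fixes \<rho> :: "complex^'n \<Rightarrow> real" and s :: real
  assumes \<rho>_smooth: "smooth_on UNIV \<rho>" and \<rho>_psh: "strictly_psh_at \<rho> x" and \<rho>_0: "\<rho> 0 = 0"
    and norm_le_\<rho>: "(norm x)\<^sup>2 \<le> \<rho> x" and s_pos: "0 < s" and s_less_1: "s < 1"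
    and \<rho>_\<gamma>: "norm x \<le> 1 \<Longrightarrow> \<rho> (\<gamma> x) \<le> s * \<rho> x"
begin

lemma continuous_\<rho>: "continuous_on S (\<lambda>x. \<rho> (\<Phi> k x))"
  using continuous_on_compose2[OF smooth_on_imp_continuous_on[OF \<rho>_smooth] \<Phi>_continuous] by simp

lemma continuous_\<rho>': "continuous_on S \<rho>"
  using continuous_\<rho>[of S 0] by (simp add: \<Phi>_0)

lemma compact_sublevel: "compact {x. \<rho> x \<le> 1}"
proof -
  have "{x. \<rho> x \<le> 1} \<subseteq> cball 0 1"
  proof
    fix x assume "x \<in> {x. \<rho> x \<le> 1}"
    then have "(norm x)\<^sup>2 \<le> 1" using norm_le_\<rho>[of x] by simp
    then show "x \<in> cball 0 1" by (simp add: power_le_one_iff)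
  qed
  moreover have "closed {x. \<rho> x \<le> 1}" by (intro closed_Collect_le continuous_\<rho>' continuous_intros)
  ultimately show ?thesis
    using compact_Int_closed[OF compact_cball, of "{x. \<rho> x \<le> 1}" 0 1] by (simp add: Int_absorb1)
qed

lemma \<rho>_\<Phi>_1: "\<rho> x \<le> 1 \<Longrightarrow> \<rho> (\<Phi> 1 x) \<le> s"
proof -
  assume 1: "\<rho> x \<le> 1"
  then have "(norm x)\<^sup>2 \<le> 1" using norm_le_\<rho>[of x] by simp
  then have "norm x \<le> 1" by (simp add: power_le_one_iff)
  then have "\<rho> (\<gamma> x) \<le> s * \<rho> x" by (rule \<rho>_\<gamma>)
  also have "\<dots> \<le> s" using 1 s_pos by simp
  finally show ?thesis by (simp add: \<Phi>_1)
qed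

text \<open>The sets \<open>\<gamma>\<^sup>j {\<rho> \<le> 1}\<close> are nested, each in the interior of the preceding one.\<close>

lemma \<rho>_decreasing:
  assumes "\<rho> (\<Phi> (- j) z) \<le> 1" "i < j"
  shows "\<rho> (\<Phi> (- i) z) \<le> s"
  using assms(2)
proof (induction i rule: int_less_induct)
  case base
  then show ?case using \<rho>_\<Phi>_1[OF assms(1)] \<Phi>_add[of 1 "- j" z] by simp
next
  case (step i)
  have "\<rho> (\<Phi> (- i) z) \<le> 1" using step.IH s_less_1 by simp
  then show ?case using \<rho>_\<Phi>_1[of "\<Phi> (- i) z"] \<Phi>_add[of 1 "- i" z] by simp
qed

text \<open>The shell number \<open>j\<close> is the image under \<open>\<gamma>\<^sup>j\<close> of the half-open fundamental domain
  \<open>{\<rho> \<le> 1} - \<gamma> {\<rho> \<le> 1}\<close>.\<close>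

definition in_shell :: "complex^'n \<Rightarrow> int \<Rightarrow> bool" where
  "in_shell z j \<longleftrightarrow> \<rho> (\<Phi> (- j) z) \<le> 1 \<and> 1 < \<rho> (\<Phi> (- j - 1) z)"

text \<open>Powers of the contraction bring \<open>z\<close> into \<open>{\<rho> \<le> 1}\<close>; conversely high powers shrink the whole
  compact set \<open>{\<rho> \<le> 1}\<close> so much that \<open>z\<close> is no longer in its image. By nestedness there is exactly one
  transition.\<close>

lemma ex1_shell:
  assumes "z \<noteq> 0"
  shows "\<exists>!j. in_shell z j"
proof (rule ex_ex1I)
  obtain N where "\<And>m. m > N \<Longrightarrow> \<Phi> (int m) ` {z} \<subseteq> {x. \<rho> x < 1}"
    using contraction_eventually[of "{z}" "{x. \<rho> x < 1}"] \<rho>_0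
      open_Collect_less[OF continuous_\<rho>' continuous_on_const] by auto
  then have "\<Phi> (int (Suc N)) ` {z} \<subseteq> {x. \<rho> x < 1}" by blast
  then have j0: "\<rho> (\<Phi> (- (- int (Suc N))) z) \<le> 1" by (simp add: add.commute)
  obtain M where M: "\<And>m. m > M \<Longrightarrow> \<Phi> (int m) ` {x. \<rho> x \<le> 1} \<subseteq> ball 0 (norm z)"
    using contraction_eventually[OF compact_sublevel, of "ball 0 (norm z)"] assms by auto
  have j1: "\<not> \<rho> (\<Phi> (- int (Suc M)) z) \<le> 1"
  proof
    assume "\<rho> (\<Phi> (- int (Suc M)) z) \<le> 1"
    then have "\<Phi> (int (Suc M)) (\<Phi> (- int (Suc M)) z) \<in> ball 0 (norm z)" using M[of "Suc M"] by blast
    then show False by (simp only: \<Phi>_cancel) simp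
  qed
  show "\<exists>j. in_shell z j"
  proof (rule ccontr)
    assume "\<not> (\<exists>j. in_shell z j)"
    then have step: "\<rho> (\<Phi> (- (j + 1)) z) \<le> 1" if "\<rho> (\<Phi> (- j) z) \<le> 1" for j
      using that by (auto simp: in_shell_def not_less)
    have "- int (Suc N) \<le> int (Suc M)" by simp
    then have "\<rho> (\<Phi> (- int (Suc M)) z) \<le> 1"
      by (induction rule: int_ge_induct) (use j0 step in auto)
    then show False using j1 by simp
  qed
  have False if "in_shell z i" "in_shell z j" "i < j" for i j
  proof (cases "i + 1 = j")
    case True
    then show ?thesis using that by (auto simp: in_shell_def)
  next
    case False
    then show ?thesis
      using that \<rho>_decreasing[of j z "i + 1"] s_less_1 by (auto simp: in_shell_def)
  qed
  then show "i = j" if "in_shell z i" "in_shell z j" for i j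
    using that by (metis linorder_neqE)
qed

definition shell_index :: "complex^'n \<Rightarrow> int" where
  "shell_index z = (THE j. in_shell z j)"

lemma in_shell_index: "z \<noteq> 0 \<Longrightarrow> in_shell z (shell_index z)"
  unfolding shell_index_def by (rule theI'[OF ex1_shell])

lemma shell_index_eqI: "z \<noteq> 0 \<Longrightarrow> in_shell z j \<Longrightarrow> shell_index z = j"
  using ex1_shell in_shell_index by blast

lemma in_shell_\<Phi>: "in_shell (\<Phi> k z) (j + k) \<longleftrightarrow> in_shell z j"
  using \<Phi>_add[of "- (j + k)" k z] \<Phi>_add[of "- (j + k) - 1" k z] by (simp add: in_shell_def)

lemma shell_index_\<Phi>: "z \<noteq> 0 \<Longrightarrow> shell_index (\<Phi> k z) = shell_index z + k"
  by (rule shell_index_eqI) (simp_all add: \<Phi>_eq_0_iff in_shell_\<Phi> in_shell_index)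

text \<open>On the shell number zero the potential is \<open>u = h + F (g - h)\<close>, a smooth version of \<open>max g h\<close>; the
  other shells receive it by automorphy. The point of the proof is that \<open>\<psi> = u\<close> not only on the half-open shell
  but in a full neighbourhood of each of its points. At a point with \<open>\<rho> = 1\<close> the neighbours with \<open>\<rho> > 1\<close> belong
  to the shell number \<open>-1\<close>. Its image under \<open>\<gamma>\<close> lies where \<open>h\<close> dominates, so that there
  \<open>\<psi> = a\<^sup>-\<^sup>1 (h \<circ> \<gamma>) = g + c\<close>; and \<open>u = g + c\<close> as well, since \<open>g\<close> dominates.\<close>

lemma adapted_automorphic_potential:
  obtains a \<psi> where "0 < a" "a < 1" "smooth_on (UNIV - {0}) \<psi>"
    "\<And>z. z \<noteq> 0 \<Longrightarrow> \<psi> z > 0" "\<And>z. z \<noteq> 0 \<Longrightarrow> strictly_psh_at \<psi> z"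
    "\<And>k z. z \<noteq> 0 \<Longrightarrow> \<psi> (\<Phi> k z) = a powi k * \<psi> z"
proof -
  obtain F F' F'' c where F: "smooth_on UNIV F"
    "\<And>t. (F has_real_derivative F' t) (at t)" "\<And>t. (F' has_real_derivative F'' t) (at t)"
    "\<And>t. 0 \<le> F' t" "\<And>t. F' t \<le> 1" "\<And>t. 0 \<le> F'' t"
    and F_nonneg: "\<And>t. 0 \<le> F t" and F_left: "\<And>t. t \<le> -1 \<Longrightarrow> F t = 0"
    and F_right: "\<And>t. t \<ge> 1 \<Longrightarrow> F t = t + c" and c: "-1 \<le> c" "c \<le> 1"
    using smooth_convex_profile by blast
  \<comment> \<open>normalized to have the values \<open>-2\<close> at \<open>\<rho> = s\<close> and \<open>2\<close> at \<open>\<rho> = 1\<close>, which leaves room for the width of \<open>F\<close>\<close>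
  define C where "C = 4 / (1 - s)"
  define g where "g = (\<lambda>x. C * (\<rho> x - (1 + s) / 2))"
  have C: "C > 0" using s_less_1 by (simp add: C_def)
  have g_mono: "g x \<le> g y \<longleftrightarrow> \<rho> x \<le> \<rho> y" for x y using C by (simp add: g_def)
  have g_eq: "g x = C * (\<rho> x - s) - 2" "g x = C * (\<rho> x - 1) + 2" for x
    using s_less_1 by (simp_all add: g_def C_def field_simps)
  have g_inner: "g x \<le> -2" if "\<rho> x \<le> s" for x
    using that C by (simp add: g_eq(1) mult_le_0_iff)
  have g_outer: "g x \<ge> 2" if "\<rho> x \<ge> 1" for x
    using that C by (simp add: g_eq(2))
  have g_smooth: "smooth_on UNIV g"
    unfolding g_def by (intro smooth_on_cmult smooth_on_diff smooth_on_const \<rho>_smooth open_UNIV)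
  have g_psh: "strictly_psh_at g x" for x
  proof -
    have *: "smooth_on UNIV (\<lambda>x. \<rho> x + - ((1 + s) / 2))"
      by (intro smooth_on_add smooth_on_const \<rho>_smooth open_UNIV)
    have "strictly_psh_at (\<lambda>x. \<rho> x + - ((1 + s) / 2)) x"
      by (rule strictly_psh_add_const[OF open_UNIV \<rho>_smooth UNIV_I \<rho>_psh])
    from strictly_psh_cmult[OF open_UNIV * UNIV_I C this] show ?thesis by (simp add: g_def)
  qed
  \<comment> \<open>the summand \<open>c\<close> makes \<open>h\<close> match \<open>a\<close> times the outer values \<open>g + c\<close> of \<open>u\<close>\<close>
  define h0 where "h0 = (\<lambda>x. g (\<Phi> (- 1) x) + c)"
  have h0_smooth: "smooth_on UNIV h0"
    unfolding h0_def
    by (intro smooth_on_add smooth_on_const smooth_on_compose[OF open_UNIV open_UNIV _ \<Phi>_smooth g_smooth] open_UNIV subset_UNIV)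
  have h0_psh: "strictly_psh_at h0 x" for x
    unfolding h0_def
    by (rule strictly_psh_add_const[OF open_UNIV
        smooth_on_compose[OF open_UNIV open_UNIV subset_UNIV \<Phi>_smooth g_smooth] UNIV_I
        strictly_psh_pullback[OF open_UNIV g_smooth UNIV_I g_psh]])
  obtain H where H: "H > 0" "\<And>x. \<rho> x \<le> 1 \<Longrightarrow> \<bar>h0 x\<bar> \<le> H"
  proof -
    have "compact (h0 ` {x. \<rho> x \<le> 1})"
      using compact_continuous_image[OF continuous_on_subset[OF smooth_on_imp_continuous_on[OF h0_smooth]] compact_sublevel]
      by simp
    then show thesis
      using compact_imp_bounded[of "h0 ` {x. \<rho> x \<le> 1}"] that unfolding bounded_pos by auto
  qed
  \<comment> \<open>small enough for \<open>h \<le> 1/2\<close> on \<open>{\<rho> \<le> 1}\<close>, whence \<open>g - h > 1\<close> near \<open>{\<rho> = 1}\<close>\<close>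
  define a where "a = min (1/2) (1 / (2 * H))"
  have a: "0 < a" "a < 1" using H(1) by (simp_all add: a_def)
  define h where "h = (\<lambda>x. a * h0 x)"
  have h_small: "h x \<le> 1/2" if "\<rho> x \<le> 1" for x
  proof -
    have "h x \<le> a * H" unfolding h_def using H(2)[OF that] a(1) by (intro mult_left_mono) auto
    also have "\<dots> \<le> 1 / (2 * H) * H" using H(1) by (intro mult_right_mono) (auto simp: a_def)
    finally show ?thesis using H(1) by simp
  qed
  have h_pos: "h x > 0" if "\<rho> (\<Phi> (- 1) x) \<ge> 1" for x
    using g_outer[OF that] c(1) a(1) by (simp add: h_def h0_def)
  have h_smooth: "smooth_on UNIV h" unfolding h_def by (rule smooth_on_cmult[OF open_UNIV h0_smooth])
  have h_psh: "strictly_psh_at h x" for x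
    unfolding h_def by (rule strictly_psh_cmult[OF open_UNIV h0_smooth UNIV_I a(1) h0_psh])
  define u where "u = (\<lambda>x. h x + F (g x - h x))"
  have u_smooth: "smooth_on UNIV u"
    unfolding u_def
    by (intro smooth_on_add smooth_on_compose[OF open_UNIV open_UNIV _ _ F(1)] smooth_on_diff
        h_smooth g_smooth open_UNIV subset_UNIV)
  have u_psh: "strictly_psh_at u x" for x
    unfolding u_def by (rule strictly_psh_glue[OF F g_smooth g_psh h_smooth h_psh])
  define \<psi> where "\<psi> = (\<lambda>z. a powi shell_index z * u (\<Phi> (- shell_index z) z))"
  have \<psi>_\<Phi>: "\<psi> (\<Phi> k z) = a powi k * \<psi> z" if "z \<noteq> 0" for k z
  proof -
    have "\<Phi> (- (shell_index z + k)) (\<Phi> k z) = \<Phi> (- shell_index z) z"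
      using \<Phi>_add[of "- (shell_index z + k)" k z] by simp
    moreover have "a powi (shell_index z + k) = a powi k * a powi shell_index z"
      using a(1) by (simp add: power_int_add mult.commute)
    ultimately show ?thesis by (simp add: \<psi>_def shell_index_\<Phi>[OF that])
  qed
  have \<psi>_shell_0: "\<psi> w = u w" if "w \<noteq> 0" "in_shell w 0" for w
    using shell_index_eqI[OF that] by (simp add: \<psi>_def \<Phi>_0)
  have cont: "continuous_on UNIV (\<lambda>x. f (\<Phi> k x))" if "smooth_on UNIV f" for f :: "complex^'n \<Rightarrow> real" and k
    using continuous_on_compose2[OF smooth_on_imp_continuous_on[OF that] \<Phi>_continuous] by simp
  have cont0: "continuous_on UNIV f" if "smooth_on UNIV f" for f :: "complex^'n \<Rightarrow> real"
    by (rule smooth_on_imp_continuous_on[OF that])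
  have near_shell_0: "\<exists>V. open V \<and> z \<in> V \<and> (\<forall>w\<in>V. w \<noteq> 0 \<and> \<psi> w = u w)"
    if z: "z \<noteq> 0" "in_shell z 0" for z
  proof (cases "\<rho> z < 1")
    case True
    let ?V = "(UNIV - {0}) \<inter> {w. \<rho> w < 1} \<inter> {w. 1 < \<rho> (\<Phi> (- 1) w)}"
    have "open ?V"
      by (intro open_Int open_Collect_less continuous_\<rho> continuous_\<rho>' continuous_intros open_Diff) auto
    moreover have "z \<in> ?V" using z True by (simp add: in_shell_def)
    moreover have "\<forall>w\<in>?V. w \<noteq> 0 \<and> \<psi> w = u w"
      using \<psi>_shell_0 by (auto simp: in_shell_def \<Phi>_0)
    ultimately show ?thesis by blast
  next
    case False
    then have \<rho>z: "\<rho> z = 1" using z by (simp add: in_shell_def \<Phi>_0)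
    let ?V = "(UNIV - {0}) \<inter> {w. 1 < \<rho> (\<Phi> (- 1) w)} \<inter> {w. g (\<Phi> 1 w) < - 1} \<inter> {w. 1 < g w - h w}"
    have "open ?V"
      by (intro open_Int open_Collect_less continuous_\<rho> cont g_smooth continuous_on_diff cont0 h_smooth continuous_on_const open_Diff) auto
    moreover have "z \<in> ?V"
      using z g_inner[OF \<rho>_\<Phi>_1[of z]] g_outer[of z] h_small[of z] \<rho>z by (auto simp: in_shell_def)
    moreover have "w \<noteq> 0 \<and> \<psi> w = u w" if w: "w \<in> ?V" for w
    proof (cases "\<rho> w \<le> 1")
      case True
      then show ?thesis using w \<psi>_shell_0[of w] by (simp add: in_shell_def \<Phi>_0)
    next
      case False
      have gw: "g w \<ge> 2" using False by (intro g_outer) simp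
      have "\<rho> (\<Phi> 1 w) \<le> 1" using w g_outer[of "\<Phi> 1 w"] by fastforce
      then have "in_shell w (- 1)" using False by (simp add: in_shell_def \<Phi>_0)
      then have "\<psi> w = u (\<Phi> 1 w) / a" using w shell_index_eqI[of w "- 1"] by (simp add: \<psi>_def field_simps)
      moreover have "h (\<Phi> 1 w) = a * (g w + c)"
        using \<Phi>_cancel(1)[of 1 w] by (simp add: h_def h0_def)
      moreover have "a * (g w + c) > 0" using a(1) gw c(1) by simp
      ultimately have "\<psi> w = g w + c"
        using w a(1) F_left[of "g (\<Phi> 1 w) - h (\<Phi> 1 w)"] by (simp add: u_def)
      moreover have "u w = g w + c" using w F_right[of "g w - h w"] by (simp add: u_def)
      ultimately show ?thesis using w by simp
    qed
    ultimately show ?thesis by blast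
  qed
  have near: "\<exists>j V. open V \<and> z \<in> V \<and> (\<forall>w\<in>V. w \<noteq> 0 \<and> \<psi> w = a powi j * u (\<Phi> (- j) w))" if z: "z \<noteq> 0" for z
  proof -
    define j where "j = shell_index z"
    have "\<Phi> (- j) z \<noteq> 0" "in_shell (\<Phi> (- j) z) 0"
      using z in_shell_\<Phi>[of "- j" z j] in_shell_index[OF z] by (simp_all add: \<Phi>_eq_0_iff j_def)
    then obtain V where V: "open V" "\<Phi> (- j) z \<in> V" "\<forall>w\<in>V. w \<noteq> 0 \<and> \<psi> w = u w"
      using near_shell_0 by blast
    have "w \<noteq> 0 \<and> \<psi> w = a powi j * u (\<Phi> (- j) w)" if "w \<in> \<Phi> (- j) -` V" for w
      using V(3) that \<psi>_\<Phi>[of "\<Phi> (- j) w" j] by (auto simp: \<Phi>_cancel \<Phi>_fix_0)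
    then show ?thesis using \<Phi>_open_vimage[OF V(1), of "- j"] V(2) by blast
  qed
  have loc_smooth: "smooth_on V (\<lambda>w. u (\<Phi> (- j) w))" "smooth_on V (\<lambda>w. a powi j * u (\<Phi> (- j) w))" for j V
    using smooth_on_compose[OF open_UNIV open_UNIV subset_UNIV \<Phi>_smooth u_smooth]
      smooth_on_cmult[OF open_UNIV] smooth_on_subset by blast+
  show thesis
  proof (rule that[OF a])
    show "smooth_on (UNIV - {0}) \<psi>"
    proof (rule smooth_on_local)
      fix z :: "complex^'n" assume "z \<in> UNIV - {0}"
      then obtain j V where V: "open V" "z \<in> V" "\<forall>w\<in>V. w \<noteq> 0 \<and> \<psi> w = a powi j * u (\<Phi> (- j) w)"
        using near[of z] by blast
      have "smooth_on V \<psi>" by (rule smooth_on_cong[OF V(1) _ loc_smooth(2)]) (use V(3) in simp)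
      then show "\<exists>T. open T \<and> z \<in> T \<and> smooth_on T \<psi>" using V by blast
    qed
    show "strictly_psh_at \<psi> z" if "z \<noteq> 0" for z
    proof -
      obtain j V where V: "open V" "z \<in> V" "\<forall>w\<in>V. w \<noteq> 0 \<and> \<psi> w = a powi j * u (\<Phi> (- j) w)"
        using near[OF \<open>z \<noteq> 0\<close>] by blast
      have "a powi j > 0" using a(1) by simp
      then have "strictly_psh_at (\<lambda>w. a powi j * u (\<Phi> (- j) w)) z"
        using strictly_psh_cmult[OF open_UNIV loc_smooth(1) UNIV_I _ strictly_psh_pullback[OF open_UNIV u_smooth UNIV_I u_psh]]
        by blast
      then show ?thesis by (rule strictly_psh_cong_open[OF V(1,2), rotated]) (use V(3) in simp)
    qed
    show "\<psi> z > 0" if z: "z \<noteq> 0" for z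
    proof -
      let ?y = "\<Phi> (- shell_index z) z"
      have e: "- shell_index z - 1 = - 1 + - shell_index z" by simp
      have "1 < \<rho> (\<Phi> (- shell_index z - 1) z)" using in_shell_index[OF z] by (simp add: in_shell_def)
      then have "\<rho> (\<Phi> (- 1) ?y) \<ge> 1" unfolding e \<Phi>_add by simp
      then have "u ?y > 0" using h_pos[of ?y] F_nonneg[of "g ?y - h ?y"] by (simp add: u_def)
      then show ?thesis using a(1) by (simp add: \<psi>_def)
    qed
  qed (rule \<psi>_\<Phi>)
qed

end

lemma (in hopf) automorphic_potential_exists:
  obtains a \<psi> where "0 < a" "a < 1" "smooth_on (UNIV - {0}) \<psi>"
    "\<And>z. z \<noteq> 0 \<Longrightarrow> \<psi> z > 0" "\<And>z. z \<noteq> 0 \<Longrightarrow> strictly_psh_at \<psi> z"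
    "\<And>k z. z \<noteq> 0 \<Longrightarrow> \<psi> (\<Phi> k z) = a powi k * \<psi> z"
proof -
  obtain \<rho> s where "smooth_on UNIV \<rho>" "\<And>x. strictly_psh_at \<rho> x" "\<rho> 0 = 0" "\<And>x. (norm x)\<^sup>2 \<le> \<rho> x"
    "0 < s" "s < 1" "\<And>x. norm x \<le> 1 \<Longrightarrow> \<rho> (\<gamma> x) \<le> s * \<rho> x"
    using adapted_psh_function by blast
  then interpret adapted \<gamma> \<rho> s by unfold_locales
  show thesis using adapted_automorphic_potential that by blast
qed

section \<open>The quotient manifold\<close>

lemma powi_bounds_imp:
  fixes a :: real
  assumes "0 < a" "a < 1" "a ^ n < a powi m" "a powi m * a ^ n < 1"
  shows "\<bar>m\<bar> < int n"
proof (rule ccontr)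
  assume "\<not> ?thesis"
  then consider "m \<ge> int n" | "- m \<ge> int n" by linarith
  then show False
  proof cases
    case 1
    then obtain k where k: "m = int k" "k \<ge> n" by (metis nonneg_int_cases of_nat_0_le_iff of_nat_le_iff order_trans)
    then show False using power_decreasing[of n k a] assms by simp
  next
    case 2
    then obtain k where k: "- m = int k" "k \<ge> n" by (metis nonneg_int_cases of_nat_0_le_iff of_nat_le_iff order_trans)
    then have "m = - int k" by simp
    then have "a powi m * a ^ k = 1" using assms(1) by (simp add: power_int_minus)
    moreover have "a ^ k \<le> a ^ n" using power_decreasing[of n k a] assms k by simp
    then have "a powi m * a ^ k \<le> a powi m * a ^ n" using assms(1) by (intro mult_left_mono) auto
    ultimately show False using assms(4) by simp
  qed
qed

lemma second_countable_top_of_set: "second_countable (top_of_set (S :: 'a::second_countable_topology set))"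
proof -
  obtain B :: "'a set set" where B: "countable B" "\<And>C. C \<in> B \<Longrightarrow> open C"
      "\<And>T. open T \<Longrightarrow> \<exists>U. U \<subseteq> B \<and> T = \<Union>U"
    using univ_second_countable by blast
  have "\<exists>V\<in>B. x \<in> V \<and> V \<subseteq> U" if "open U" "x \<in> U" for U x
    using B(3)[OF that(1)] that(2) by blast
  then have "second_countable (euclidean :: 'a topology)"
    unfolding second_countable_def using B(1,2) by (intro exI[of _ B]) simp
  then show ?thesis by (rule second_countable_subtopology)
qed

locale hopf_potential = hopf \<gamma> for \<gamma> :: "complex^'n \<Rightarrow> complex^'n" +
  fixes a :: real and \<psi> :: "complex^'n \<Rightarrow> real"
  assumes a_pos: "0 < a" and a_less_1: "a < 1" and \<psi>_smooth: "smooth_on (UNIV - {0}) \<psi>"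
    and \<psi>_pos: "z \<noteq> 0 \<Longrightarrow> \<psi> z > 0" and \<psi>_psh: "z \<noteq> 0 \<Longrightarrow> strictly_psh_at \<psi> z"
    and \<psi>_\<Phi>: "z \<noteq> 0 \<Longrightarrow> \<psi> (\<Phi> k z) = a powi k * \<psi> z"
begin

abbreviation "E \<equiv> UNIV - {0 :: complex^'n}"
abbreviation "p \<equiv> hopf_proj \<gamma>"
abbreviation "X \<equiv> hopf_topology \<gamma>"
abbreviation "Y \<equiv> top_of_set E"

lemma open_E: "open E" by (simp add: open_Diff)

lemma p_eq_range: "p z = range (\<lambda>k. \<Phi> k z)"
  unfolding hopf_proj_def by (rule hopf_orbit_range[OF bij_\<gamma>])

lemma p_eq_iff: "p z = p w \<longleftrightarrow> (\<exists>k. w = \<Phi> k z)"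
proof
  assume "p z = p w"
  moreover have "w \<in> p w" unfolding p_eq_range by (rule range_eqI[of _ _ 0]) (simp add: \<Phi>_0)
  ultimately show "\<exists>k. w = \<Phi> k z" by (auto simp: p_eq_range)
next
  assume "\<exists>k. w = \<Phi> k z"
  then obtain k where w: "w = \<Phi> k z" by blast
  have "range (\<lambda>j. \<Phi> (j + k) z) = range (\<lambda>j. \<Phi> j z)"
  proof -
    have "(\<lambda>j. \<Phi> j z) ` range (\<lambda>j. j + k) = range (\<lambda>j. \<Phi> (j + k) z)" by (rule image_image)
    moreover have "range (\<lambda>j. j + k) = UNIV" by (simp add: surj_plus_right)
    ultimately show ?thesis by metis
  qed
  then show "p z = p w" by (simp add: p_eq_range w \<Phi>_add)
qed

lemma p_\<Phi>: "p (\<Phi> k z) = p z"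
  using p_eq_iff by metis

text \<open>Any two points in a common window have potentials with quotient strictly between \<open>a\<close> and its
  inverse, which is the reason for the square root; so no window meets a nontrivial translate of itself.\<close>

definition window :: "complex^'n \<Rightarrow> (complex^'n) set" where
  "window z = {x. x \<noteq> 0 \<and> sqrt a * \<psi> z < \<psi> x \<and> sqrt a * \<psi> x < \<psi> z}"

lemma open_window: "open (window z)"
proof -
  have c: "continuous_on E \<psi>" by (rule smooth_on_imp_continuous_on[OF \<psi>_smooth])
  have "open (E \<inter> \<psi> -` {sqrt a * \<psi> z<..})" "open (E \<inter> (\<lambda>x. sqrt a * \<psi> x) -` {..<\<psi> z})"
    by (intro continuous_open_preimage c continuous_intros open_E; simp)+
  then have "open ((E \<inter> \<psi> -` {sqrt a * \<psi> z<..}) \<inter> (E \<inter> (\<lambda>x. sqrt a * \<psi> x) -` {..<\<psi> z}))" by blast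
  also have "\<dots> = window z" by (auto simp: window_def)
  finally show ?thesis .
qed

lemma mem_window: "z \<noteq> 0 \<Longrightarrow> z \<in> window z"
  using \<psi>_pos[of z] a_pos a_less_1 by (simp add: window_def)

lemma window_translate:
  assumes "x \<in> window z" "\<Phi> k x \<in> window w"
  shows "a * \<psi> w < a powi k * \<psi> z" "a powi k * a * \<psi> z < \<psi> w" "\<psi> z > 0" "\<psi> w > 0"
proof -
  let ?b = "sqrt a"
  have b: "?b > 0" "?b * ?b = a" using a_pos by simp_all
  have k: "a powi k > 0" using a_pos by simp
  have x: "x \<noteq> 0" "?b * \<psi> z < \<psi> x" "?b * \<psi> x < \<psi> z" using assms(1) by (auto simp: window_def)
  have y: "?b * \<psi> w < a powi k * \<psi> x" "?b * (a powi k * \<psi> x) < \<psi> w"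
    using assms(2) \<psi>_\<Phi>[OF x(1)] by (auto simp: window_def)
  have "?b * (?b * \<psi> w) < ?b * (a powi k * \<psi> x)" using y(1) b(1) by simp
  also have "\<dots> = a powi k * (?b * \<psi> x)" by simp
  also have "\<dots> < a powi k * \<psi> z" using x(3) k by simp
  finally show "a * \<psi> w < a powi k * \<psi> z" using b(2) by (simp only: mult.assoc[symmetric])
  have "a powi k * ?b * (?b * \<psi> z) < a powi k * ?b * \<psi> x" using x(2) k b(1) by simp
  also have "\<dots> < \<psi> w" using y(2) by (simp only: mult.assoc mult.left_commute)
  finally show "a powi k * a * \<psi> z < \<psi> w" using b(2) by (metis mult.assoc)
  have "\<psi> x > 0" using \<psi>_pos[OF x(1)] .
  then show "\<psi> z > 0" "\<psi> w > 0"
    using x(3) y(2) b(1) k by (meson mult_pos_pos order_less_trans)+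
qed

lemma window_unique:
  assumes "x \<in> window z" "\<Phi> k x \<in> window z"
  shows "k = 0"
proof -
  note * = window_translate[OF assms]
  have "a < a powi k" using *(1,3) by simp
  moreover have "a powi k * a < 1" using *(2,3) by simp
  ultimately show ?thesis using powi_bounds_imp[OF a_pos a_less_1, of 1 k] by simp
qed

lemma inj_on_window: "inj_on p (window z)"
proof (rule inj_onI)
  fix x y assume xy: "x \<in> window z" "y \<in> window z" "p x = p y"
  then obtain k where k: "y = \<Phi> k x" using p_eq_iff by blast
  then have "k = 0" using window_unique xy by blast
  then show "x = y" using k by (simp add: \<Phi>_0)
qed

lemma zero_notin_window: "0 \<notin> window z" by (simp add: window_def)

lemma \<Phi>_free: "x \<noteq> 0 \<Longrightarrow> \<Phi> j x = \<Phi> k x \<Longrightarrow> j = k"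
proof -
  assume x: "x \<noteq> 0" and eq: "\<Phi> j x = \<Phi> k x"
  have "\<Phi> (j - k) x = x"
    using \<Phi>_add[of "- k" j x] eq \<Phi>_cancel(1)[of k x] by simp
  then have "j - k = 0" using window_unique[of x x "j - k"] mem_window[OF x] by simp
  then show ?thesis by simp
qed

text \<open>The quotients of \<open>\<psi>\<close> over two windows lie in an interval whose endpoints have ratio \<open>a\<^sup>2\<close>, and so
  at most finitely many powers of \<open>a\<close> do.\<close>

lemma finite_window_meets: "finite {k. \<Phi> k ` window z \<inter> window w \<noteq> {}}"
proof (cases "{k. \<Phi> k ` window z \<inter> window w \<noteq> {}} = {}")
  case False
  then obtain k u where k: "u \<in> window z" "\<Phi> k u \<in> window w" by blast
  have "{l. \<Phi> l ` window z \<inter> window w \<noteq> {}} \<subseteq> {k - 1..k + 1}"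
  proof
    fix l assume "l \<in> {l. \<Phi> l ` window z \<inter> window w \<noteq> {}}"
    then obtain v where l: "v \<in> window z" "\<Phi> l v \<in> window w" by blast
    note A = window_translate[OF k] and B = window_translate[OF l]
    have e: "a powi l = a powi (l - k) * a powi k" using a_pos by (simp add: power_int_diff)
    have pk: "a powi k > 0" using a_pos by simp
    have "a * (a powi k * a * \<psi> z) < a * \<psi> w" using A(2) a_pos by simp
    also have "\<dots> < a powi (l - k) * a powi k * \<psi> z" using B(1) e by simp
    finally have "a ^ 2 * (a powi k * \<psi> z) < a powi (l - k) * (a powi k * \<psi> z)"
      by (simp add: power2_eq_square mult_ac)
    then have 1: "a ^ 2 < a powi (l - k)" using pk A(3) by (simp only: mult_less_cancel_right) (auto dest: mult_pos_pos)
    have "a * (a powi (l - k) * a powi k * a * \<psi> z) < a * \<psi> w" using B(2) e a_pos by simp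
    also have "\<dots> < a powi k * \<psi> z" using A(1) .
    finally have "(a powi (l - k) * a ^ 2) * (a powi k * \<psi> z) < 1 * (a powi k * \<psi> z)"
      by (simp add: power2_eq_square mult_ac)
    then have 2: "a powi (l - k) * a ^ 2 < 1" using pk A(3) by (simp only: mult_less_cancel_right) (auto dest: mult_pos_pos)
    have "\<bar>l - k\<bar> < int 2" by (rule powi_bounds_imp[OF a_pos a_less_1 1 2])
    then show "l \<in> {k - 1..k + 1}" by auto
  qed
  then show ?thesis using finite_subset by blast
qed simp

lemma quotient_map_p: "quotient_map Y X p"
  unfolding hopf_topology_def by (rule quotient_map_quotient_topology)

lemma topspace_X: "topspace X = p ` E"
  using quotient_imp_surjective_map[OF quotient_map_p] by simp

lemma continuous_map_p: "continuous_map Y X p"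
  by (rule quotient_imp_continuous_map[OF quotient_map_p])

lemma preimage_p_image: "{x \<in> E. p x \<in> p ` V} = (\<Union>k. E \<inter> \<Phi> k -` V)"
  by (auto simp: p_eq_iff image_iff)

lemma openin_p_image:
  assumes "open V" "0 \<notin> V"
  shows "openin X (p ` V)"
proof -
  have "open (\<Union>k. E \<inter> \<Phi> k -` V)" using \<Phi>_open_vimage[OF assms(1)] open_E by blast
  then have "openin Y {x \<in> E. p x \<in> p ` V}"
    unfolding preimage_p_image by (simp add: openin_open_eq[OF open_E])
  then show ?thesis using assms(2) by (auto simp: hopf_topology_def openin_quotient_topology)
qed

lemma open_map_p: "open_map Y X p"
  unfolding open_map_def
proof (intro allI impI)
  fix U assume "openin Y U"
  then have "open U" "U \<subseteq> E" by (auto simp: openin_open_eq[OF open_E])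
  then show "openin X (p ` U)" by (intro openin_p_image) auto
qed

lemma homeomorphic_map_p:
  assumes V: "open V" "0 \<notin> V" "inj_on p V"
  shows "homeomorphic_map (top_of_set V) (subtopology X (p ` V)) p"
proof (rule bijective_open_imp_homeomorphic_map)
  have VE: "V \<subseteq> E" using V(2) by auto
  have sub: "top_of_set V = subtopology Y V" using VE by (simp add: subtopology_subtopology Int_absorb1)
  have pV: "p ` V \<subseteq> topspace X" using VE by (auto simp: topspace_X)
  show "continuous_map (top_of_set V) (subtopology X (p ` V)) p"
    unfolding sub by (auto simp: continuous_map_in_subtopology continuous_map_from_subtopology[OF continuous_map_p])
  show "open_map (top_of_set V) (subtopology X (p ` V)) p"
    unfolding open_map_def
  proof (intro allI impI)
    fix U assume "openin (top_of_set V) U"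
    then have U: "open U" "U \<subseteq> V" by (auto simp: openin_open_eq[OF V(1)])
    then have "openin X (p ` U)" using V(2) by (intro openin_p_image) auto
    then show "openin (subtopology X (p ` V)) (p ` U)"
      using U(2) by (subst openin_open_subtopology[OF openin_p_image[OF V(1,2)]]) auto
  qed
  show "p ` topspace (top_of_set V) = topspace (subtopology X (p ` V))"
    using pV by (auto simp: topspace_subtopology)
  show "inj_on p (topspace (top_of_set V))" using V(3) by simp
qed

lemma homeomorphic_map_chart:
  assumes V: "open V" "0 \<notin> V" "inj_on p V"
  shows "homeomorphic_map (subtopology X (p ` V)) (top_of_set V) (inv_into V p)"
proof -
  have pV: "p ` V \<subseteq> topspace X" using V(2) by (auto simp: topspace_X)
  obtain g where g: "homeomorphic_maps (top_of_set V) (subtopology X (p ` V)) p g"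
    using homeomorphic_map_p[OF V] by (auto simp: homeomorphic_map_maps)
  then have "homeomorphic_map (subtopology X (p ` V)) (top_of_set V) g" by (simp add: homeomorphic_maps_map)
  moreover have "g y = inv_into V p y" if "y \<in> topspace (subtopology X (p ` V))" for y
  proof -
    have "y \<in> p ` V" using that by (simp add: topspace_subtopology)
    then obtain x where x: "x \<in> V" "y = p x" by (rule imageE)
    then show ?thesis using g V(3) by (simp add: homeomorphic_maps_def)
  qed
  ultimately show ?thesis by (rule homeomorphic_map_eq)
qed

text \<open>By finiteness, only finitely many translates of a window around \<open>x\<close> have to be kept away from the given
  neighbourhood of \<open>y\<close>.\<close>

lemma Hausdorff_X: "Hausdorff_space X"
  unfolding Hausdorff_space_def topspace_X
proof (intro allI impI, elim conjE imageE)
  fix q r x y assume ne: "q \<noteq> r" and q: "q = p x" "x \<in> E" and r: "r = p y" "y \<in> E"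
  let ?J = "{k. \<Phi> k ` window x \<inter> window y \<noteq> {}}"
  have "\<exists>U W. open U \<and> open W \<and> \<Phi> k x \<in> U \<and> y \<in> W \<and> U \<inter> W = {}" for k
    using hausdorff[of "\<Phi> k x" y] ne q r p_\<Phi> by metis
  then obtain U W where UW: "\<And>k. open (U k)" "\<And>k. open (W k)" "\<And>k. \<Phi> k x \<in> U k" "\<And>k. y \<in> W k" "\<And>k. U k \<inter> W k = {}"
    by metis
  define U' where "U' = window x \<inter> (\<Inter>k\<in>?J. \<Phi> k -` U k)"
  define W' where "W' = window y \<inter> (\<Inter>k\<in>?J. W k)"
  have o: "open U'" "open W'"
    unfolding U'_def W'_def
    by (intro open_Int open_window open_INT finite_window_meets ballI \<Phi>_open_vimage UW)+
  have z: "0 \<notin> U'" "0 \<notin> W'" using zero_notin_window by (auto simp: U'_def W'_def)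
  have "disjnt (p ` U') (p ` W')"
  proof (rule ccontr)
    assume "\<not> ?thesis"
    then obtain u w where uw: "u \<in> U'" "w \<in> W'" "p u = p w" by (auto simp: disjnt_def)
    then obtain k where k: "w = \<Phi> k u" using p_eq_iff by blast
    then have "k \<in> ?J" using uw by (auto simp: U'_def W'_def)
    then have "\<Phi> k u \<in> U k \<inter> W k" using uw k by (auto simp: U'_def W'_def)
    then show False using UW(5) by blast
  qed
  moreover have "x \<in> U'" "y \<in> W'" using q r UW mem_window by (auto simp: U'_def W'_def)
  ultimately show "\<exists>U V. openin X U \<and> openin X V \<and> q \<in> U \<and> r \<in> V \<and> disjnt U V"
    using openin_p_image[OF o(1) z(1)] openin_p_image[OF o(2) z(2)] q r by blast
qed

lemma second_countable_X: "second_countable X"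
  by (rule second_countable_open_map_image[OF continuous_map_p open_map_p _ second_countable_top_of_set])
     (simp add: topspace_X)

lemma connected_E: "connected E"
proof -
  have "2 \<le> DIM(complex^'n)" using zero_less_card_finite[where 'a = 'n] by simp
  then have "connected (- {0 :: complex^'n})"
    by (intro path_connected_imp_connected path_connected_punctured_universe)
  then show ?thesis by (simp add: Compl_eq_Diff_UNIV)
qed

lemma connected_Y: "connected_space Y"
  using connected_E connectedin_iff_connected[of E] by (simp add: connectedin_def)

text \<open>Windows are evenly covered: their translates are the sheets.\<close>

lemma covering_map_p: "covering_map Y X p"
  unfolding covering_map_def
proof (intro conjI ballI continuous_map_p)
  show "p ` topspace Y = topspace X" by (simp add: topspace_X)
  fix q assume "q \<in> topspace X"
  then obtain z where z: "z \<noteq> 0" "q = p z" by (auto simp: topspace_X)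
  let ?V = "window z"
  let ?VV = "range (\<lambda>k. \<Phi> k ` ?V)"
  have img: "\<Phi> k ` S = \<Phi> (- k) -` S" for k S
    by (auto simp: \<Phi>_cancel image_iff) (metis \<Phi>_cancel(2))
  have op: "open (\<Phi> k ` ?V)" for k unfolding img by (rule \<Phi>_open_vimage[OF open_window])
  have z0: "0 \<notin> \<Phi> k ` ?V" for k using zero_notin_window by (auto simp: \<Phi>_eq_0_iff dest: sym)
  have pimg: "p ` \<Phi> k ` ?V = p ` ?V" for k by (simp add: image_image p_\<Phi>)
  have inj: "inj_on p (\<Phi> k ` ?V)" for k
    using inj_on_window[of z] by (auto simp: inj_on_def p_\<Phi>)
  have "\<Union>?VV = {y \<in> topspace Y. p y \<in> p ` ?V}"
  proof -
    have "{y \<in> topspace Y. p y \<in> p ` ?V} = (\<Union>k. E \<inter> \<Phi> k -` ?V)" using preimage_p_image by simp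
    also have "\<dots> = (\<Union>k. \<Phi> k -` ?V)" using zero_notin_window \<Phi>_fix_0 by auto
    also have "\<dots> = (\<Union>k. \<Phi> (- k) -` ?V)"
    proof (intro equalityI subsetI; elim UN_E)
      fix x k assume "x \<in> \<Phi> k -` ?V"
      then show "x \<in> (\<Union>k. \<Phi> (- k) -` ?V)" by (intro UN_I[of "- k"]) simp_all
    next
      fix x k assume "x \<in> \<Phi> (- k) -` ?V"
      then show "x \<in> (\<Union>k. \<Phi> k -` ?V)" by (intro UN_I[of "- k"]) simp_all
    qed
    finally show ?thesis by (simp add: img)
  qed
  moreover have "\<forall>V\<in>?VV. openin Y V"
  proof
    fix V assume "V \<in> ?VV"
    then obtain k where V: "V = \<Phi> k ` ?V" by blast
    have "V \<subseteq> E" using z0[of k] V by auto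
    then show "openin Y V" unfolding openin_open_eq[OF open_E] using op[of k] V by auto
  qed
  moreover have "pairwise disjnt ?VV"
  proof (rule pairwiseI)
    fix A B assume "A \<in> ?VV" "B \<in> ?VV" "A \<noteq> B"
    then obtain j k where jk: "A = \<Phi> j ` ?V" "B = \<Phi> k ` ?V" by blast
    show "disjnt A B"
    proof (rule ccontr)
      assume "\<not> disjnt A B"
      then obtain u v where uv: "u \<in> ?V" "v \<in> ?V" "\<Phi> j u = \<Phi> k v" unfolding jk by (auto simp: disjnt_def)
      then have "\<Phi> (- k + j) u = v" unfolding \<Phi>_add by (simp add: \<Phi>_cancel)
      then have "- k + j = 0" using window_unique[of u z] uv by metis
      then show False using jk \<open>A \<noteq> B\<close> by simp
    qed
  qed
  moreover have "\<forall>V\<in>?VV. homeomorphic_map (subtopology Y V) (subtopology X (p ` ?V)) p"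
  proof
    fix V assume "V \<in> ?VV"
    then obtain k where V: "V = \<Phi> k ` ?V" by blast
    have "V \<subseteq> E" using z0[of k] V by auto
    then have "subtopology Y V = top_of_set V" by (simp add: subtopology_subtopology Int_absorb1)
    then show "homeomorphic_map (subtopology Y V) (subtopology X (p ` ?V)) p"
      using homeomorphic_map_p[OF op z0 inj, of k] V pimg[of k] by simp
  qed
  ultimately show "\<exists>T. q \<in> T \<and> openin X T \<and>
        (\<exists>\<V>. \<Union>\<V> = {y\<in>topspace Y. p y \<in> T} \<and> (\<forall>V\<in>\<V>. openin Y V) \<and> pairwise disjnt \<V> \<and>
           (\<forall>V\<in>\<V>. homeomorphic_map (subtopology Y V) (subtopology X T) p))"
    using openin_p_image[OF open_window zero_notin_window, of z] z mem_window[OF z(1)] by blast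
qed

text \<open>The exponent is locally constant because the projection is locally injective, and constant because the
  punctured space is connected.\<close>

lemma deck_is_iterate:
  assumes "deck_transformation Y p f"
  obtains k where "\<And>x. x \<noteq> 0 \<Longrightarrow> f x = \<Phi> k x"
proof -
  have hom: "homeomorphic_map Y Y f" and pf: "\<And>x. x \<noteq> 0 \<Longrightarrow> p (f x) = p x"
    using assms by (auto simp: deck_transformation_def)
  have cont: "continuous_on E f" using homeomorphic_imp_continuous_map[OF hom] by simp
  have fE: "f x \<noteq> 0" if "x \<noteq> 0" for x
    using homeomorphic_imp_surjective_map[OF hom] that by auto
  have ex: "\<exists>k. f x = \<Phi> k x" if "x \<noteq> 0" for x using pf[OF that] p_eq_iff[of x "f x"] by metis
  define \<kappa> where "\<kappa> = (\<lambda>x. SOME k. f x = \<Phi> k x)"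
  have \<kappa>: "f x = \<Phi> (\<kappa> x) x" if "x \<noteq> 0" for x unfolding \<kappa>_def by (rule someI_ex[OF ex[OF that]])
  have "\<kappa> constant_on E"
  proof (rule locally_constant_imp_constant)
    show "connected E" by (rule connected_E)
    fix x assume x: "x \<in> E"
    define V where "V = window (f x)"
    let ?T = "E \<inter> f -` V \<inter> \<Phi> (\<kappa> x) -` V"
    have fx: "f x \<in> V" using x fE mem_window by (auto simp: V_def)
    have "open ?T"
      unfolding V_def by (intro open_Int \<Phi>_open_vimage open_window continuous_open_preimage[OF cont open_E])
    then have "openin Y ?T" by (auto simp: openin_open_eq[OF open_E])
    moreover have "x \<in> ?T" using x fx \<kappa>[of x] by auto
    moreover have "\<kappa> y = \<kappa> x" if y: "y \<in> ?T" for y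
    proof -
      have "p (f y) = p (\<Phi> (\<kappa> x) y)" using y pf p_\<Phi> by simp
      then have "f y = \<Phi> (\<kappa> x) y" using y inj_on_window[of "f x"] by (auto simp: V_def inj_on_def)
      then show ?thesis using \<kappa>[of y] \<Phi>_free[of y] y by auto
    qed
    ultimately show "\<exists>T. openin Y T \<and> x \<in> T \<and> (\<forall>y\<in>T. \<kappa> y = \<kappa> x)" by blast
  qed
  then obtain k where "\<And>x. x \<in> E \<Longrightarrow> \<kappa> x = k" by (auto simp: constant_on_def)
  then show thesis using that[of k] \<kappa> by auto
qed

end

section \<open>Charts and tensors\<close>

lemma ext_deriv2_cong_open:
  assumes "open S" "x \<in> S" "\<And>y v w. y \<in> S \<Longrightarrow> \<eta> y v w = \<theta> y v w"
  shows "ext_deriv2 \<eta> x u v w = ext_deriv2 \<theta> x u v w"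
proof -
  have "der (\<lambda>y. \<eta> y a b) x c = der (\<lambda>y. \<theta> y a b) x c" for a b c
    by (rule der_cong_open[OF assms(1,2)]) (rule assms(3))
  then show ?thesis by (simp add: ext_deriv2_def)
qed

context hopf_potential
begin

abbreviation "A \<equiv> hopf_atlas \<gamma>"
abbreviation "B \<equiv> pullback_atlas Y p A"

text \<open>The normalized form is invariant under \<open>\<gamma>\<close>, because the potential and its \<open>dd\<^sup>c\<close> are multiplied by the
  same constant.\<close>

definition normalized_form :: "complex^'n \<Rightarrow> complex^'n \<Rightarrow> complex^'n \<Rightarrow> real" where
  "normalized_form x v w = ddc \<psi> x v w / \<psi> x"

lemma normalized_form_\<Phi>:
  assumes x: "x \<noteq> 0"
  shows "normalized_form (\<Phi> m x) (der (\<Phi> m) x v) (der (\<Phi> m) x w) = normalized_form x v w"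
proof -
  have xE: "x \<in> E" using x by simp
  have "ddc \<psi> (\<Phi> m x) (der (\<Phi> m) x v) (der (\<Phi> m) x w) = ddc (\<lambda>y. \<psi> (\<Phi> m y)) x v w"
    by (rule ddc_holomorphic_pullback[OF \<Phi>_holo open_E \<psi>_smooth, symmetric]) (simp add: \<Phi>_eq_0_iff x)
  also have "\<dots> = ddc (\<lambda>y. a powi m * \<psi> y) x v w"
    by (rule ddc_cong_open[OF open_E xE]) (simp add: \<psi>_\<Phi>)
  also have "\<dots> = a powi m * ddc \<psi> x v w" by (rule ddc_cmult[OF open_E \<psi>_smooth xE])
  finally show ?thesis using a_pos by (simp add: normalized_form_def \<psi>_\<Phi>[OF x])
qed

lemma normalized_form_bilinear: "x \<noteq> 0 \<Longrightarrow> bilinear (normalized_form x)"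
  using ddc_bilinear[OF open_E \<psi>_smooth, of x] unfolding bilinear_def normalized_form_def
  by (auto simp: linear_iff add_divide_distrib)

lemma normalized_form_alternating: "normalized_form x v v = 0"
  by (simp add: normalized_form_def ddc_alternating)

lemma normalized_form_i: "x \<noteq> 0 \<Longrightarrow> normalized_form x (\<i> *s v) (\<i> *s w) = normalized_form x v w"
  by (simp add: normalized_form_def ddc_i_invariant[OF open_E \<psi>_smooth])

lemma normalized_form_pos: "x \<noteq> 0 \<Longrightarrow> v \<noteq> 0 \<Longrightarrow> normalized_form x v (\<i> *s v) > 0"
  using \<psi>_psh[of x] \<psi>_pos[of x] by (simp add: normalized_form_def strictly_psh_at_def)

lemma smooth_inverse_\<psi>: "smooth_on E (\<lambda>x. inverse (\<psi> x))"
  by (rule smooth_on_compose[OF open_E open_greaterThan _ \<psi>_smooth smooth_on_inverse])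
     (rule image_subsetI, simp add: \<psi>_pos)

lemma smooth_normalized_form: "smooth_on E (\<lambda>x. normalized_form x v w)"
  unfolding normalized_form_def divide_inverse
  by (intro smooth_on_mult open_E smooth_inverse_\<psi> smooth_on_ddc[OF open_E \<psi>_smooth])

text \<open>Charts of the quotient take values in the punctured space, and by invariance the normalized form may be
  evaluated in any of them. On the covering, the factor \<open>\<psi> x\<close> belongs to the point and not to its coordinates;
  in the standard coordinates the two agree and the product is \<open>dd\<^sup>c \<psi>\<close>.\<close>

definition hopf_form :: "((complex^'n) set, 'n) tensor2" where
  "hopf_form d q v w = normalized_form (snd d q) v w"

definition cover_form :: "(complex^'n, 'n) tensor2" where
  "cover_form c x v w = \<psi> x * normalized_form (snd c x) v w"

lemma A_chartE:
  assumes "d \<in> A"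
  obtains V where "open V" "0 \<notin> V" "inj_on p V" "d = (p ` V, inv_into V p)"
  using assms unfolding hopf_atlas_def by blast

lemma A_chart_image:
  assumes "inj_on p V"
  shows "inv_into V p ` p ` V = V"
  using assms by (simp add: inv_into_image_cancel)

lemma A_chart_inverse:
  assumes "d \<in> A" "q \<in> fst d"
  shows "p (snd d q) = q" "snd d q \<noteq> 0" "inv_into (fst d) (snd d) (snd d q) = q"
proof -
  obtain V where V: "open V" "0 \<notin> V" "inj_on p V" "d = (p ` V, inv_into V p)" using A_chartE[OF assms(1)] .
  obtain x where x: "x \<in> V" "q = p x" using assms(2) V(4) by auto
  then have "snd d q = x" using V(3,4) by simp
  then show "p (snd d q) = q" "snd d q \<noteq> 0" using x V(2) by auto
  have "inj_on (snd d) (fst d)" using V(4) by (simp add: inj_on_inv_into)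
  then show "inv_into (fst d) (snd d) (snd d q) = q" using assms(2) by simp
qed

lemma A_chart_open: "d \<in> A \<Longrightarrow> open (snd d ` fst d)"
  by (erule A_chartE) (simp add: A_chart_image)

lemma A_chart_image_nonzero: "d \<in> A \<Longrightarrow> y \<in> snd d ` fst d \<Longrightarrow> y \<noteq> 0"
  by (erule imageE) (simp add: A_chart_inverse)

lemma A_inv_into: "d \<in> A \<Longrightarrow> y \<in> snd d ` fst d \<Longrightarrow> inv_into (fst d) (snd d) y = p y \<and> p y \<in> fst d \<and> snd d (p y) = y"
  by (erule imageE) (simp add: A_chart_inverse)

text \<open>A chart of the quotient selects a point of each orbit; by continuity it is the same translate for all
  neighbours.\<close>

lemma A_local:
  assumes d: "d \<in> A" and x: "p x \<in> fst d"
  obtains N j where "open N" "x \<in> N" "\<forall>y\<in>N. p y \<in> fst d \<and> snd d (p y) = \<Phi> j y"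
proof -
  obtain V where V: "open V" "0 \<notin> V" "inj_on p V" "d = (p ` V, inv_into V p)" using A_chartE[OF d] .
  obtain z where z: "z \<in> V" "p x = p z" using x V(4) by auto
  then obtain j where j: "z = \<Phi> j x" using p_eq_iff by blast
  show thesis
  proof (intro that[of "\<Phi> j -` V" j] ballI allI)
    show "open (\<Phi> j -` V)" by (rule \<Phi>_open_vimage[OF V(1)])
    show "x \<in> \<Phi> j -` V" using z j by simp
    fix y assume "y \<in> \<Phi> j -` V"
    then have y: "\<Phi> j y \<in> V" by simp
    have py: "p y = p (\<Phi> j y)" by (simp add: p_\<Phi>)
    show "p y \<in> fst d \<and> snd d (p y) = \<Phi> j y"
      unfolding py using y V(3,4) by simp
  qed
qed

lemma B_chartE:
  assumes "c \<in> B"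
  obtains d where "d \<in> A" "open (fst c)" "fst c \<subseteq> E" "inj_on p (fst c)" "p ` fst c \<subseteq> fst d"
    "snd c = (\<lambda>x. snd d (p x))"
  using assms unfolding pullback_atlas_def by (force simp: openin_open_eq[OF open_E] o_def)

lemma B_chart:
  assumes c: "c \<in> B" and x: "x \<in> fst c"
  shows "x \<noteq> 0" "p (snd c x) = p x" "snd c x \<noteq> 0" "inv_into (fst c) (snd c) (snd c x) = x"
proof -
  obtain d where d: "d \<in> A" "open (fst c)" "fst c \<subseteq> E" "inj_on p (fst c)" "p ` fst c \<subseteq> fst d"
    "snd c = (\<lambda>x. snd d (p x))" using B_chartE[OF c] .
  show "x \<noteq> 0" using d x by auto
  have p: "p (snd c y) = p y" "snd c y \<noteq> 0" if "y \<in> fst c" for y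
    using A_chart_inverse[OF d(1), of "p y"] d(5,6) that by auto
  then show "p (snd c x) = p x" "snd c x \<noteq> 0" using x by auto
  have "inj_on (snd c) (fst c)" using d(4) p(1) by (metis inj_on_def)
  then show "inv_into (fst c) (snd c) (snd c x) = x" using x by simp
qed

lemma B_local:
  assumes c: "c \<in> B" and x: "x \<in> fst c"
  obtains N j where "open N" "x \<in> N" "\<forall>y\<in>N. y \<in> fst c \<and> snd c y = \<Phi> j y"
proof -
  obtain d where d: "d \<in> A" "open (fst c)" "fst c \<subseteq> E" "inj_on p (fst c)" "p ` fst c \<subseteq> fst d"
    "snd c = (\<lambda>x. snd d (p x))" using B_chartE[OF c] .
  have px: "p x \<in> fst d" using d x by auto
  obtain j N where N: "open N" "x \<in> N" "\<forall>y\<in>N. p y \<in> fst d \<and> snd d (p y) = \<Phi> j y"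
    using A_local[OF d(1) px] .
  note N = N[rule_format]
  show thesis by (intro that[of "N \<inter> fst c" j] ballI) (use N d(2,6) x in auto)
qed

lemma B_inv_local:
  assumes c: "c \<in> B" and x: "x \<in> fst c"
  obtains N i where "open N" "snd c x \<in> N" "x = \<Phi> i (snd c x)"
    "\<forall>y\<in>N. y \<noteq> 0 \<and> y \<in> snd c ` fst c \<and> \<Phi> i y \<in> fst c \<and> inv_into (fst c) (snd c) y = \<Phi> i y"
proof -
  obtain j N where N: "open N" "x \<in> N" "\<forall>y\<in>N. y \<in> fst c \<and> snd c y = \<Phi> j y"
    using B_local[OF c x] .
  note N = N[rule_format]
  have cx: "snd c x = \<Phi> j x" using N by blast
  show thesis
  proof (intro that[of "\<Phi> (- j) -` N" "- j"] ballI allI)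
    show "open (\<Phi> (- j) -` N)" by (rule \<Phi>_open_vimage[OF N(1)])
    show "snd c x \<in> \<Phi> (- j) -` N" "x = \<Phi> (- j) (snd c x)" using N(2) by (simp_all add: cx \<Phi>_cancel)
    fix y assume "y \<in> \<Phi> (- j) -` N"
    then have y: "\<Phi> (- j) y \<in> fst c" "snd c (\<Phi> (- j) y) = y" using N(3)[of "\<Phi> (- j) y"] by (simp_all add: \<Phi>_cancel)
    show "y \<noteq> 0 \<and> y \<in> snd c ` fst c \<and> \<Phi> (- j) y \<in> fst c \<and> inv_into (fst c) (snd c) y = \<Phi> (- j) y"
      using B_chart(3,4)[OF c y(1)] y by (metis image_eqI)
  qed
qed

text \<open>Identity, projection and deck transformations are powers of \<open>\<gamma>\<close> near each point in any pair of charts,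
  because a chart followed by the projection, or preceded by it, only moves points within their orbits.\<close>

lemma coord_rep_A_A:
  assumes c: "c \<in> A" and d: "d \<in> A" and q: "q \<in> fst c" "q \<in> fst d"
  obtains N m where "open N" "snd c q \<in> N" "\<forall>y\<in>N. coord_rep c d id y = \<Phi> m y" "snd d q = \<Phi> m (snd c q)"
proof -
  let ?y = "snd c q"
  have pq: "p ?y = q" using A_chart_inverse[OF c q(1)] by simp
  then have pd: "p ?y \<in> fst d" using q(2) by simp
  obtain m N where N: "open N" "?y \<in> N" "\<forall>y\<in>N. p y \<in> fst d \<and> snd d (p y) = \<Phi> m y"
    using A_local[OF d pd] .
  note N = N[rule_format]
  show thesis
  proof (intro that[of "N \<inter> snd c ` fst c" m] ballI allI)
    show "open (N \<inter> snd c ` fst c)" using N(1) A_chart_open[OF c] by blast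
    show "?y \<in> N \<inter> snd c ` fst c" using N(2) q(1) by blast
    show "snd d q = \<Phi> m ?y" using N(2,3) pq by metis
    show "coord_rep c d id y = \<Phi> m y" if "y \<in> N \<inter> snd c ` fst c" for y
      using that N(3)[of y] A_inv_into[OF c, of y] by (simp add: coord_rep_def)
  qed
qed

lemma coord_rep_B_A:
  assumes c: "c \<in> B" and d: "d \<in> A" and x: "x \<in> fst c" "p x \<in> fst d"
  obtains N m where "open N" "snd c x \<in> N" "\<forall>y\<in>N. coord_rep c d p y = \<Phi> m y" "snd d (p x) = \<Phi> m (snd c x)"
proof -
  let ?y = "snd c x"
  have px: "p ?y = p x" using B_chart[OF c x(1)] by simp
  then have pd: "p ?y \<in> fst d" using x(2) by simp
  obtain m N where N: "open N" "?y \<in> N" "\<forall>y\<in>N. p y \<in> fst d \<and> snd d (p y) = \<Phi> m y"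
    using A_local[OF d pd] .
  note N = N[rule_format]
  obtain i N' where N': "open N'" "?y \<in> N'" "x = \<Phi> i ?y"
    "\<forall>y\<in>N'. y \<noteq> 0 \<and> y \<in> snd c ` fst c \<and> \<Phi> i y \<in> fst c \<and> inv_into (fst c) (snd c) y = \<Phi> i y"
    using B_inv_local[OF c x(1)] .
  note N' = N'[rule_format]
  show thesis
  proof (intro that[of "N \<inter> N'" m] ballI allI)
    show "open (N \<inter> N')" "?y \<in> N \<inter> N'" using N(1,2) N'(1,2) by auto
    show "snd d (p x) = \<Phi> m ?y" using N(2,3) px by metis
    show "coord_rep c d p y = \<Phi> m y" if "y \<in> N \<inter> N'" for y
      using that N(3)[of y] N'(4)[of y] by (simp add: coord_rep_def p_\<Phi>)
  qed
qed

lemma coord_rep_B_B: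
  assumes c: "c \<in> B" and d: "d \<in> B" and f: "\<And>z. z \<noteq> 0 \<Longrightarrow> f z = \<Phi> k z" and x: "x \<in> fst c" "f x \<in> fst d"
  obtains N m where "open N" "snd c x \<in> N" "\<forall>y\<in>N. coord_rep c d f y = \<Phi> m y" "snd d (f x) = \<Phi> m (snd c x)"
proof -
  let ?y = "snd c x"
  obtain i N where N: "open N" "?y \<in> N" "x = \<Phi> i ?y"
    "\<forall>y\<in>N. y \<noteq> 0 \<and> y \<in> snd c ` fst c \<and> \<Phi> i y \<in> fst c \<and> inv_into (fst c) (snd c) y = \<Phi> i y"
    using B_inv_local[OF c x(1)] .
  note N = N[rule_format]
  obtain j N' where N': "open N'" "f x \<in> N'" "\<forall>y\<in>N'. y \<in> fst d \<and> snd d y = \<Phi> j y"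
    using B_local[OF d x(2)] .
  note N' = N'[rule_format]
  have fx: "f x = \<Phi> k (\<Phi> i ?y)" using f[OF B_chart(1)[OF c x(1)]] N(3) by simp
  have comp: "\<Phi> (j + k + i) y = \<Phi> j (\<Phi> k (\<Phi> i y))" for y by (simp add: \<Phi>_add)
  show thesis
  proof (intro that[of "N \<inter> (\<lambda>y. \<Phi> (k + i) y) -` N'" "j + k + i"] ballI allI)
    show "open (N \<inter> (\<lambda>y. \<Phi> (k + i) y) -` N')" using N(1) \<Phi>_open_vimage[OF N'(1)] by blast
    show "?y \<in> N \<inter> (\<lambda>y. \<Phi> (k + i) y) -` N'" using N(2) N'(2) fx by (simp add: \<Phi>_add)
    show "snd d (f x) = \<Phi> (j + k + i) ?y" using N'(2,3) fx comp by metis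
    fix y assume y: "y \<in> N \<inter> (\<lambda>y. \<Phi> (k + i) y) -` N'"
    then have "f (\<Phi> i y) = \<Phi> k (\<Phi> i y)" using f N(4)[of y] by (simp add: \<Phi>_eq_0_iff)
    then show "coord_rep c d f y = \<Phi> (j + k + i) y"
      using y N(4)[of y] N'(3)[of "\<Phi> (k + i) y"] by (simp add: coord_rep_def comp) (simp add: \<Phi>_add)
  qed
qed

lemma coord_rep_derivative:
  assumes "open N" "x \<in> N" "\<And>y. y \<in> N \<Longrightarrow> r y = \<Phi> m y" "x \<noteq> 0"
  shows "normalized_form (\<Phi> m x) (der r x v) (der r x w) = normalized_form x v w"
  using normalized_form_\<Phi>[OF assms(4), of m v w] frechet_derivative_cong_open[OF assms(1-3)] by simp

lemma holo_on_coord_rep: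
  assumes "\<And>y. y \<in> S \<Longrightarrow> \<exists>m N. open N \<and> y \<in> N \<and> (\<forall>z\<in>N. r z = \<Phi> m z)"
  shows "holo_on S r"
  by (rule holo_on_local) (use assms holo_on_subset[OF \<Phi>_holo] in \<open>metis subset_UNIV\<close>)

lemma complex_manifold_hopf: "complex_manifold X A"
  unfolding complex_manifold_def
proof (intro conjI ballI Hausdorff_X second_countable_X)
  fix d assume d: "d \<in> A"
  obtain V where V: "open V" "0 \<notin> V" "inj_on p V" "d = (p ` V, inv_into V p)" using A_chartE[OF d] .
  show "case d of (U, \<phi>) \<Rightarrow> openin X U \<and> open (\<phi> ` U) \<and>
      homeomorphic_map (subtopology X U) (top_of_set (\<phi> ` U)) \<phi>"
    using openin_p_image[OF V(1,2)] homeomorphic_map_chart[OF V(1-3)] V(1)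
    by (simp add: V(4) A_chart_image[OF V(3)])
next
  show "\<Union> (fst ` A) = topspace X"
  proof
    show "\<Union> (fst ` A) \<subseteq> topspace X"
    proof (rule Union_least, erule imageE)
      fix U c assume U: "U = fst c" and c: "c \<in> A"
      obtain V where V: "open V" "0 \<notin> V" "inj_on p V" "c = (p ` V, inv_into V p)" using A_chartE[OF c] .
      have "V \<subseteq> E" using V(2) by auto
      then show "U \<subseteq> topspace X" unfolding topspace_X U V(4) fst_conv by (rule image_mono)
    qed
    show "topspace X \<subseteq> \<Union> (fst ` A)"
    proof
      fix q assume "q \<in> topspace X"
      then obtain z where z: "z \<noteq> 0" "q = p z" by (auto simp: topspace_X)
      have "(p ` window z, inv_into (window z) p) \<in> A"
        unfolding hopf_atlas_def using open_window zero_notin_window inj_on_window by blast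
      then have "p ` window z \<in> fst ` A" by (rule rev_image_eqI) simp
      then show "q \<in> \<Union> (fst ` A)" using mem_window[OF z(1)] z(2) by blast
    qed
  qed
next
  fix c d assume c: "c \<in> A" and d: "d \<in> A"
  show "holo_on (snd c ` (fst c \<inter> fst d)) (coord_rep c d id)"
  proof (rule holo_on_coord_rep)
    fix y assume "y \<in> snd c ` (fst c \<inter> fst d)"
    then obtain q where q: "q \<in> fst c" "q \<in> fst d" "y = snd c q" by auto
    obtain m N where "open N" "snd c q \<in> N" "\<forall>y\<in>N. coord_rep c d id y = \<Phi> m y" "snd d q = \<Phi> m (snd c q)"
      using coord_rep_A_A[OF c d q(1,2)] .
    then show "\<exists>m N. open N \<and> y \<in> N \<and> (\<forall>z\<in>N. coord_rep c d id z = \<Phi> m z)"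
      unfolding q(3) by (intro exI[of _ m] exI[of _ N]) simp
  qed
qed

lemma hermitian_metric_hopf_form: "hermitian_metric A hopf_form"
  unfolding hermitian_metric_def two_form_def
proof (intro conjI ballI allI impI)
  fix d assume d: "d \<in> A"
  note inv = A_chart_inverse[OF d]
  fix q assume q: "q \<in> fst d"
  have "hopf_form d q = normalized_form (snd d q)" by (simp add: hopf_form_def fun_eq_iff)
  then show "bilinear (hopf_form d q)" using normalized_form_bilinear[OF inv(2)[OF q]] by simp
  fix v
  show "hopf_form d q v v = 0" by (simp add: hopf_form_def normalized_form_alternating)
  show "hopf_form d q (\<i> *s v) (\<i> *s w) = hopf_form d q v w" for w
    by (simp add: hopf_form_def normalized_form_i[OF inv(2)[OF q]])
  show "hopf_form d q v (\<i> *s v) > 0" if "v \<noteq> 0"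
    using normalized_form_pos[OF inv(2)[OF q] that] by (simp add: hopf_form_def)
next
  fix d v w assume d: "d \<in> A"
  show "smooth_on (snd d ` fst d) (\<lambda>x. local_tensor d hopf_form x v w)"
  proof (rule smooth_on_cong[OF A_chart_open[OF d]])
    show "smooth_on (snd d ` fst d) (\<lambda>x. normalized_form x v w)"
      by (rule smooth_on_subset[OF smooth_normalized_form]) (use A_chart_image_nonzero[OF d] in auto)
    show "normalized_form x v w = local_tensor d hopf_form x v w" if "x \<in> snd d ` fst d" for x
      using A_inv_into[OF d that] by (simp add: local_tensor_def hopf_form_def)
  qed
next
  show "is_pullback A A id hopf_form hopf_form"
    unfolding is_pullback_def Let_def
  proof (intro ballI impI allI)
    fix c d q v w assume c: "c \<in> A" and d: "d \<in> A" and q: "q \<in> fst c" "id q \<in> fst d"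
    have q2: "q \<in> fst d" using q(2) by simp
    obtain m N where N: "open N" "snd c q \<in> N" "\<forall>y\<in>N. coord_rep c d id y = \<Phi> m y" "snd d q = \<Phi> m (snd c q)"
      using coord_rep_A_A[OF c d q(1) q2] .
    note N = N[rule_format]
    show "hopf_form c q v w = hopf_form d (id q) (der (coord_rep c d id) (snd c q) v) (der (coord_rep c d id) (snd c q) w)"
      using coord_rep_derivative[OF N(1-3) A_chart_inverse(2)[OF c q(1)]] by (simp add: hopf_form_def N(4))
  qed
qed

text \<open>Near each point, the coordinates of the covering differ from the standard ones by a power of
  \<open>\<gamma>\<close>, so that the potential and its form are rescaled by a constant.\<close>

lemma cover_form_local:
  assumes c: "c \<in> B" and y0: "y0 \<in> snd c ` fst c"
  obtains N r where "open N" "y0 \<in> N" "N \<subseteq> E" "r > 0"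
    "\<forall>y\<in>N. (\<psi> \<circ> inv_into (fst c) (snd c)) y = r * \<psi> y"
    "\<forall>y\<in>N. \<forall>v w. local_tensor c cover_form y v w = ddc (\<lambda>y. r * \<psi> y) y v w"
proof -
  obtain x where x: "x \<in> fst c" "y0 = snd c x" using y0 by blast
  obtain i N where N: "open N" "snd c x \<in> N" "x = \<Phi> i (snd c x)"
    "\<forall>y\<in>N. y \<noteq> 0 \<and> y \<in> snd c ` fst c \<and> \<Phi> i y \<in> fst c \<and> inv_into (fst c) (snd c) y = \<Phi> i y"
    using B_inv_local[OF c x(1)] .
  note N = N[rule_format]
  show thesis
  proof (intro that[of N "a powi i"] ballI allI)
    show "open N" "y0 \<in> N" "N \<subseteq> E" "a powi i > 0" using N(1,2,4) x a_pos by auto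
    fix y assume y: "y \<in> N"
    then have y': "y \<noteq> 0" "inv_into (fst c) (snd c) y = \<Phi> i y" using N(4) by blast+
    then show "(\<psi> \<circ> inv_into (fst c) (snd c)) y = a powi i * \<psi> y" by (simp add: \<psi>_\<Phi>)
    have "snd c (\<Phi> i y) = y" using y N(4)[OF y] by (metis f_inv_into_f)
    then show "local_tensor c cover_form y v w = ddc (\<lambda>y. a powi i * \<psi> y) y v w" for v w
      using y' \<psi>_pos[of y]
      by (simp add: local_tensor_def cover_form_def normalized_form_def \<psi>_\<Phi> ddc_cmult[OF open_E \<psi>_smooth])
  qed
qed

lemma smooth_scaled_potential: "N \<subseteq> E \<Longrightarrow> smooth_on N (\<lambda>y. r * \<psi> y)"
  by (rule smooth_on_subset[OF smooth_on_cmult[OF open_E \<psi>_smooth]])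

lemma is_pullback_cover_form:
  assumes f: "\<And>z. z \<noteq> 0 \<Longrightarrow> f z = \<Phi> k z"
  shows "is_pullback B B f cover_form (scale_tensor (\<lambda>_. a powi k) cover_form)"
  unfolding is_pullback_def Let_def
proof (intro ballI impI allI)
  fix c d x v w assume c: "c \<in> B" and d: "d \<in> B" and x: "x \<in> fst c" "f x \<in> fst d"
  obtain m N where N: "open N" "snd c x \<in> N" "\<forall>y\<in>N. coord_rep c d f y = \<Phi> m y" "snd d (f x) = \<Phi> m (snd c x)"
    using coord_rep_B_B[OF c d f x] .
  note N = N[rule_format]
  have "\<psi> (f x) = a powi k * \<psi> x" using f \<psi>_\<Phi> B_chart(1)[OF c x(1)] by simp
  then show "scale_tensor (\<lambda>_. a powi k) cover_form c x v w
      = cover_form d (f x) (der (coord_rep c d f) (snd c x) v) (der (coord_rep c d f) (snd c x) w)"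
    using coord_rep_derivative[OF N(1-3) B_chart(3)[OF c x(1)]] by (simp add: cover_form_def scale_tensor_def N(4))
qed

lemma kaehler_metric_cover_form: "kaehler_metric B cover_form"
  unfolding kaehler_metric_def hermitian_metric_def two_form_def
proof (intro conjI ballI allI impI)
  fix c x assume c: "c \<in> B" and x: "x \<in> fst c"
  note ch = B_chart[OF c x]
  have "bilinear (\<lambda>v w. \<psi> x * normalized_form (snd c x) v w)"
    using normalized_form_bilinear[OF ch(3)] unfolding bilinear_def
    by (auto simp: linear_iff algebra_simps)
  then show "bilinear (cover_form c x)" by (simp add: cover_form_def[abs_def])
  fix v
  show "cover_form c x v v = 0" by (simp add: cover_form_def normalized_form_alternating)
  show "cover_form c x (\<i> *s v) (\<i> *s w) = cover_form c x v w" for w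
    by (simp add: cover_form_def normalized_form_i[OF ch(3)])
  show "cover_form c x v (\<i> *s v) > 0" if "v \<noteq> 0"
    using normalized_form_pos[OF ch(3) that] \<psi>_pos[OF ch(1)] by (simp add: cover_form_def)
next
  fix c v w assume c: "c \<in> B"
  show "smooth_on (snd c ` fst c) (\<lambda>x. local_tensor c cover_form x v w)"
  proof (rule smooth_on_local)
    fix y0 assume "y0 \<in> snd c ` fst c"
    then obtain r N where N: "open N" "y0 \<in> N" "N \<subseteq> E"
      "\<forall>y\<in>N. \<forall>v w. local_tensor c cover_form y v w = ddc (\<lambda>y. r * \<psi> y) y v w"
      by (rule cover_form_local[OF c])
    note N = N[rule_format]
    have "smooth_on N (\<lambda>x. local_tensor c cover_form x v w)"
      by (rule smooth_on_cong[OF N(1) _ smooth_on_ddc[OF N(1) smooth_scaled_potential[OF N(3), of r], of v w]])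
         (simp add: N(4))
    then show "\<exists>T. open T \<and> y0 \<in> T \<and> smooth_on T (\<lambda>x. local_tensor c cover_form x v w)" using N by blast
  qed
next
  have "scale_tensor (\<lambda>_. a powi 0) cover_form = cover_form" by (simp add: scale_tensor_def fun_eq_iff)
  then show "is_pullback B B id cover_form cover_form"
    using is_pullback_cover_form[of id 0] by (simp add: \<Phi>_0)
next
  fix c y0 u v w assume c: "c \<in> B" and y0: "y0 \<in> snd c ` fst c"
  obtain r N where N: "open N" "y0 \<in> N" "N \<subseteq> E"
    "\<forall>y\<in>N. \<forall>v w. local_tensor c cover_form y v w = ddc (\<lambda>y. r * \<psi> y) y v w"
    by (rule cover_form_local[OF c y0])
  note N = N[rule_format]
  have "ext_deriv2 (local_tensor c cover_form) y0 u v w = ext_deriv2 (ddc (\<lambda>y. r * \<psi> y)) y0 u v w"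
    by (rule ext_deriv2_cong_open[OF N(1,2,4)])
  also have "\<dots> = 0" by (rule ddc_closed[OF N(1) smooth_scaled_potential[OF N(3)] N(2)])
  finally show "ext_deriv2 (local_tensor c cover_form) y0 u v w = 0" .
qed

lemma lck_covering_cover_form: "lck_covering X A Y p cover_form"
  unfolding lck_covering_def Let_def
proof (intro conjI allI impI connected_Y covering_map_p kaehler_metric_cover_form)
  fix f assume f: "deck_transformation Y p f"
  obtain k where k: "\<And>x. x \<noteq> 0 \<Longrightarrow> f x = \<Phi> k x" using deck_is_iterate[OF f] by blast
  show "holomorphic_map B B Y Y f"
    unfolding holomorphic_map_def
  proof (intro conjI ballI)
    show "continuous_map Y Y f"
      using f unfolding deck_transformation_def by (blast intro: homeomorphic_imp_continuous_map)
    fix c d assume c: "c \<in> B" and d: "d \<in> B"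
    show "holo_on (snd c ` {x \<in> fst c. f x \<in> fst d}) (coord_rep c d f)"
    proof (rule holo_on_coord_rep)
      fix y assume "y \<in> snd c ` {x \<in> fst c. f x \<in> fst d}"
      then obtain x where x: "x \<in> fst c" "f x \<in> fst d" "y = snd c x" by auto
      obtain m N where "open N" "snd c x \<in> N" "\<forall>y\<in>N. coord_rep c d f y = \<Phi> m y" "snd d (f x) = \<Phi> m (snd c x)"
        using coord_rep_B_B[OF c d k x(1,2)] .
      then show "\<exists>m N. open N \<and> y \<in> N \<and> (\<forall>z\<in>N. coord_rep c d f z = \<Phi> m z)"
        unfolding x(3) by (intro exI[of _ m] exI[of _ N]) simp
    qed
  qed
  have "a powi k > 0" using a_pos by simp
  then show "\<exists>a>0. is_pullback B B f cover_form (scale_tensor (\<lambda>_. a) cover_form)"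
    using is_pullback_cover_form[of f k] k by blast
qed

text \<open>This serves for the potential itself and for the conformal factor, its reciprocal.\<close>

lemma smooth_function_on_cover:
  assumes "smooth_on {0<..} F"
  shows "smooth_function B (\<lambda>x. F (\<psi> x))"
  unfolding smooth_function_def
proof (intro ballI, unfold split_beta)
  fix c assume c: "c \<in> B"
  show "smooth_on (snd c ` fst c) ((\<lambda>x. F (\<psi> x)) \<circ> inv_into (fst c) (snd c))"
  proof (rule smooth_on_local)
    fix y0 assume "y0 \<in> snd c ` fst c"
    then obtain r N where N: "open N" "y0 \<in> N" "N \<subseteq> E" "r > 0"
      "\<forall>y\<in>N. (\<psi> \<circ> inv_into (fst c) (snd c)) y = r * \<psi> y"
      by (rule cover_form_local[OF c])
    note N = N[rule_format]
    have "smooth_on N (\<lambda>y. F (r * \<psi> y))"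
      by (rule smooth_on_compose[OF N(1) open_greaterThan _ smooth_scaled_potential[OF N(3)] assms])
         (rule image_subsetI, use N(3,4) \<psi>_pos in \<open>simp add: subset_iff\<close>)
    then have "smooth_on N ((\<lambda>x. F (\<psi> x)) \<circ> inv_into (fst c) (snd c))"
      by (rule smooth_on_cong[OF N(1), rotated]) (use N(5) in simp)
    then show "\<exists>T. open T \<and> y0 \<in> T \<and> smooth_on T ((\<lambda>x. F (\<psi> x)) \<circ> inv_into (fst c) (snd c))"
      using N by blast
  qed
qed

lemma lck_metric_hopf_form: "lck_metric A Y p cover_form hopf_form"
  unfolding lck_metric_def Let_def
proof (intro conjI hermitian_metric_hopf_form exI[of _ "\<lambda>x. inverse (\<psi> x)"] ballI)
  show "smooth_function B (\<lambda>x. inverse (\<psi> x))" by (rule smooth_function_on_cover[OF smooth_on_inverse])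
  show "inverse (\<psi> x) > 0" if "x \<in> topspace Y" for x using \<psi>_pos that by simp
  show "is_pullback B A p hopf_form (scale_tensor (\<lambda>x. inverse (\<psi> x)) cover_form)"
    unfolding is_pullback_def Let_def
  proof (intro ballI impI allI)
    fix c d x v w assume c: "c \<in> B" and d: "d \<in> A" and x: "x \<in> fst c" "p x \<in> fst d"
    obtain m N where N: "open N" "snd c x \<in> N" "\<forall>y\<in>N. coord_rep c d p y = \<Phi> m y" "snd d (p x) = \<Phi> m (snd c x)"
      using coord_rep_B_A[OF c d x] .
    note N = N[rule_format]
    show "scale_tensor (\<lambda>x. inverse (\<psi> x)) cover_form c x v w
      = hopf_form d (p x) (der (coord_rep c d p) (snd c x) v) (der (coord_rep c d p) (snd c x) w)"
      using coord_rep_derivative[OF N(1-3) B_chart(3)[OF c x(1)]] \<psi>_pos[OF B_chart(1)[OF c x(1)]]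
      by (simp add: cover_form_def hopf_form_def scale_tensor_def N(4))
  qed
qed

lemma automorphic_potential_\<psi>: "automorphic_potential A Y p cover_form \<psi>"
  unfolding automorphic_potential_def Let_def
proof (intro conjI ballI allI impI)
  show "smooth_function B \<psi>" using smooth_function_on_cover[OF smooth_on_ident[OF open_greaterThan]] .
  show "\<psi> y > 0" if "y \<in> topspace Y" for y using \<psi>_pos that by simp
  show "is_ddc B \<psi> cover_form"
    unfolding is_ddc_def
  proof (intro ballI allI)
    fix c y0 v w assume c: "c \<in> B" and y0: "y0 \<in> snd c ` fst c"
    obtain r N where N: "open N" "y0 \<in> N"
      "\<forall>y\<in>N. (\<psi> \<circ> inv_into (fst c) (snd c)) y = r * \<psi> y"
      "\<forall>y\<in>N. \<forall>v w. local_tensor c cover_form y v w = ddc (\<lambda>y. r * \<psi> y) y v w"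
      by (rule cover_form_local[OF c y0])
    note N = N[rule_format]
    show "local_tensor c cover_form y0 v w = ddc (\<psi> \<circ> inv_into (fst c) (snd c)) y0 v w"
      unfolding N(4)[OF N(2)] by (rule ddc_cong_open[OF N(1,2) N(3)[symmetric]])
  qed
  fix f assume "deck_transformation Y p f"
  then obtain k where "\<And>x. x \<noteq> 0 \<Longrightarrow> f x = \<Phi> k x" using deck_is_iterate by blast
  then show "\<exists>a. \<forall>y\<in>topspace Y. \<psi> (f y) = a * \<psi> y" using \<psi>_\<Phi> by auto
qed

lemma hopf_admits_lck_metric_with_potential: "admits_lck_metric_with_potential X A"
  unfolding admits_lck_metric_with_potential_def
  using complex_manifold_hopf lck_covering_cover_form lck_metric_hopf_form automorphic_potential_\<psi> by blast

end

theorem corollary4p3: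
  fixes \<gamma> :: "complex^'n \<Rightarrow> complex^'n"
  assumes "holomorphic_contraction \<gamma>"
    and "biholomorphic_automorphism \<gamma>"
  shows "admits_lck_metric_with_potential (hopf_topology \<gamma>) (hopf_atlas \<gamma>)"
proof -
  interpret hopf \<gamma> using assms by unfold_locales
  obtain a \<psi> where "0 < a" "a < 1" "smooth_on (UNIV - {0}) \<psi>"
    "\<And>z. z \<noteq> 0 \<Longrightarrow> \<psi> z > 0" "\<And>z. z \<noteq> 0 \<Longrightarrow> strictly_psh_at \<psi> z"
    "\<And>k z. z \<noteq> 0 \<Longrightarrow> \<psi> (iterate \<gamma> k z) = a powi k * \<psi> z"
    using automorphic_potential_exists by blast
  then interpret hopf_potential \<gamma> a \<psi> by unfold_locales
  show ?thesis by (rule hopf_admits_lck_metric_with_potential)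
qed

end
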